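(* Let $\epsilon>0$ and $\sigma\ge\frac12+\epsilon$ be fixed. For $x,y,z,n\in\mathbb{N}$ with $n\ge3$ put $q=\frac{x^n+y^n}{z^n}$ and $$L(x,y,z,n)=\lim_{\tau\to\infty}\frac{1}{\tau}\int_1^{\frac{q\tau}{\zeta(2\sigma)}}\left|\zeta\left(\tfrac12+it\right)\right|^2{\rm d}t\times\int_{\frac{q\tau}{\zeta(2\sigma)}}^{[\frac{q\tau}{\zeta(2\sigma)}]^1}|\zeta(\sigma+it)|^2{\rm d}t\times\left\{\int_{\frac{q\tau}{\zeta(2\sigma)}}^{[\frac{q\tau}{\zeta(2\sigma)}]^1}\left|\zeta\left(\tfrac12+it\right)\right|^2{\rm d}t\right\}^{-1}.$$ Then the condition "$L(x,y,z,n)\neq1$ for all $x,y,z,n\in\mathbb{N}$ with $n\ge3$" is equivalent to the Fermat–Wiles theorem (that $x^n+y^n=z^n$ has no solution with $x,y,z,n\in\mathbb{N}$, $n\ge3$).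
   Context: $\zeta$ is the Riemann zeta-function. Numbers of the form $\frac{x^n+y^n}{z^n}$ with $x,y,z,n\in\mathbb{N}$, $n\ge3$, are called Fermat's rationals. Let $Z(t)=e^{i\vartheta(t)}\zeta(\frac12+it)$, with $\vartheta$ the Riemann–Siegel theta function. A Jacob's ladder (in the sense of J. Moser) is $\varphi_1(T)=\frac12\varphi(T)$, where $\varphi$ solves the nonlinear integral equation $\int_0^{\mu[\varphi(T)]}Z^2(t)e^{-2t/\varphi(T)}\,{\rm d}t=\int_0^T Z^2(t)\,{\rm d}t$ with an admissible $\mu(y)\ge 7y\ln y$. For sufficiently large $Y$, $[Y]^1$ denotes the first reverse iterate $\varphi_1^{-1}(Y)$, i.e. $\varphi_1([Y]^1)=Y$. Known facts (Moser): $Y<[Y]^1$, $[Y]^1\sim Y$, $[Y]^1-Y=(1-c)\frac{[Y]^1}{\ln [Y]^1}\{1+\mathcal{O}(1/\ln Y)\}$ and $\int_Y^{[Y]^1}|\zeta(\frac12+it)|^2{\rm d}t=(1-c)Y+\mathcal{O}(Y^{1/3+\delta})$ for every fixed $\delta>0$, where $c$ is Euler's constant. *)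

theory Defs
  imports "HOL-Complex_Analysis.Complex_Analysis"
begin

(* The Riemann zeta function: the analytic continuation of the Dirichlet series to the plane
   without 1, unique by the identity theorem. The value at the pole is set to 0, since otherwise
   THE would not pick out a single total function. *)
definition zeta :: "complex \<Rightarrow> complex" where
  "zeta = (THE f. f holomorphic_on (- {1}) \<and>
                  (\<forall>s. Re s > 1 \<longrightarrow> (\<lambda>n. 1 / of_nat (Suc n) powr s) sums f s) \<and>
                  f 1 = 0)"

(* ln_Gamma is the continuous branch of the logarithm of Gamma on the right half-plane that is
   real on the positive axis, as needed for the Riemann-Siegel theta function. *)
definition rs_theta :: "real \<Rightarrow> real" where
  "rs_theta t = Im (ln_Gamma (Complex (1/4) (t/2))) - t / 2 * ln pi"

(* The argument of Re is real for real t, by the functional equation of zeta. *)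
definition hardy_Z :: "real \<Rightarrow> real" where
  "hardy_Z t = Re (exp (\<i> * of_real (rs_theta t)) * zeta (Complex (1/2) t))"

(* Admissible functions on the ray from y0. Moser takes them smooth as well; no regularity is
   imposed here, so all of his functions are included. Starting the ray to the right of 1 keeps
   the lower bound positive. *)
definition admissible :: "(real \<Rightarrow> real) \<Rightarrow> real \<Rightarrow> bool" where
  "admissible \<mu> y0 \<longleftrightarrow>
     1 < y0 \<and> mono_on {y0..} \<mu> \<and> (\<forall>y\<ge>y0. \<mu> y \<ge> 7 * y * ln y)"

definition ladder_equation :: "(real \<Rightarrow> real) \<Rightarrow> real \<Rightarrow> real \<Rightarrow> bool" where
  "ladder_equation \<mu> y T \<longleftrightarrow>
     integral {0..\<mu> y} (\<lambda>t. (hardy_Z t)\<^sup>2 * exp (- (2 * t / y))) =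
     integral {0..T} (\<lambda>t. (hardy_Z t)\<^sup>2)"

(* A ladder is only meaningful on the ray from T0; its values elsewhere are irrelevant. *)
definition jacobs_ladder :: "(real \<Rightarrow> real) \<Rightarrow> real \<Rightarrow> bool" where
  "jacobs_ladder \<phi>\<^sub>1 T0 \<longleftrightarrow> 0 < T0 \<and>
     (\<exists>\<mu> y0 \<phi>. admissible \<mu> y0 \<and>
        (\<forall>T\<ge>T0. y0 \<le> \<phi> T \<and> ladder_equation \<mu> (\<phi> T) T \<and> \<phi>\<^sub>1 T = \<phi> T / 2))"

(* The first reverse iterate of Y, meaningful for all sufficiently large Y. *)
definition reverse_iterate :: "(real \<Rightarrow> real) \<Rightarrow> real \<Rightarrow> real \<Rightarrow> real" where
  "reverse_iterate \<phi>\<^sub>1 T0 Y = inv_into {T0..} \<phi>\<^sub>1 Y"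

definition fermat_rational :: "nat \<Rightarrow> nat \<Rightarrow> nat \<Rightarrow> nat \<Rightarrow> real" where
  "fermat_rational x y z n = (real x ^ n + real y ^ n) / real z ^ n"

(* The series shows that zeta is real at 2 * \<sigma> > 1, so Re is only a change of type. *)
definition fermat_functional ::
    "(real \<Rightarrow> real) \<Rightarrow> real \<Rightarrow> real \<Rightarrow> nat \<Rightarrow> nat \<Rightarrow> nat \<Rightarrow> nat \<Rightarrow> real \<Rightarrow> real" where
  "fermat_functional \<phi>\<^sub>1 T0 \<sigma> x y z n \<tau> =
     (let Y = fermat_rational x y z n * \<tau> / Re (zeta (of_real (2 * \<sigma>)));
          Y' = reverse_iterate \<phi>\<^sub>1 T0 Y
      in 1 / \<tau> * integral {1..Y} (\<lambda>t. (cmod (zeta (Complex (1/2) t)))\<^sup>2)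
           * integral {Y..Y'} (\<lambda>t. (cmod (zeta (Complex \<sigma> t)))\<^sup>2)
           * inverse (integral {Y..Y'} (\<lambda>t. (cmod (zeta (Complex (1/2) t)))\<^sup>2)))"

definition fermat_limit ::
    "(real \<Rightarrow> real) \<Rightarrow> real \<Rightarrow> real \<Rightarrow> nat \<Rightarrow> nat \<Rightarrow> nat \<Rightarrow> nat \<Rightarrow> real" where
  "fermat_limit \<phi>\<^sub>1 T0 \<sigma> x y z n = Lim at_top (fermat_functional \<phi>\<^sub>1 T0 \<sigma> x y z n)"

end

theory Submission
  imports Defs "HOL-Real_Asymp.Real_Asymp"
begin

text \<open>
  Write \<open>G(T)\<close> for the integral of \<open>Z\<^sup>2\<close> over \<open>[0, T]\<close> and \<open>Y'\<close> for the first reverse iterate of \<open>Y\<close>.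
  Everything rests on \<open>G(T) = T ln T + a T + o(T)\<close>. The ladder equation says that \<open>G(Y')\<close> is the
  integral of \<open>Z\<^sup>2(t) exp (-t/Y)\<close> up to a negligible tail, hence \<open>G(Y') = Y ln Y + (a + K) Y + o(Y)\<close> with
  \<open>K\<close> the integral of \<open>u ln u exp (-u)\<close>, which is positive. Therefore \<open>G(Y') - G(Y) \<sim> K Y\<close> and
  \<open>Y' - Y \<sim> K Y / ln Y\<close>. For \<open>\<sigma> > 1/2\<close> the mean value of \<open>|\<zeta>(\<sigma> + it)|\<^sup>2\<close> over an interval of this length is
  asymptotically \<open>\<zeta>(2\<sigma>)\<close>, so that the functional tends to the Fermat rational itself.

  For the mean square, \<open>\<zeta>\<close> is written on the critical line as \<open>A + \<chi> D\<close> plus a small error, where \<open>A\<close> is the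
  sum of \<open>n powr (-s)\<close> over \<open>n \<le> t / (2 \<pi> (j + 1/2))\<close> and \<open>D\<close> the dual sum over \<open>k \<le> j\<close>. With \<open>j\<close> a power
  of \<open>ln T\<close> the sum \<open>A\<close> is so short, and \<open>D\<close> so tiny, that trivial bounds suffice for all off-diagonal terms
  in \<open>|\<zeta>|\<^sup>2 = |\<zeta> - A|\<^sup>2 + 2 Re (\<zeta> cnj A) - |A|\<^sup>2\<close>. The approximation itself, like the functional
  equation, comes from the Fourier series of the sawtooth function in the Euler-Maclaurin formula.
\<close>

section \<open>Euler-Maclaurin sums and the continuation of zeta\<close>

text \<open>With \<open>Y = q \<tau> / \<zeta>(2\<sigma>)\<close> the three factors of the
  functional behave like \<open>q / \<zeta>(2\<sigma>) * ln Y\<close>,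
  \<open>\<zeta>(2\<sigma>) * K Y / ln Y\<close> and \<open>1 / (K Y)\<close>: the logarithms,
  \<open>\<zeta>(2\<sigma>)\<close> and \<open>K\<close> cancel, which is why the limit is exactly
  \<open>q\<close>. The obstacle is that \<open>G(Y') - G(Y)\<close> has order \<open>Y\<close>
  while \<open>G(Y)\<close> has order \<open>Y ln Y\<close>, so the mean square is required with its
  second term. A sum and its dual are usually paired by stationary phase or a Hilbert-type
  inequality; here their lengths are made very unequal instead. The diagonal gives
  \<open>T (H_X + H_j - 1)\<close> with \<open>X\<close> about
  \<open>T / (2 \<pi> (j + 1/2))\<close>: the logarithm lost by shortening \<open>A\<close> is
  regained from the dual sum, so \<open>j\<close> disappears in the limit and
  \<open>a = 2 \<gamma> - ln (2 \<pi>) - 1\<close> remains. The cross term never meets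
  \<open>\<chi>\<close>, because the zeta factor in it is replaced by a long Dirichlet polynomial.
  That large \<open>Y\<close> have a reverse iterate at all follows from the ladder equation itself,
  by strict monotonicity of its left side and the intermediate value theorem.\<close>

text \<open>Euler-Maclaurin sums; their limit is the zeta function for \<open>Re s > -1\<close>, \<open>s \<noteq> 1\<close>.
  At \<open>N = 0\<close> the convention \<open>0 powr a = 0\<close> makes the sum vanish.\<close>
definition em :: "nat \<Rightarrow> complex \<Rightarrow> complex" where
  "em N s = (\<Sum>n=1..N. of_nat n powr (-s)) - of_nat N powr (-s) / 2 - of_nat N powr (1 - s) / (1 - s)"

lemma has_vector_derivative_powr_real:
  assumes "u > 0"
  shows "((\<lambda>u. complex_of_real u powr a) has_vector_derivative a * of_real u powr (a - 1)) (at u within S)"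
proof -
  have "((\<lambda>z. z powr a) has_field_derivative a * of_real u powr (a - 1)) (at (complex_of_real u))"
    using assms by (intro has_field_derivative_powr) (auto simp: complex_nonpos_Reals_iff)
  then show ?thesis by (rule has_vector_derivative_real_field)
qed

lemma norm_powr_of_nonneg_real:
  assumes "u \<ge> 0" shows "norm (complex_of_real u powr a) = u powr Re a"
  using assms by (cases "u = 0") (auto simp: norm_powr_real_powr)

lemma continuous_on_powr_real:
  assumes "\<And>u. u \<in> S \<Longrightarrow> u > 0"
  shows "continuous_on S (\<lambda>u. complex_of_real u powr a)"
proof -
  have "continuous (at u within S) (\<lambda>u. complex_of_real u powr a)" if "u \<in> S" for u
    using has_vector_derivative_continuous has_vector_derivative_powr_real assms that by blast
  then show ?thesis by (simp add: continuous_on_eq_continuous_within)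
qed

text \<open>Continuity down to 0 admits the interval from 0 to 1 in the Euler-Maclaurin step; the
  Fourier expansion behind the functional equation starts there.\<close>

lemma continuous_on_powr_real_0:
  assumes "Re a > 0"
  shows "continuous_on {0..} (\<lambda>u. complex_of_real u powr a)"
proof -
  have "continuous (at u within {0..}) (\<lambda>u. complex_of_real u powr a)" if "u \<ge> 0" for u
  proof (cases "u = 0")
    case True
    have "((\<lambda>u. u powr Re a) \<longlongrightarrow> 0) (at 0 within {0..})"
      using assms by (auto intro!: tendsto_eq_intros eventually_at_le simp: eventually_at_filter)
    then have "((\<lambda>u. norm (complex_of_real u powr a)) \<longlongrightarrow> 0) (at 0 within {0..})"
      by (rule Lim_transform_eventually) (auto simp: eventually_at_filter norm_powr_of_nonneg_real)
    then show ?thesis using True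
      by (simp add: continuous_within tendsto_norm_zero_iff)
  next
    case False
    then show ?thesis
      using has_vector_derivative_continuous has_vector_derivative_powr_real that
      by (metis less_eq_real_def)
  qed
  then show ?thesis by (simp add: continuous_on_eq_continuous_within)
qed

text \<open>Integration by parts against the sawtooth \<open>u - n - 1/2\<close>, whose values -1/2
  and 1/2 at the two ends produce the half terms in \<open>em\<close>. For \<open>n = 0\<close> the
  powers may fail to be differentiable at 0, but their continuity suffices when
  \<open>Re s < 0\<close>.\<close>

lemma em_step_integral:
  assumes "s \<noteq> 1" "n \<ge> 1 \<or> Re s < 0"
  shows "((\<lambda>u. complex_of_real (u - real n - 1/2) * (- s * of_real u powr (- s - 1))) has_integral (em (Suc n) s - em n s))
           {real n..real n + 1}"
proof -
  let ?F = "\<lambda>u. complex_of_real (u - real n - 1/2) * complex_of_real u powr (-s) - of_real u powr (1 - s) / (1 - s)"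
  have "((\<lambda>u. complex_of_real (u - real n - 1/2) * (- s * of_real u powr (- s - 1))) has_integral
          (?F (real n + 1) - ?F (real n))) {real n..real n + 1}"
  proof (rule fundamental_theorem_of_calculus_interior)
    show "continuous_on {real n..real n + 1} ?F"
    proof (cases "n \<ge> 1")
      case True
      then show ?thesis using assms by (intro continuous_intros continuous_on_powr_real) auto
    next
      case False
      then have "Re s < 0" using assms by auto
      then have "continuous_on {real n..real n + 1} (\<lambda>u. complex_of_real u powr (-s))"
        "continuous_on {real n..real n + 1} (\<lambda>u. complex_of_real u powr (1-s))"
        by (auto intro!: continuous_on_subset[OF continuous_on_powr_real_0])
      then show ?thesis using assms by (intro continuous_intros) auto
    qed
    fix u assume u: "u \<in> {real n<..<real n + 1}"
    then have "u > 0" by auto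
    show "(?F has_vector_derivative complex_of_real (u - real n - 1/2) * (- s * of_real u powr (- s - 1))) (at u)"
    proof -
      have "(?F has_vector_derivative (complex_of_real (u - real n - 1/2) * (- s * of_real u powr (- s - 1)) + 1 * of_real u powr (-s))
              - ((1 - s) * of_real u powr (1 - s - 1)) / (1 - s)) (at u)"
        using \<open>u > 0\<close>
        by (intro has_vector_derivative_diff has_vector_derivative_mult has_vector_derivative_powr_real
           has_vector_derivative_divide) 
           (auto intro!: derivative_eq_intros has_vector_derivative_of_real simp: has_real_derivative_iff_has_vector_derivative[symmetric])
      then show ?thesis using assms by simp
    qed
  qed auto
  moreover have "?F (real n + 1) - ?F (real n) = em (Suc n) s - em n s"
    by (simp add: em_def algebra_simps add_divide_distrib)
  ultimately show ?thesis by simp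
qed


lemma powr_real_diff_bound:
  assumes "0 < a" "a \<le> u" "Re b \<le> 1"
  shows "norm (complex_of_real u powr b - of_real a powr b) \<le> norm b * a powr (Re b - 1) * (u - a)"
proof (cases "a = u")
  case False
  have "norm (complex_of_real u powr b - of_real a powr b) \<le> norm b * a powr (Re b - 1) * u - norm b * a powr (Re b - 1) * a"
  proof (rule differentiable_bound_general[where \<phi> = "\<lambda>u. norm b * a powr (Re b - 1) * u" and \<phi>' = "\<lambda>_. norm b * a powr (Re b - 1)"])
    show "a < u" using assms False by simp
    show "continuous_on {a..u} (\<lambda>u. complex_of_real u powr b)"
      using assms by (intro continuous_on_powr_real) auto
    fix x assume x: "a < x" "x < u"
    show "((\<lambda>u. complex_of_real u powr b) has_vector_derivative b * of_real x powr (b - 1)) (at x)"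
      using assms x by (intro has_vector_derivative_powr_real) auto
    show "norm (b * of_real x powr (b - 1)) \<le> norm b * a powr (Re b - 1)"
      using assms x by (auto simp: norm_mult norm_powr_of_nonneg_real intro!: mult_left_mono powr_mono2')
  qed (auto intro!: continuous_intros derivative_eq_intros simp: has_real_derivative_iff_has_vector_derivative[symmetric])
  then show ?thesis by (simp add: algebra_simps)
qed simp

text \<open>The sawtooth has mean 0 over a unit interval, so the constant \<open>G n\<close> may be
  subtracted from \<open>G u\<close>. The difference gains one power of \<open>n\<close>, which
  moves the region of convergence from \<open>Re s > 0\<close> to \<open>Re s > -1\<close>.\<close>

lemma em_step_bound:
  assumes "s \<noteq> 1" "n \<ge> 1" "Re s > -2"
  shows "norm (em (Suc n) s - em n s) \<le> norm s * norm (s + 1) * real n powr (- Re s - 2)"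
proof -
  define G where "G = (\<lambda>u. - s * complex_of_real u powr (- s - 1))"
  have 1: "((\<lambda>u. complex_of_real (u - real n - 1/2) * G u) has_integral (em (Suc n) s - em n s)) {real n..real n + 1}"
    unfolding G_def using em_step_integral[of s n] assms by simp
  have "((\<lambda>u. u - real n - 1/2) has_integral ((real n + 1 - real n - 1/2)^2/2 - (real n - real n - 1/2)^2/2)) {real n..real n + 1}"
    by (intro fundamental_theorem_of_calculus)
       (auto intro!: derivative_eq_intros simp: has_real_derivative_iff_has_vector_derivative[symmetric])
  then have "((\<lambda>u. u - real n - 1/2) has_integral 0) {real n..real n + 1}"
    by (simp add: power2_eq_square)
  then have "((\<lambda>u. complex_of_real (u - real n - 1/2)) has_integral of_real 0) {real n..real n + 1}"
    by (rule has_integral_of_real)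
  then have "((\<lambda>u. complex_of_real (u - real n - 1/2) * G n) has_integral of_real 0 * G n) {real n..real n + 1}"
    by (rule has_integral_mult_left)
  then have 2: "((\<lambda>u. complex_of_real (u - real n - 1/2) * (G u - G n)) has_integral (em (Suc n) s - em n s)) {real n..real n + 1}"
    using has_integral_diff[OF 1, of "\<lambda>u. complex_of_real (u - real n - 1/2) * G n" 0]
    by (simp add: right_diff_distrib)
  have "norm (em (Suc n) s - em n s) \<le> norm s * norm (s + 1) * real n powr (- Re s - 2) * measure lborel (cbox (real n) (real n + 1))"
  proof (rule has_integral_bound)
    show "((\<lambda>u. complex_of_real (u - real n - 1/2) * (G u - G n)) has_integral (em (Suc n) s - em n s)) (cbox (real n) (real n + 1))"
      using 2 by simp
    fix u assume "u \<in> cbox (real n) (real n + 1)"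
    then have u: "real n \<le> u" "u \<le> real n + 1" by auto
    have e: "norm (- s - 1) = norm (s + 1)"
      by (metis minus_add_distrib norm_minus_cancel uminus_add_conv_diff add.commute)
    have e2: "Re (- s - 1) - 1 = - Re s - 2" by simp
    have "norm (G u - G n) = norm s * norm (complex_of_real u powr (-s-1) - of_real (real n) powr (-s-1))"
      unfolding G_def by (subst norm_mult[symmetric]) (simp add: right_diff_distrib norm_minus_commute)
    also have "\<dots> \<le> norm s * (norm (-s-1) * real n powr (Re (-s-1) - 1) * (u - real n))"
      using assms u by (intro mult_left_mono powr_real_diff_bound) auto
    also have "\<dots> \<le> norm s * (norm (-s-1) * real n powr (Re (-s-1) - 1) * 1)"
      using u by (intro mult_left_mono) auto
    finally have *: "norm (G u - G n) \<le> norm s * norm (s + 1) * real n powr (- Re s - 2)"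
      by (simp only: e e2 mult_1_right mult.assoc)
    have "norm (complex_of_real (u - real n - 1/2)) \<le> 1"
      using u by (simp only: norm_of_real)
    then have "norm (complex_of_real (u - real n - 1/2) * (G u - G n)) \<le> 1 * (norm s * norm (s + 1) * real n powr (- Re s - 2))"
      unfolding norm_mult by (intro mult_mono *) auto
    then show "norm (complex_of_real (u - real n - 1/2) * (G u - G n)) \<le> norm s * norm (s + 1) * real n powr (- Re s - 2)"
      by simp
  qed auto
  then show ?thesis by simp
qed

text \<open>The limit of \<open>em\<close>, written as a telescoping series so that the Weierstrass
  test yields locally uniform convergence. It starts at index 1 because the step from 0 to 1 is
  controlled only for \<open>Re s < 0\<close>.\<close>

definition zeta0 :: "complex \<Rightarrow> complex" where
  "zeta0 s = em 1 s + (\<Sum>i. em (i + 2) s - em (i + 1) s)"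

lemma em_telescope: "em (Suc n) s = em 1 s + (\<Sum>i<n. em (i + 2) s - em (i + 1) s)"
  using sum_lessThan_telescope[of "\<lambda>i. em (Suc i) s" n] by simp

lemma em_uniform_limit:
  assumes "\<delta> > 0" and S: "\<And>s. s \<in> S \<Longrightarrow> s \<noteq> 1 \<and> Re s \<ge> -1 + \<delta> \<and> norm s \<le> B"
  shows "uniform_limit S (\<lambda>n. em (Suc n)) zeta0 sequentially"
proof -
  have "uniform_limit S (\<lambda>n s. \<Sum>i<n. em (i + 2) s - em (i + 1) s) (\<lambda>s. \<Sum>i. em (i + 2) s - em (i + 1) s) sequentially"
  proof (rule Weierstrass_m_test)
    have "summable (\<lambda>i. real (Suc i) powr (-1 - \<delta>))"
      using assms by (subst summable_Suc_iff) (simp add: summable_real_powr_iff)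
    then show "summable (\<lambda>i. (B * (B + 1)) * real (Suc i) powr (-1 - \<delta>))"
      by (rule summable_mult)
    fix i s assume "s \<in> S"
    then have s: "s \<noteq> 1" "Re s \<ge> -1 + \<delta>" "norm s \<le> B" using S by auto
    then have "B \<ge> 0" using norm_ge_zero order_trans by blast
    have "norm (em (i + 2) s - em (i + 1) s) \<le> norm s * norm (s + 1) * real (Suc i) powr (- Re s - 2)"
      using em_step_bound[of s "Suc i"] s assms by simp
    also have "\<dots> \<le> (B * (B + 1)) * real (Suc i) powr (-1 - \<delta>)"
      using s \<open>B \<ge> 0\<close> norm_triangle_ineq[of s 1]
      by (intro mult_mono powr_mono) auto
    finally show "norm (em (i + 2) s - em (i + 1) s) \<le> (B * (B + 1)) * real (Suc i) powr (-1 - \<delta>)" .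
  qed
  then have "uniform_limit S (\<lambda>n s. em 1 s + (\<Sum>i<n. em (i + 2) s - em (i + 1) s)) zeta0 sequentially"
    unfolding zeta0_def by (intro uniform_limit_add uniform_limit_const)
  then show ?thesis by (simp only: em_telescope[symmetric])
qed

lemma em_LIMSEQ:
  assumes "s \<noteq> 1" "Re s > -1"
  shows "(\<lambda>n. em n s) \<longlonglongrightarrow> zeta0 s"
proof -
  have "uniform_limit {s} (\<lambda>n. em (Suc n)) zeta0 sequentially"
    by (rule em_uniform_limit[of "Re s + 1" _ "norm s"]) (use assms in auto)
  then have "(\<lambda>n. em (Suc n) s) \<longlonglongrightarrow> zeta0 s"
    by (rule tendsto_uniform_limitI) simp
  then show ?thesis by (rule LIMSEQ_imp_Suc[of "\<lambda>n. em n s"])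
qed

lemma zeta0_holomorphic: "zeta0 holomorphic_on ({s. Re s > -1} - {1})"
proof (rule holomorphic_uniform_sequence)
  show o: "open ({s. Re s > -1} - {1})"
    by (intro open_delete open_halfspace_Re_gt)
  show "em (Suc n) holomorphic_on {s. Re s > -1} - {1}" for n
    unfolding em_def by (intro holomorphic_intros) auto
  fix z assume z: "z \<in> {s. Re s > -1} - {1::complex}"
  obtain d where d: "d > 0" "cball z d \<subseteq> {s. Re s > -1} - {1}"
    using open_contains_cball_eq[OF o] z by blast
  \<comment> \<open>Compactness keeps the real parts on the disc at least \<open>m + 1\<close> away
    from -1; this is the \<open>\<delta>\<close> of the uniform estimate.\<close>
  have "compact (Re ` cball z d)" by (intro compact_continuous_image continuous_intros compact_cball)
  moreover have "Re ` cball z d \<noteq> {}" using d by auto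
  ultimately obtain m where m: "m \<in> Re ` cball z d" "\<And>x. x \<in> cball z d \<Longrightarrow> m \<le> Re x"
    using compact_attains_inf by (metis imageI)
  have "m > -1" using m d by auto
  have "uniform_limit (cball z d) (\<lambda>n. em (Suc n)) zeta0 sequentially"
  proof (rule em_uniform_limit[of "m + 1" _ "norm z + d"])
    fix s assume s: "s \<in> cball z d"
    have "norm s \<le> norm z + d" using s norm_triangle_ineq[of z "s - z"] 
      by (simp add: dist_norm norm_minus_commute)
    then show "s \<noteq> 1 \<and> - 1 + (m + 1) \<le> Re s \<and> norm s \<le> norm z + d"
      using m(2)[OF s] d s by auto
  qed (use \<open>m > -1\<close> in auto)
  then show "\<exists>d>0. cball z d \<subseteq> {s. Re s > -1} - {1} \<and>
      uniform_limit (cball z d) (\<lambda>n. em (Suc n)) zeta0 sequentially"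
    using d by blast
qed

lemma zeta0_sums:
  assumes "Re s > 1"
  shows "(\<lambda>n. 1 / of_nat (Suc n) powr s) sums zeta0 s"
proof -
  have "s \<noteq> 1" using assms by auto
  have lim: "(\<lambda>n. of_nat n powr a) \<longlonglongrightarrow> (0::complex)" if "Re a < 0" for a
  proof -
    have "(\<lambda>n. real n powr Re a) \<longlonglongrightarrow> 0"
      using that by real_asymp
    then have "(\<lambda>n. norm (of_nat n powr a :: complex)) \<longlonglongrightarrow> 0"
      using norm_powr_of_nonneg_real[of "real n" a for n] by simp
    then show ?thesis by (rule tendsto_norm_zero_cancel)
  qed
  have "(\<lambda>n. em n s + of_nat n powr (-s) / 2 + of_nat n powr (1 - s) / (1 - s)) \<longlonglongrightarrow> zeta0 s + 0 / 2 + 0 / (1 - s)"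
    using assms \<open>s \<noteq> 1\<close> by (intro tendsto_intros em_LIMSEQ lim) auto
  then have "(\<lambda>N. \<Sum>n=1..N. of_nat n powr (-s)) \<longlonglongrightarrow> zeta0 s"
    by (simp add: em_def)
  moreover have "(\<Sum>n=1..N. of_nat n powr (-s)) = (\<Sum>n<N. 1 / of_nat (Suc n) powr s :: complex)" for N
    by (rule sum.reindex_bij_witness[of _ Suc "\<lambda>n. n - 1"]) (auto simp: powr_minus field_simps)
  ultimately show ?thesis by (simp add: sums_def)
qed

section \<open>Fourier series of the sawtooth function\<close>

lemma continuous_mult_absolutely_integrable:
  fixes f g :: "real \<Rightarrow> complex"
  assumes f: "continuous_on {a..b} f" and g: "g absolutely_integrable_on {a..b}"
  shows "(\<lambda>u. f u * g u) absolutely_integrable_on {a..b}"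
proof (rule absolutely_integrable_bounded_measurable_product[OF bilinear_times _ _ _ g])
  show "f \<in> borel_measurable (lebesgue_on {a..b})"
    using f by (intro continuous_imp_measurable_on_sets_lebesgue) auto
  show "bounded (f ` {a..b})"
    using f by (intro compact_imp_bounded compact_continuous_image) auto
qed auto

lemma powr_absolutely_integrable:
  assumes "Re w > 0" "0 \<le> a"
  shows "(\<lambda>u. complex_of_real u powr (w - 1)) absolutely_integrable_on {a..b}"
proof -
  have "(\<lambda>u. complex_of_real u powr (w - 1)) absolutely_integrable_on {0<..b}"
  proof (rule measurable_bounded_by_integrable_imp_absolutely_integrable)
    show "(\<lambda>u. complex_of_real u powr (w - 1)) \<in> borel_measurable (lebesgue_on {0<..b})"
      by (intro continuous_imp_measurable_on_sets_lebesgue continuous_on_powr_real) auto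
    show "(\<lambda>u. u powr (Re w - 1)) integrable_on {0<..b}"
    proof (cases "b \<ge> 0")
      case True
      have "(\<lambda>u. u powr (Re w - 1)) integrable_on {0..b}"
        using assms True by (intro integrable_on_powr_from_0) auto
      then show ?thesis
        by (rule integrable_spike_set) (auto intro: negligible_subset[of "{0}"])
    qed auto
  qed (auto simp: norm_powr_of_nonneg_real)
  then have "(\<lambda>u. complex_of_real u powr (w - 1)) absolutely_integrable_on {0..b}"
    by (subst absolutely_integrable_spike_set_eq[where T = "{0<..b}"]) (auto intro: negligible_subset[of "{0}"])
  then show ?thesis
    by (rule absolutely_integrable_on_subinterval) (use assms in auto)
qed

text \<open>The sawtooth has the Fourier series with terms
  \<open>- sin (2 \<pi> k u) / (\<pi> k)\<close>, hence the plus sign: \<open>saw n K\<close> is the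
  remainder after \<open>K\<close> terms.\<close>

definition saw :: "nat \<Rightarrow> nat \<Rightarrow> real \<Rightarrow> real" where
  "saw n K u = u - n - 1/2 + (\<Sum>k=1..K. sin (2 * pi * real k * u) / (pi * real k))"

lemma saw_continuous [continuous_intros]: "continuous_on S (saw n K)"
  unfolding saw_def by (intro continuous_intros) auto

lemma sin_2pi_nat [simp]: "sin (2 * pi * real k * real n) = 0"
  by (metis mult.assoc mult.commute of_nat_mult sin_2npi)

lemma cos_2pi_nat [simp]: "cos (2 * pi * real k * real n) = 1"
  by (metis mult.assoc mult.commute of_nat_mult cos_2npi)

lemma sin_2pi_nat_Suc [simp]: "sin (2 * pi * real k * (real n + 1)) = 0"
  using sin_2pi_nat[of k "Suc n"] by (simp add: add.commute)

lemma cos_2pi_nat_Suc [simp]: "cos (2 * pi * real k * (real n + 1)) = 1"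
  using cos_2pi_nat[of k "Suc n"] by (simp add: add.commute)

lemma sin_diff_2pi_nat [simp]:
  assumes "k \<le> m" shows "sin (2 * pi * (real m - real k) * real n) = 0" 
    "sin (2 * pi * (real m - real k) * (real n + 1)) = 0"
  using assms sin_2pi_nat[of "m - k" n] sin_2pi_nat_Suc[of "m - k" n] by (simp_all add: of_nat_diff)

lemma sin_add_2pi_nat [simp]:
  shows "sin (2 * pi * (real m + real k) * real n) = 0" 
    "sin (2 * pi * (real m + real k) * (real n + 1)) = 0"
  using sin_2pi_nat[of "m + k" n] sin_2pi_nat_Suc[of "m + k" n] by simp_all

lemma integral_linear_sin:
  assumes "m \<ge> 1"
  shows "((\<lambda>u. (u - real n - 1/2) * sin (2 * pi * real m * u)) has_integral (- 1 / (2 * pi * m))) {real n..real n + 1}"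
proof -
  let ?F = "\<lambda>u. - (u - real n - 1/2) * cos (2 * pi * m * u) / (2 * pi * m) + sin (2 * pi * m * u) / (2 * pi * m)^2"
  have "((\<lambda>u. (u - real n - 1/2) * sin (2 * pi * real m * u)) has_integral (?F (real n + 1) - ?F (real n))) {real n..real n + 1}"
    using assms
    by (intro fundamental_theorem_of_calculus)
       (auto intro!: derivative_eq_intros simp: has_real_derivative_iff_has_vector_derivative[symmetric] field_simps power2_eq_square)
  moreover have "?F (real n + 1) = - (1/2) / (2 * pi * m)" "?F (real n) = (1/2) / (2 * pi * m)"
    by simp_all
  moreover have "- (1/2) / (2 * pi * m) - (1/2) / (2 * pi * m) = - 1 / (2 * pi * m)"
    using assms by (simp add: field_simps)
  ultimately show ?thesis by (simp only:)
qed

lemma integral_sin_sin: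
  assumes "1 \<le> k" "k < m"
  shows "((\<lambda>u. sin (2 * pi * real k * u) * sin (2 * pi * real m * u)) has_integral 0) {real n..real n + 1}"
proof -
  have d: "((\<lambda>u. sin (c * u) / c) has_real_derivative cos (c * u)) (at u within S)" if "c \<noteq> 0" for c u S
    using that by (auto intro!: derivative_eq_intros)
  let ?F = "\<lambda>u. (sin (2 * pi * (real m - real k) * u) / (2 * pi * (real m - real k)) - sin (2 * pi * (real m + real k) * u) / (2 * pi * (real m + real k))) / 2"
  have "((\<lambda>u. (cos (2 * pi * (real m - real k) * u) - cos (2 * pi * (real m + real k) * u)) / 2) has_integral (?F (real n + 1) - ?F (real n))) {real n..real n + 1}"
    using assms
    by (intro fundamental_theorem_of_calculus)
       (auto simp: has_real_derivative_iff_has_vector_derivative[symmetric] intro!: DERIV_cdivide DERIV_diff d)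
  moreover have "(cos (2 * pi * (real m - real k) * u) - cos (2 * pi * (real m + real k) * u)) / 2 = sin (2 * pi * real k * u) * sin (2 * pi * real m * u)" for u
  proof -
    have "2 * pi * (real m - real k) * u = 2 * pi * real m * u - 2 * pi * real k * u"
      "2 * pi * (real m + real k) * u = 2 * pi * real m * u + 2 * pi * real k * u" by (simp_all add: algebra_simps)
    then show ?thesis by (simp only: cos_diff cos_add) simp
  qed
  ultimately show ?thesis using assms by simp
qed

lemma integral_sin_squared:
  assumes "1 \<le> m"
  shows "((\<lambda>u. (sin (2 * pi * real m * u))\<^sup>2) has_integral (1/2)) {real n..real n + 1}"
proof -
  let ?F = "\<lambda>u. u / 2 - sin (2 * pi * (real m + real m) * u) / (2 * pi * (real m + real m)) / 2"
  have "((\<lambda>u. (1 - cos (2 * pi * (real m + real m) * u)) / 2) has_integral (?F (real n + 1) - ?F (real n))) {real n..real n + 1}"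
    using assms
    by (intro fundamental_theorem_of_calculus)
       (auto intro!: derivative_eq_intros simp: has_real_derivative_iff_has_vector_derivative[symmetric] field_simps)
  moreover have "(1 - cos (2 * pi * (real m + real m) * u)) / 2 = (sin (2 * pi * real m * u))\<^sup>2" for u
  proof -
    have "2 * pi * (real m + real m) * u = 2 * (2 * pi * real m * u)" by (simp add: algebra_simps)
    then have "cos (2 * pi * (real m + real m) * u) = 1 - 2 * (sin (2 * pi * real m * u))\<^sup>2"
      by (simp only: cos_double_sin)
    then show ?thesis unfolding \<open>cos _ = _\<close> by simp
  qed
  moreover have "?F (real n + 1) - ?F (real n) = 1/2"
    by (simp only: sin_add_2pi_nat) (simp add: field_simps)
  ultimately show ?thesis by (simp only:)
qed

text \<open>Bessel's identity for the sawtooth, whose own square norm is 1/12. For the new frequency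
  \<open>m\<close> the cross term contributes \<open>- 1 / (\<pi> m)^2\<close> and the new square
  half of that with the opposite sign; all earlier frequencies are orthogonal to it.\<close>

lemma integral_saw_squared:
  "((\<lambda>u. (saw n K u)\<^sup>2) has_integral (1/12 - (\<Sum>k=1..K. 1 / (2 * pi\<^sup>2 * (real k)\<^sup>2)))) {real n..real n + 1}"
proof (induction K)
  case 0
  let ?F = "\<lambda>u. (u - real n - 1/2)^3 / 3"
  have "((\<lambda>u. (u - real n - 1/2)^2) has_integral (?F (real n + 1) - ?F (real n))) {real n..real n + 1}"
    by (intro fundamental_theorem_of_calculus)
       (auto intro!: derivative_eq_intros simp: has_real_derivative_iff_has_vector_derivative[symmetric] field_simps)
  then show ?case by (simp add: saw_def power3_eq_cube)
next
  case (Suc K)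
  let ?m = "Suc K"
  have "((\<lambda>u. (u - real n - 1/2) * sin (2 * pi * real ?m * u) +
              (\<Sum>k=1..K. (sin (2 * pi * real k * u) * sin (2 * pi * real ?m * u)) / (pi * real k))) 
         has_integral (- 1 / (2 * pi * ?m) + (\<Sum>k=1..K. 0 / (pi * real k)))) {real n..real n + 1}"
    by (intro has_integral_add has_integral_sum has_integral_divide integral_linear_sin integral_sin_sin) auto
  then have *: "((\<lambda>u. saw n K u * sin (2 * pi * real ?m * u)) has_integral (- 1 / (2 * pi * ?m))) {real n..real n + 1}"
    by (simp add: saw_def distrib_right sum_distrib_right)
  have "((\<lambda>u. (saw n K u)\<^sup>2 + 2 / (pi * ?m) * (saw n K u * sin (2 * pi * real ?m * u)) + 1 / (pi * ?m)^2 * (sin (2 * pi * real ?m * u))\<^sup>2)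
      has_integral (1/12 - (\<Sum>k=1..K. 1 / (2 * pi\<^sup>2 * (real k)\<^sup>2)) + 2 / (pi * ?m) * (- 1 / (2 * pi * ?m)) + 1 / (pi * ?m)^2 * (1/2))) {real n..real n + 1}"
    by (intro has_integral_add has_integral_mult_right Suc.IH * integral_sin_squared) auto
  moreover have "(saw n K u)\<^sup>2 + 2 / (pi * ?m) * (saw n K u * sin (2 * pi * real ?m * u)) + 1 / (pi * ?m)^2 * (sin (2 * pi * real ?m * u))\<^sup>2 = (saw n ?m u)\<^sup>2" for u
  proof -
    have "saw n ?m u = saw n K u + sin (2 * pi * real ?m * u) / (pi * ?m)" by (simp add: saw_def)
    then show ?thesis by (simp only: power2_sum power_divide) (simp add: field_simps)
  qed
  moreover have "1/12 - (\<Sum>k=1..K. 1 / (2 * pi\<^sup>2 * (real k)\<^sup>2)) + 2 / (pi * ?m) * (- 1 / (2 * pi * ?m)) + 1 / (pi * ?m)^2 * (1/2)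
     = 1/12 - (\<Sum>k=1..?m. 1 / (2 * pi\<^sup>2 * (real k)\<^sup>2))"
  proof -
    have "2 / (pi * ?m) * (- 1 / (2 * pi * ?m)) + 1 / (pi * ?m)^2 * (1/2) = - (1 / (2 * pi\<^sup>2 * (real ?m)\<^sup>2))"
      by (simp add: field_simps power2_eq_square del: of_nat_Suc)
    then show ?thesis by (simp del: of_nat_Suc)
  qed
  ultimately show ?case by (simp only:)
qed

text \<open>Euler's value \<open>pi\<^sup>2 / 6\<close> takes the place of the completeness of the
  trigonometric system: it makes Bessel's inequality an equality in the limit.\<close>

lemma saw_L2_tendsto: "(\<lambda>K. 1/12 - (\<Sum>k=1..K. 1 / (2 * pi\<^sup>2 * (real k)\<^sup>2))) \<longlonglongrightarrow> 0"
proof -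
  have "(\<lambda>K. \<Sum>k<K. 1 / (real k + 1)\<^sup>2) \<longlonglongrightarrow> pi\<^sup>2 / 6"
    using inverse_squares_sums by (simp add: sums_def add.commute)
  moreover have "(\<Sum>k=1..K. 1 / (2 * pi\<^sup>2 * (real k)\<^sup>2)) = 1 / (2 * pi\<^sup>2) * (\<Sum>k<K. 1 / (real k + 1)\<^sup>2)" for K
    unfolding sum_distrib_left
    by (rule sum.reindex_bij_witness[of _ Suc "\<lambda>n. n - 1"]) (auto simp: field_simps)
  ultimately have "(\<lambda>K. 1/12 - (\<Sum>k=1..K. 1 / (2 * pi\<^sup>2 * (real k)\<^sup>2))) \<longlonglongrightarrow> 1/12 - 1 / (2 * pi\<^sup>2) * (pi\<^sup>2 / 6)"
    by (simp only:) (intro tendsto_intros)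
  then show ?thesis by simp
qed

text \<open>The pointwise bound \<open>|f G| \<le> (f\<^sup>2 / \<delta> + \<delta> |G|\<^sup>2) / 2\<close> replaces the Cauchy-Schwarz inequality for integrals.\<close>

lemma saw_integral_tendsto_0:
  fixes G :: "real \<Rightarrow> complex"
  assumes G: "G absolutely_integrable_on {real n..real n + 1}" "(\<lambda>u. (norm (G u))\<^sup>2) integrable_on {real n..real n + 1}"
  shows "(\<lambda>K. integral {real n..real n + 1} (\<lambda>u. of_real (saw n K u) * G u)) \<longlonglongrightarrow> 0"
proof -
  let ?I = "{real n..real n + 1}"
  define E where "E = (\<lambda>K. 1/12 - (\<Sum>k=1..K. 1 / (2 * pi\<^sup>2 * (real k)\<^sup>2)))"
  define J where "J = integral ?I (\<lambda>u. (norm (G u))\<^sup>2)"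
  \<comment> \<open>The balanced choice would be \<open>sqrt (E K)\<close>; the additional
    \<open>1 / (K + 1)\<close> keeps \<open>\<delta>\<close> positive without an argument that
    \<open>E K\<close> is nonzero.\<close>
  define \<delta> where "\<delta> = (\<lambda>K::nat. sqrt (E K) + 1 / (real K + 1))"
  have E: "((\<lambda>u. (saw n K u)\<^sup>2) has_integral E K) ?I" for K
    unfolding E_def by (rule integral_saw_squared)
  have E0: "E K \<ge> 0" for K
    by (rule has_integral_nonneg[OF E]) auto
  have \<delta>0: "\<delta> K > 0" for K
    using E0[of K] unfolding \<delta>_def by (simp add: add_nonneg_pos)
  have J: "((\<lambda>u. (norm (G u))\<^sup>2) has_integral J) ?I" unfolding J_def using G by (simp add: integrable_integral)
  have le: "norm (integral ?I (\<lambda>u. of_real (saw n K u) * G u)) \<le> (sqrt (E K) + \<delta> K * J) / 2" for K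
  proof -
    have "norm (integral ?I (\<lambda>u. of_real (saw n K u) * G u)) \<le> integral ?I (\<lambda>u. ((saw n K u)\<^sup>2 / \<delta> K + \<delta> K * (norm (G u))\<^sup>2) / 2)"
    proof (rule integral_norm_bound_integral)
      show "(\<lambda>u. of_real (saw n K u) * G u) integrable_on ?I"
        by (intro set_lebesgue_integral_eq_integral(1) continuous_mult_absolutely_integrable G continuous_intros)
      show "(\<lambda>u. ((saw n K u)\<^sup>2 / \<delta> K + \<delta> K * (norm (G u))\<^sup>2) / 2) integrable_on ?I"
        using has_integral_divide[OF has_integral_add[OF has_integral_divide[OF E] has_integral_mult_right[OF J]]]
        by blast
      fix u
      have "2 * \<bar>saw n K u\<bar> * norm (G u) \<le> (saw n K u)\<^sup>2 / \<delta> K + \<delta> K * (norm (G u))\<^sup>2"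
      proof -
        have "0 \<le> (\<bar>saw n K u\<bar> - \<delta> K * norm (G u))\<^sup>2 / \<delta> K" using \<delta>0[of K] by simp
        also have "\<dots> = (saw n K u)\<^sup>2 / \<delta> K + \<delta> K * (norm (G u))\<^sup>2 - 2 * \<bar>saw n K u\<bar> * norm (G u)"
          using \<delta>0[of K] by (simp add: power2_diff field_simps power2_eq_square)
        finally show ?thesis by simp
      qed
      then show "norm (of_real (saw n K u) * G u) \<le> ((saw n K u)\<^sup>2 / \<delta> K + \<delta> K * (norm (G u))\<^sup>2) / 2"
        by (simp add: norm_mult)
    qed
    also have "\<dots> = (E K / \<delta> K + \<delta> K * J) / 2"
      by (intro integral_unique has_integral_divide has_integral_add has_integral_mult_right E J)
    also have "E K / \<delta> K \<le> sqrt (E K)"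
    proof -
      have "E K = sqrt (E K) * sqrt (E K)" using E0 by simp
      also have "\<dots> \<le> sqrt (E K) * \<delta> K" using E0[of K] unfolding \<delta>_def by (intro mult_left_mono) auto
      finally show ?thesis using \<delta>0[of K] by (simp add: field_simps)
    qed
    finally show ?thesis by simp
  qed
  have "E \<longlonglongrightarrow> 0" unfolding E_def by (rule saw_L2_tendsto)
  then have s: "(\<lambda>K. sqrt (E K)) \<longlonglongrightarrow> 0" using tendsto_real_sqrt by fastforce
  have "(\<lambda>K. 1 / (real K + 1)) \<longlonglongrightarrow> 0" by real_asymp
  then have "\<delta> \<longlonglongrightarrow> 0 + 0" unfolding \<delta>_def by (intro tendsto_add s)
  then have "(\<lambda>K. (sqrt (E K) + \<delta> K * J) / 2) \<longlonglongrightarrow> (0 + (0 + 0) * J) / 2"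
    by (intro tendsto_divide tendsto_add tendsto_mult tendsto_const s) simp_all
  then have lim: "(\<lambda>K. (sqrt (E K) + \<delta> K * J) / 2) \<longlonglongrightarrow> 0" by simp
  show ?thesis
    by (rule Lim_null_comparison[OF always_eventually lim]) (intro allI le)
qed

text \<open>The Fourier series may be inserted term by term because its remainder tends to 0 in mean
  square while the other factor is square integrable. Near 0 the latter demands
  \<open>Re s < -1/2\<close>, hence the two cases.\<close>

lemma em_step_fourier:
  assumes "s \<noteq> 1" "n \<ge> 1 \<or> Re s < - 1/2"
  shows "(\<lambda>K. \<Sum>k=1..K. s / of_real (pi * real k) * integral {real n..real n + 1} (\<lambda>u. of_real (sin (2 * pi * real k * u)) * of_real u powr (- s - 1)))
          \<longlonglongrightarrow> em (Suc n) s - em n s"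
proof -
  let ?I = "{real n..real n + 1}"
  let ?p = "\<lambda>u. complex_of_real u powr (- s - 1)"
  have p: "?p absolutely_integrable_on ?I"
  proof (cases "n \<ge> 1")
    case True
    then show ?thesis by (intro absolutely_integrable_continuous_real continuous_on_powr_real) auto
  next
    case False
    then show ?thesis using assms powr_absolutely_integrable[of "-s" "real n"] by auto
  qed
  have p2: "(\<lambda>u. (norm (?p u))\<^sup>2) integrable_on ?I"
  proof (cases "n \<ge> 1")
    case True
    then show ?thesis by (intro integrable_continuous_real continuous_intros continuous_on_powr_real) auto
  next
    case False
    have "(\<lambda>u. u powr (2 * (- Re s - 1))) integrable_on {0..1}"
      using False assms by (intro integrable_on_powr_from_0) auto
    also have "?this \<longleftrightarrow> (\<lambda>u. (norm (?p u))\<^sup>2) integrable_on {0..1}"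
      by (intro integrable_cong) (auto simp: norm_powr_of_nonneg_real powr_powr power2_eq_square simp flip: powr_add)
    finally show ?thesis using False by (cases n) auto
  qed
  define G where "G = (\<lambda>u. - s * ?p u)"
  have G: "G absolutely_integrable_on ?I" 
    unfolding G_def by (intro continuous_mult_absolutely_integrable p continuous_intros)
  have G2: "(\<lambda>u. (norm (G u))\<^sup>2) integrable_on ?I"
    unfolding G_def using integrable_on_cmult_left[OF p2, of "(norm s)\<^sup>2"] by (simp add: norm_mult power_mult_distrib)
  have eq: "integral ?I (\<lambda>u. of_real (saw n K u) * G u) = (em (Suc n) s - em n s) - 
      (\<Sum>k=1..K. s / of_real (pi * real k) * integral ?I (\<lambda>u. of_real (sin (2 * pi * real k * u)) * ?p u))" for K
  proof -
    have "((\<lambda>u. of_real (u - real n - 1/2) * (- s * ?p u) + (\<Sum>k=1..K. - (s / of_real (pi * real k)) * (of_real (sin (2 * pi * real k * u)) * ?p u))) has_integral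
        (em (Suc n) s - em n s) + (\<Sum>k=1..K. - (s / of_real (pi * real k)) * integral ?I (\<lambda>u. of_real (sin (2 * pi * real k * u)) * ?p u))) ?I"
      using assms
      by (intro has_integral_add em_step_integral has_integral_sum has_integral_mult_right integrable_integral
           set_lebesgue_integral_eq_integral(1) continuous_mult_absolutely_integrable p continuous_intros) auto
    moreover have "of_real (u - real n - 1/2) * (- s * ?p u) + (\<Sum>k=1..K. - (s / of_real (pi * real k)) * (of_real (sin (2 * pi * real k * u)) * ?p u))
       = of_real (saw n K u) * G u" for u
      unfolding saw_def G_def of_real_add distrib_right of_real_sum sum_distrib_right
      by (intro arg_cong2[of _ _ _ _ "(+)"] refl sum.cong) auto
    ultimately show ?thesis by (simp add: integral_unique sum_negf)
  qed
  have "(\<lambda>K. integral ?I (\<lambda>u. of_real (saw n K u) * G u)) \<longlonglongrightarrow> 0"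
    by (rule saw_integral_tendsto_0[OF G G2])
  then have "(\<lambda>K. (em (Suc n) s - em n s) - integral ?I (\<lambda>u. of_real (saw n K u) * G u)) \<longlonglongrightarrow> (em (Suc n) s - em n s) - 0"
    by (intro tendsto_intros)
  then show ?thesis by (simp add: eq)
qed

lemma em_fourier:
  assumes "s \<noteq> 1" "N \<ge> 1 \<or> Re s < - 1/2" "N \<le> R"
  shows "(\<lambda>K. \<Sum>k=1..K. s / of_real (pi * real k) * integral {real N..real R} (\<lambda>u. of_real (sin (2 * pi * real k * u)) * of_real u powr (- s - 1)))
          \<longlonglongrightarrow> em R s - em N s"
  using assms(3)
proof (induction R rule: dec_induct)
  case base
  then show ?case by simp
next
  case (step R)
  let ?f = "\<lambda>k u. of_real (sin (2 * pi * real k * u)) * complex_of_real u powr (- s - 1)"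
  have "integral {real N..real (Suc R)} (?f k) = integral {real N..real R} (?f k) + integral {real R..real R + 1} (?f k)" for k
  proof -
    have p: "(\<lambda>u. complex_of_real u powr (- s - 1)) absolutely_integrable_on {real N..real (Suc R)}"
    proof (cases "N \<ge> 1")
      case True
      then show ?thesis by (intro absolutely_integrable_continuous_real continuous_on_powr_real) auto
    next
      case False
      then show ?thesis using assms powr_absolutely_integrable[of "-s" "real N"] by auto
    qed
    have "?f k integrable_on {real N..real (Suc R)}"
      by (intro set_lebesgue_integral_eq_integral(1) continuous_mult_absolutely_integrable p continuous_intros)
    then have "integral {real N..real R} (?f k) + integral {real R..real (Suc R)} (?f k) = integral {real N..real (Suc R)} (?f k)"
      using step by (intro Henstock_Kurzweil_Integration.integral_combine) auto
    then show ?thesis by (simp add: add.commute)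
  qed
  then have "(\<lambda>K. \<Sum>k=1..K. s / of_real (pi * real k) * integral {real N..real (Suc R)} (?f k)) =
     (\<lambda>K. (\<Sum>k=1..K. s / of_real (pi * real k) * integral {real N..real R} (?f k)) + (\<Sum>k=1..K. s / of_real (pi * real k) * integral {real R..real R + 1} (?f k)))"
    by (simp add: distrib_left sum.distrib)
  moreover have "\<dots> \<longlonglongrightarrow> (em R s - em N s) + (em (Suc R) s - em R s)"
    using assms step by (intro tendsto_add step.IH em_step_fourier) auto
  ultimately show ?case by simp
qed

section \<open>Mellin transforms of the trigonometric functions\<close>

text \<open>For estimates that hold away from the singularity at 0, where the piece over the
  interval from 0 to \<open>\<epsilon>\<close> costs only a positive power of
  \<open>\<epsilon>\<close>.\<close>

lemma le_of_le_add_powr: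
  fixes x B C p r :: real
  assumes "p > 0" "r > 0" "\<And>\<epsilon>. 0 < \<epsilon> \<Longrightarrow> \<epsilon> < r \<Longrightarrow> x \<le> B + C * \<epsilon> powr p"
  shows "x \<le> B"
proof (rule tendsto_lowerbound)
  have "((\<lambda>\<epsilon>. \<epsilon> powr p) \<longlongrightarrow> 0 powr p) (at_right 0)"
    using assms by (intro tendsto_intros) (auto simp: eventually_at_filter)
  then have "((\<lambda>\<epsilon>. B + C * \<epsilon> powr p) \<longlongrightarrow> B + C * 0 powr p) (at_right 0)"
    by (intro tendsto_add tendsto_mult tendsto_const)
  then show "((\<lambda>\<epsilon>. B + C * \<epsilon> powr p) \<longlongrightarrow> B) (at_right 0)" using assms by simp
  show "\<forall>\<^sub>F \<epsilon> in at_right 0. x \<le> B + C * \<epsilon> powr p"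
    unfolding eventually_at_right_field using assms by auto
qed auto

lemma powr_integral_near_0:
  fixes h :: "real \<Rightarrow> complex"
  assumes "Re w > 0" "continuous_on {0..\<epsilon>} h" "\<And>u. u \<in> {0..\<epsilon>} \<Longrightarrow> norm (h u) \<le> 1" "\<epsilon> \<ge> 0"
  shows "norm (integral {0..\<epsilon>} (\<lambda>u. h u * of_real u powr (w - 1))) \<le> \<epsilon> powr Re w / Re w"
proof -
  have "norm (integral {0..\<epsilon>} (\<lambda>u. h u * of_real u powr (w - 1))) \<le> integral {0..\<epsilon>} (\<lambda>u. u powr (Re w - 1))"
  proof (rule integral_norm_bound_integral)
    show "(\<lambda>u. h u * of_real u powr (w - 1)) integrable_on {0..\<epsilon>}"
      using assms by (intro set_lebesgue_integral_eq_integral(1) continuous_mult_absolutely_integrable powr_absolutely_integrable) auto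
    show "(\<lambda>u. u powr (Re w - 1)) integrable_on {0..\<epsilon>}"
      using assms by (intro integrable_on_powr_from_0) auto
    fix u assume u: "u \<in> {0..\<epsilon>}"
    then have "norm (h u) * u powr (Re w - 1) \<le> 1 * u powr (Re w - 1)"
      using assms by (intro mult_right_mono) auto
    then show "norm (h u * of_real u powr (w - 1)) \<le> u powr (Re w - 1)"
      using u by (simp add: norm_mult norm_powr_of_nonneg_real)
  qed
  also have "\<dots> = \<epsilon> powr (Re w - 1 + 1) / (Re w - 1 + 1)"
    using assms by (intro integral_unique has_integral_powr_from_0) auto
  finally show ?thesis by simp
qed

lemma integral_combine_powr:
  fixes h :: "real \<Rightarrow> complex"
  assumes "Re w > 0" "continuous_on {a..c} h" "0 \<le> a" "a \<le> b" "b \<le> c"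
  shows "integral {a..c} (\<lambda>u. h u * of_real u powr (w - 1)) = 
    integral {a..b} (\<lambda>u. h u * of_real u powr (w - 1)) + integral {b..c} (\<lambda>u. h u * of_real u powr (w - 1))"
  using assms
  by (intro Henstock_Kurzweil_Integration.integral_combine[symmetric] set_lebesgue_integral_eq_integral(1)
       continuous_mult_absolutely_integrable powr_absolutely_integrable) auto

text \<open>Rotating the ray of integration of the Gamma integral by a right angle.  The primitive of
  \<open>z powr (w - 1) * exp (- z)\<close> on the half-plane \<open>Re z + Im z > 0\<close> turns Cauchy's theorem into the
  fundamental theorem of calculus.\<close>

lemma gamma_rotation_bound:
  assumes w: "0 < Re w" "Re w < 1"
  obtains C where "\<And>R. R > 0 \<Longrightarrow>
    norm (integral {0..R} (\<lambda>u. of_real (exp (-u)) * of_real u powr (w - 1)) - 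
          \<i> powr w * integral {0..R} (\<lambda>u. cis (-u) * of_real u powr (w - 1))) \<le> C * R powr (Re w - 1)"
proof -
  define S where "S = {z::complex. Re z + Im z > 0}"
  have Sconv: "convex S" and Sopen: "open S"
  proof -
    have eq: "S = {z. inner (Complex 1 1) z > 0}" unfolding S_def by (simp add: inner_complex_def)
    show "convex S" "open S" unfolding eq by (auto intro: convex_halfspace_gt open_halfspace_gt)
  qed
  define f where "f = (\<lambda>z::complex. exp (-z) * z powr (w - 1))"
  have "f holomorphic_on S"
    unfolding f_def S_def by (intro holomorphic_intros) (auto simp: complex_nonpos_Reals_iff)
  then obtain F where F: "\<And>z. z \<in> S \<Longrightarrow> (F has_field_derivative f z) (at z within S)"
    using holomorphic_convex_primitive'[OF Sconv Sopen] by blast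
  have F': "(F has_field_derivative f z) (at z)" if "z \<in> S" for z
    using F[OF that] at_within_open[OF that Sopen] by metis
  define \<sigma> where "\<sigma> = Re w"
  \<comment> \<open>On the segment from \<open>r\<close> to \<open>\<i> * r\<close> the modulus is
    at least \<open>r / sqrt 2\<close> and the argument at most pi in absolute value;
    \<open>M\<close> collects the resulting factors.\<close>
  define M where "M = (1 / sqrt 2) powr (\<sigma> - 1) * exp (pi * \<bar>Im w\<bar>)"
  have M0: "M > 0" unfolding M_def by simp
  have fb: "norm (f (of_real (r * (1 - v)) + \<i> * of_real (r * v))) \<le> M * r powr (\<sigma> - 1) * exp (- (r * (1 - v)))"
    if "r > 0" "0 \<le> v" "v \<le> 1" for r v
  proof -
    let ?z = "complex_of_real (r * (1 - v)) + \<i> * of_real (r * v)"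
    have n2: "(norm ?z)\<^sup>2 = r\<^sup>2 * ((1 - v)\<^sup>2 + v\<^sup>2)" by (simp add: cmod_power2 power_mult_distrib distrib_left)
    have "(1 - v)\<^sup>2 + v\<^sup>2 - 1/2 = 2 * (v - 1/2)\<^sup>2" by (simp add: power2_eq_square field_simps)
    then have "(1 - v)\<^sup>2 + v\<^sup>2 \<ge> 1/2" using zero_le_power2[of "v - 1/2"] by linarith
    then have "r\<^sup>2 * ((1 - v)\<^sup>2 + v\<^sup>2) \<ge> r\<^sup>2 * (1/2)" by (intro mult_left_mono) auto
    then have "(norm ?z)\<^sup>2 \<ge> (r * (1 / sqrt 2))\<^sup>2" unfolding n2 by (simp add: power_mult_distrib power_divide)
    then have ge: "norm ?z \<ge> r * (1 / sqrt 2)" by (rule power2_le_imp_le) simp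
    have "norm (?z powr (w - 1)) = norm ?z powr (\<sigma> - 1) * exp (- Im w * Arg ?z)"
      by (simp add: norm_powr_complex \<sigma>_def)
    also have "\<dots> \<le> (r * (1 / sqrt 2)) powr (\<sigma> - 1) * exp (pi * \<bar>Im w\<bar>)"
    proof (intro mult_mono)
      show "norm ?z powr (\<sigma> - 1) \<le> (r * (1 / sqrt 2)) powr (\<sigma> - 1)"
        using ge w that unfolding \<sigma>_def by (intro powr_mono2') auto
      have "\<bar>Arg ?z\<bar> \<le> pi" using Arg_bounded[of ?z] by (simp add: abs_le_iff)
      then have "\<bar>Im w\<bar> * \<bar>Arg ?z\<bar> \<le> \<bar>Im w\<bar> * pi" by (intro mult_left_mono) auto
      then have "- Im w * Arg ?z \<le> pi * \<bar>Im w\<bar>" using abs_ge_self[of "- Im w * Arg ?z"] by (simp add: abs_mult mult.commute)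
      then show "exp (- Im w * Arg ?z) \<le> exp (pi * \<bar>Im w\<bar>)" by simp
    qed auto
    also have "\<dots> = M * r powr (\<sigma> - 1)"
      unfolding M_def using that by (subst powr_mult) auto
    finally have "norm (?z powr (w - 1)) \<le> M * r powr (\<sigma> - 1)" .
    then have "exp (- (r * (1 - v))) * norm (?z powr (w - 1)) \<le> exp (- (r * (1 - v))) * (M * r powr (\<sigma> - 1))"
      by (intro mult_left_mono) auto
    then show ?thesis by (simp add: f_def norm_mult mult.commute)
  qed
  \<comment> \<open>A straight chord replaces the quarter circle. Integrating the factor
    \<open>exp (- (r * (1 - v)))\<close> gives the first bound, used for large \<open>r\<close>;
    bounding it by 1 gives the second, used for \<open>r\<close> near 0.\<close>
  have arc: "norm (F (\<i> * of_real r) - F (of_real r)) \<le> 2 * M * r powr (\<sigma> - 1)" 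
            "norm (F (\<i> * of_real r) - F (of_real r)) \<le> 2 * M * r powr \<sigma>" if r: "r > 0" for r
  proof -
    let ?z = "\<lambda>v. complex_of_real (r * (1 - v)) + \<i> * of_real (r * v)"
    have inS: "?z v \<in> S" for v using r by (simp add: S_def algebra_simps)
    have dz: "((\<lambda>v. F (?z v)) has_vector_derivative (\<i> * r - r) * f (?z v)) (at v)" for v
    proof -
      have "(?z has_vector_derivative (\<i> * r - r)) (at v)"
      proof -
        have "?z = (\<lambda>v. complex_of_real r + of_real v * (\<i> * r - r))" by (auto simp: algebra_simps)
        moreover have "((\<lambda>v. complex_of_real r + of_real v * (\<i> * r - r)) has_vector_derivative (0 + 1 * (\<i> * r - r))) (at v)"
          by (intro has_vector_derivative_add has_vector_derivative_const has_vector_derivative_mult_left)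
             (auto intro!: derivative_eq_intros)
        ultimately show ?thesis by simp
      qed
      from field_vector_diff_chain_at[OF this F'[OF inS]] show ?thesis by (simp add: o_def)
    qed
    have cont: "continuous_on {0..1} (\<lambda>v. F (?z v))"
      using dz has_vector_derivative_continuous by (intro continuous_at_imp_continuous_on) blast
    have nr: "norm (\<i> * complex_of_real r - r) \<le> 2 * r"
      using norm_triangle_ineq4[of "\<i> * complex_of_real r" "of_real r"] r by (simp add: norm_mult)
    have db: "norm ((\<i> * r - r) * f (?z v)) \<le> 2 * M * r powr (\<sigma> - 1) * (r * exp (- (r * (1 - v))))" if "0 < v" "v < 1" for v
    proof -
      have "norm ((\<i> * r - r) * f (?z v)) \<le> (2 * r) * (M * r powr (\<sigma> - 1) * exp (- (r * (1 - v))))"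
        unfolding norm_mult using that r by (intro mult_mono nr fb) auto
      then show ?thesis by (simp add: mult_ac)
    qed
    have "norm (F (?z 1) - F (?z 0)) \<le> 2 * M * r powr (\<sigma> - 1) * exp (- (r * (1 - 1))) - 2 * M * r powr (\<sigma> - 1) * exp (- (r * (1 - 0)))"
    proof (rule differentiable_bound_general[OF _ cont _ dz _ db])
      fix v show "((\<lambda>v. 2 * M * r powr (\<sigma> - 1) * exp (- (r * (1 - v)))) has_vector_derivative 2 * M * r powr (\<sigma> - 1) * (r * exp (- (r * (1 - v))))) (at v)"
        unfolding has_real_derivative_iff_has_vector_derivative[symmetric]
        by (auto intro!: derivative_eq_intros)
    qed (auto intro!: continuous_intros)
    also have "\<dots> \<le> 2 * M * r powr (\<sigma> - 1)" using M0 by simp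
    finally show "norm (F (\<i> * of_real r) - F (of_real r)) \<le> 2 * M * r powr (\<sigma> - 1)" by simp
    have "norm (F (?z 1) - F (?z 0)) \<le> 2 * M * r powr \<sigma> * 1 - 2 * M * r powr \<sigma> * 0"
    proof (rule differentiable_bound_general[OF _ cont _ dz])
      fix v :: real assume v: "0 < v" "v < 1"
      have "norm ((\<i> * r - r) * f (?z v)) \<le> 2 * M * r powr (\<sigma> - 1) * (r * exp (- (r * (1 - v))))"
        by (rule db[OF v])
      also have "\<dots> \<le> 2 * M * r powr (\<sigma> - 1) * (r * 1)"
        using r v M0 by (intro mult_left_mono) auto
      also have "\<dots> = 2 * M * r powr \<sigma>" using r by (simp add: powr_diff)
      finally show "norm ((\<i> * r - r) * f (?z v)) \<le> 2 * M * r powr \<sigma>" .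
      show "((\<lambda>v. 2 * M * r powr \<sigma> * v) has_vector_derivative 2 * M * r powr \<sigma>) (at v)"
        unfolding has_real_derivative_iff_has_vector_derivative[symmetric]
        by (auto intro!: derivative_eq_intros)
    qed (auto intro!: continuous_intros)
    then show "norm (F (\<i> * of_real r) - F (of_real r)) \<le> 2 * M * r powr \<sigma>" by simp
  qed
  have ftc1: "integral {a..b} (\<lambda>u. of_real (exp (-u)) * of_real u powr (w - 1)) = F (of_real b) - F (of_real a)" if "0 < a" "a \<le> b" for a b
  proof (rule integral_unique, rule fundamental_theorem_of_calculus)
    fix u assume "u \<in> {a..b}"
    then have "complex_of_real u \<in> S" using that by (simp add: S_def)
    from has_vector_derivative_real_field[OF F'[OF this], of "{a..b}"]
    show "((\<lambda>u. F (of_real u)) has_vector_derivative of_real (exp (-u)) * of_real u powr (w - 1)) (at u within {a..b})"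
      by (simp add: f_def exp_of_real[symmetric])
  qed (use that in auto)
  have ftc2: "\<i> powr w * integral {a..b} (\<lambda>u. cis (-u) * of_real u powr (w - 1)) = F (\<i> * of_real b) - F (\<i> * of_real a)" if "0 < a" "a \<le> b" for a b
  proof -
    have "((\<lambda>u. \<i> powr w * (cis (-u) * of_real u powr (w - 1))) has_integral F (\<i> * of_real b) - F (\<i> * of_real a)) {a..b}"
    proof (rule fundamental_theorem_of_calculus)
      fix u assume u: "u \<in> {a..b}"
      then have "u > 0" using that by auto
      then have S: "\<i> * complex_of_real u \<in> S" using that by (simp add: S_def)
      have "((\<lambda>z. F (\<i> * z)) has_field_derivative f (\<i> * of_real u) * (\<i> * 1)) (at (of_real u))"
        using F'[OF S] by (intro DERIV_chain2[where f = F and g = "\<lambda>z. \<i> * z"]) (auto intro!: derivative_eq_intros)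
      from has_vector_derivative_real_field[OF this, of "{a..b}"]
      have "((\<lambda>u. F (\<i> * of_real u)) has_vector_derivative f (\<i> * of_real u) * \<i>) (at u within {a..b})" by simp
      moreover have "f (\<i> * of_real u) * \<i> = \<i> powr w * (cis (-u) * of_real u powr (w - 1))"
      proof -
        have "(of_real u * \<i>) powr (w - 1) = of_real u powr (w - 1) * \<i> powr (w - 1)"
          using \<open>u > 0\<close> by (intro powr_times_real_left) auto
        moreover have "\<i> powr (w - 1) * \<i> = \<i> powr w"
          using powr_add[of \<i> "w - 1" 1] by simp
        ultimately show ?thesis by (simp add: f_def cis_conv_exp mult_ac)
      qed
      ultimately show "((\<lambda>u. F (\<i> * of_real u)) has_vector_derivative \<i> powr w * (cis (-u) * of_real u powr (w - 1))) (at u within {a..b})" by simp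
    qed (use that in auto)
    from integral_unique[OF this] show ?thesis by simp
  qed
  define D where "D = (\<lambda>a b. integral {a..b} (\<lambda>u. of_real (exp (-u)) * of_real u powr (w - 1)) - 
          \<i> powr w * integral {a..b} (\<lambda>u. cis (-u) * of_real u powr (w - 1)))"
  have "norm (D 0 R) \<le> 2 * M * R powr (\<sigma> - 1)" if R: "R > 0" for R
  proof (rule le_of_le_add_powr[of \<sigma> R _ _ "2 * M + (1 + norm (\<i> powr w)) / \<sigma>"])
    fix \<epsilon> assume \<epsilon>: "0 < \<epsilon>" "\<epsilon> < R"
    have "D 0 R = D 0 \<epsilon> + D \<epsilon> R"
      unfolding D_def using \<epsilon> w 
      by (subst (1 2) integral_combine_powr[of w 0 R _ \<epsilon>]) (auto intro!: continuous_intros simp: algebra_simps)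
    moreover have "D \<epsilon> R = (F (of_real R) - F (of_real \<epsilon>)) - (F (\<i> * of_real R) - F (\<i> * of_real \<epsilon>))"
      unfolding D_def using \<epsilon> by (simp add: ftc1 ftc2)
    ultimately have eq: "D 0 R = D 0 \<epsilon> - (F (\<i> * of_real R) - F (of_real R)) + (F (\<i> * of_real \<epsilon>) - F (of_real \<epsilon>))"
      by simp
    have "norm (D 0 R) \<le> norm (D 0 \<epsilon>) + 2 * M * R powr (\<sigma> - 1) + 2 * M * \<epsilon> powr \<sigma>"
      unfolding eq using arc(1)[OF R] arc(2)[OF \<epsilon>(1)]
        norm_triangle_ineq[of "D 0 \<epsilon> - (F (\<i> * of_real R) - F (of_real R))" "F (\<i> * of_real \<epsilon>) - F (of_real \<epsilon>)"]
        norm_triangle_ineq4[of "D 0 \<epsilon>" "F (\<i> * of_real R) - F (of_real R)"] by linarith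
    moreover have "norm (D 0 \<epsilon>) \<le> \<epsilon> powr \<sigma> / \<sigma> + norm (\<i> powr w) * (\<epsilon> powr \<sigma> / \<sigma>)"
    proof -
      have "norm (D 0 \<epsilon>) \<le> norm (integral {0..\<epsilon>} (\<lambda>u. of_real (exp (-u)) * of_real u powr (w - 1))) +
          norm (\<i> powr w) * norm (integral {0..\<epsilon>} (\<lambda>u. cis (-u) * of_real u powr (w - 1)))"
        unfolding D_def norm_mult[symmetric] by (rule norm_triangle_ineq4)
      also have "\<dots> \<le> \<epsilon> powr \<sigma> / \<sigma> + norm (\<i> powr w) * (\<epsilon> powr \<sigma> / \<sigma>)"
        unfolding \<sigma>_def using w \<epsilon>
        by (intro add_mono mult_left_mono powr_integral_near_0) (auto intro!: continuous_intros)
      finally show ?thesis .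
    qed
    ultimately show "norm (D 0 R) \<le> 2 * M * R powr (\<sigma> - 1) + (2 * M + (1 + norm (\<i> powr w)) / \<sigma>) * \<epsilon> powr \<sigma>"
      by (simp add: algebra_simps add_divide_distrib)
  qed (use R w in \<open>auto simp: \<sigma>_def\<close>)
  then show ?thesis using that[of "2 * M"] unfolding D_def \<sigma>_def by blast
qed

lemma has_integral_atLeast_tendsto:
  fixes f :: "real \<Rightarrow> 'a :: banach"
  assumes "(f has_integral I) {a..}"
  shows "((\<lambda>R. integral {a..R} f) \<longlongrightarrow> I) at_top"
proof (rule tendstoI)
  fix e :: real assume "e > 0"
  then obtain B where B: "B > 0" "\<And>l r. ball 0 B \<subseteq> cbox l r \<Longrightarrow> 
      norm (integral (cbox l r) (\<lambda>x. if x \<in> {a..} then f x else 0) - I) < e"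
    using assms unfolding has_integral_alt' by blast
  have "dist (integral {a..R} f) I < e" if R: "R \<ge> max B (max a 0)" for R
  proof -
    let ?l = "min (- B) a"
    have "ball 0 B \<subseteq> cbox ?l R" using R by (auto simp: dist_norm)
    from B(2)[OF this] have "norm (integral {?l..R} (\<lambda>x. if x \<in> {a..} then f x else 0) - I) < e" by simp
    also have "integral {?l..R} (\<lambda>x. if x \<in> {a..} then f x else 0) = integral ({?l..R} \<inter> {a..}) f"
      using integral_restrict_Int[of "{?l..R}" "{a..}" f] by (simp add: Int_commute)
    also have "{?l..R} \<inter> {a..} = {a..R}" by auto
    finally show ?thesis by (simp add: dist_norm)
  qed
  then show "\<forall>\<^sub>F R in at_top. dist (integral {a..R} f) I < e"
    by (intro eventually_at_top_linorderI)
qed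

text \<open>The integral converges only conditionally, hence the limit over \<open>R\<close>. The
  error of the rotation is \<open>O(R powr (Re w - 1))\<close> and disappears since
  \<open>Re w < 1\<close>.\<close>

lemma mellin_cis_minus:
  assumes w: "0 < Re w" "Re w < 1"
  shows "((\<lambda>R. integral {0..R} (\<lambda>u. cis (-u) * of_real u powr (w - 1))) \<longlongrightarrow> Gamma w * \<i> powr (- w)) at_top"
proof -
  let ?A = "\<lambda>R. integral {0..R} (\<lambda>u. of_real (exp (-u)) * of_real u powr (w - 1)) :: complex"
  let ?B = "\<lambda>R. integral {0..R} (\<lambda>u. cis (-u) * of_real u powr (w - 1))"
  obtain C where C: "\<And>R. R > 0 \<Longrightarrow> norm (?A R - \<i> powr w * ?B R) \<le> C * R powr (Re w - 1)"
    using gamma_rotation_bound[OF w] by blast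
  have "((\<lambda>u. of_real (exp (-u)) * complex_of_real u powr (w - 1)) has_integral Gamma w) {0..}"
    using Gamma_integral_complex[OF w(1)] by (simp add: exp_minus field_simps)
  then have A: "(?A \<longlongrightarrow> Gamma w) at_top" by (rule has_integral_atLeast_tendsto)
  have "((\<lambda>R. C * R powr (Re w - 1)) \<longlongrightarrow> 0) at_top"
    using w by real_asymp
  then have "((\<lambda>R. ?A R - \<i> powr w * ?B R) \<longlongrightarrow> 0) at_top"
    by (rule Lim_null_comparison[rotated]) (use C in \<open>auto intro!: eventually_at_top_linorderI[of 1]\<close>)
  from tendsto_diff[OF A this] have "((\<lambda>R. \<i> powr w * ?B R) \<longlongrightarrow> Gamma w) at_top" by simp
  from tendsto_mult_right[OF this, of "\<i> powr (-w)"] 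
  show ?thesis by (simp add: powr_minus field_simps)
qed

text \<open>The conjugate of the preceding transform, taken at \<open>cnj w\<close>.\<close>

lemma mellin_cis_plus:
  assumes w: "0 < Re w" "Re w < 1"
  shows "((\<lambda>R. integral {0..R} (\<lambda>u. cis u * of_real u powr (w - 1))) \<longlongrightarrow> Gamma w * \<i> powr w) at_top"
proof -
  have "((\<lambda>R. cnj (integral {0..R} (\<lambda>u. cis (-u) * of_real u powr (cnj w - 1)))) \<longlongrightarrow> cnj (Gamma (cnj w) * \<i> powr (- cnj w))) at_top"
    using w by (intro tendsto_cnj mellin_cis_minus) auto
  moreover have "cnj (Gamma (cnj w) * \<i> powr (- cnj w)) = Gamma w * \<i> powr w"
  proof -
    have "\<i> powr (- cnj w) = exp (- cnj w * (\<i> * pi / 2))" "\<i> powr w = exp (w * (\<i> * pi / 2))"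
      by (simp_all add: powr_def)
    then show ?thesis by (simp add: cnj_Gamma exp_cnj)
  qed
  moreover have "cnj (integral {0..R} (\<lambda>u. cis (-u) * of_real u powr (cnj w - 1))) = integral {0..R} (\<lambda>u. cis u * of_real u powr (w - 1))" for R
  proof -
    have "cnj (complex_of_real u powr (cnj w - 1)) = of_real u powr (w - 1)" if "u \<ge> 0" for u
      using that by (cases "u = 0") (auto simp: powr_def exp_cnj Ln_of_real)
    then have "integral {0..R} (\<lambda>u. cnj (cis (-u) * of_real u powr (cnj w - 1))) = integral {0..R} (\<lambda>u. cis u * of_real u powr (w - 1))"
      by (intro integral_cong) (simp add: cis_cnj)
    then show ?thesis by (simp add: integral_cnj)
  qed
  ultimately show ?thesis by simp
qed

section \<open>First-derivative estimates for oscillatory integrals\<close>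

text \<open>\<open>q\<close> stands for the amplitude divided by the derivative of the phase, so
  \<open>q * \<theta>'\<close> is the amplitude. After integration by parts the remaining integral
  is at most the total variation of \<open>q\<close>, which monotonicity reduces to the endpoint
  values.\<close>

lemma first_derivative_test:
  fixes q \<theta> q' \<theta>' :: "real \<Rightarrow> real"
  assumes ab: "a \<le> b"
    and q: "\<And>u. u \<in> {a..b} \<Longrightarrow> (q has_real_derivative q' u) (at u within {a..b})"
    and \<theta>: "\<And>u. u \<in> {a..b} \<Longrightarrow> (\<theta> has_real_derivative \<theta>' u) (at u within {a..b})"
    and c: "continuous_on {a..b} q'" 
    and mono: "(\<forall>u\<in>{a..b}. q' u \<le> 0) \<or> (\<forall>u\<in>{a..b}. q' u \<ge> 0)"
  shows "norm (integral {a..b} (\<lambda>u. of_real (q u * \<theta>' u) * cis (\<theta> u))) \<le> 2 * (\<bar>q a\<bar> + \<bar>q b\<bar>)"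
proof -
  have cth: "continuous_on {a..b} \<theta>" using \<theta> by (rule DERIV_continuous_on)
  have "((\<lambda>u. of_real (q' u) * cis (\<theta> u) + of_real (q u * \<theta>' u) * (\<i> * cis (\<theta> u))) has_integral
     of_real (q b) * cis (\<theta> b) - of_real (q a) * cis (\<theta> a)) {a..b}"
  proof (rule fundamental_theorem_of_calculus[OF ab])
    fix u assume u: "u \<in> {a..b}"
    have "((\<lambda>u. of_real (q u) * cis (\<theta> u)) has_vector_derivative (of_real (q u) * (\<theta>' u *\<^sub>R (\<i> * cis (\<theta> u))) + of_real (q' u) * cis (\<theta> u))) (at u within {a..b})"
    proof (intro has_vector_derivative_mult)
      show "((\<lambda>u. complex_of_real (q u)) has_vector_derivative of_real (q' u)) (at u within {a..b})"
        using q[OF u] by (intro has_vector_derivative_of_real) (simp add: has_real_derivative_iff_has_vector_derivative)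
      show "((\<lambda>u. cis (\<theta> u)) has_vector_derivative (\<theta>' u *\<^sub>R (\<i> * cis (\<theta> u)))) (at u within {a..b})"
        using has_derivative_cis[OF \<theta>[OF u, unfolded has_field_derivative_def]]
        unfolding has_vector_derivative_def by (simp add: mult.commute)
    qed
    then show "((\<lambda>u. of_real (q u) * cis (\<theta> u)) has_vector_derivative of_real (q' u) * cis (\<theta> u) + of_real (q u * \<theta>' u) * (\<i> * cis (\<theta> u))) (at u within {a..b})"
      by (simp add: scaleR_conv_of_real algebra_simps)
  qed
  moreover have i1: "(\<lambda>u. of_real (q' u) * cis (\<theta> u)) integrable_on {a..b}"
    using c cth by (intro integrable_continuous_real continuous_intros)
  ultimately have "((\<lambda>u. of_real (q u * \<theta>' u) * (\<i> * cis (\<theta> u))) has_integral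
     (of_real (q b) * cis (\<theta> b) - of_real (q a) * cis (\<theta> a)) - integral {a..b} (\<lambda>u. of_real (q' u) * cis (\<theta> u))) {a..b}"
    using has_integral_diff[OF _ integrable_integral[OF i1]] by fastforce
  from has_integral_mult_right[OF this, of "- \<i>"]
  have "integral {a..b} (\<lambda>u. of_real (q u * \<theta>' u) * cis (\<theta> u)) = - \<i> * ((of_real (q b) * cis (\<theta> b) - of_real (q a) * cis (\<theta> a)) - integral {a..b} (\<lambda>u. of_real (q' u) * cis (\<theta> u)))"
    by (intro integral_unique) (simp add: algebra_simps)
  then have "norm (integral {a..b} (\<lambda>u. of_real (q u * \<theta>' u) * cis (\<theta> u))) = norm ((of_real (q b) * cis (\<theta> b) - of_real (q a) * cis (\<theta> a)) - integral {a..b} (\<lambda>u. of_real (q' u) * cis (\<theta> u)))"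
    by (simp only: norm_mult norm_minus_cancel norm_ii mult_1_left)
  also have "\<dots> \<le> norm (of_real (q b) * cis (\<theta> b)) + norm (of_real (q a) * cis (\<theta> a)) + norm (integral {a..b} (\<lambda>u. of_real (q' u) * cis (\<theta> u)))"
    by (meson add_mono_thms_linordered_semiring(3) norm_triangle_ineq4 order_trans)
  also have "norm (of_real (q b) * cis (\<theta> b)) = \<bar>q b\<bar>" by (simp add: norm_mult)
  also have "norm (of_real (q a) * cis (\<theta> a)) = \<bar>q a\<bar>" by (simp add: norm_mult)
  also have "norm (integral {a..b} (\<lambda>u. of_real (q' u) * cis (\<theta> u))) \<le> integral {a..b} (\<lambda>u. \<bar>q' u\<bar>)"
    using c by (intro integral_norm_bound_integral i1 integrable_continuous_real continuous_intros) (auto simp: norm_mult)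
  also have "integral {a..b} (\<lambda>u. \<bar>q' u\<bar>) = \<bar>q b - q a\<bar>"
  proof -
    have "(q' has_integral (q b - q a)) {a..b}"
      using q by (intro fundamental_theorem_of_calculus ab) (simp add: has_real_derivative_iff_has_vector_derivative)
    then have "integral {a..b} q' = q b - q a" and i: "q' integrable_on {a..b}" by (auto simp: has_integral_iff)
    from mono show ?thesis
    proof
      assume m: "\<forall>u\<in>{a..b}. q' u \<le> 0"
      then have "integral {a..b} (\<lambda>u. \<bar>q' u\<bar>) = integral {a..b} (\<lambda>u. - q' u)" by (intro integral_cong) auto
      moreover have "integral {a..b} q' \<le> integral {a..b} (\<lambda>_. 0)"
        using m i by (intro integral_le) auto
      ultimately show ?thesis using \<open>integral {a..b} q' = q b - q a\<close> by simp
    next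
      assume m: "\<forall>u\<in>{a..b}. q' u \<ge> 0"
      then have "integral {a..b} (\<lambda>u. \<bar>q' u\<bar>) = integral {a..b} q'" by (intro integral_cong) auto
      moreover have "integral {a..b} (\<lambda>_. 0) \<le> integral {a..b} q'"
        using m i by (intro integral_le) auto
      ultimately show ?thesis using \<open>integral {a..b} q' = q b - q a\<close> by simp
    qed
  qed
  also have "\<bar>q b\<bar> + \<bar>q a\<bar> + \<bar>q b - q a\<bar> \<le> 2 * (\<bar>q a\<bar> + \<bar>q b\<bar>)"
  proof -
    have "x + y + z \<le> 2 * (y + x)" if "z \<le> x + y" for x y z :: real using that by simp
    then show ?thesis using abs_triangle_ineq4 by blast
  qed
  finally show ?thesis by simp
qed

text \<open>The first derivative test with \<open>q u = u powr e / (c * u - t)\<close>. Assumption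
  \<open>nz\<close> excludes a stationary point of the phase, and \<open>sg\<close> fixes the sign
  of the numerator in the derivative of \<open>q\<close>.\<close>

lemma powr_oscillation_bound:
  fixes a b c t e :: real
  assumes ab: "0 < a" "a \<le> b"
    and nz: "\<And>u. u \<in> {a..b} \<Longrightarrow> c * u \<noteq> t"
    and sg: "(\<forall>u\<in>{a..b}. (e - 1) * c * u - e * t \<le> 0) \<or> (\<forall>u\<in>{a..b}. (e - 1) * c * u - e * t \<ge> 0)"
  shows "norm (integral {a..b} (\<lambda>u. of_real (u powr (e - 1)) * cis (c * u - t * ln u))) \<le>
           2 * (a powr e / \<bar>c * a - t\<bar> + b powr e / \<bar>c * b - t\<bar>)"
proof -
  define q where "q = (\<lambda>u. u powr e / (c * u - t))"
  define q' where "q' = (\<lambda>u. u powr (e - 1) * ((e - 1) * c * u - e * t) / (c * u - t)\<^sup>2)"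
  have pos: "u > 0" if "u \<in> {a..b}" for u using that ab by auto
  have "norm (integral {a..b} (\<lambda>u. of_real (q u * (c - t / u)) * cis (c * u - t * ln u))) \<le> 2 * (\<bar>q a\<bar> + \<bar>q b\<bar>)"
  proof (rule first_derivative_test[OF ab(2), where q' = q'])
    fix u assume u: "u \<in> {a..b}"
    note p = pos[OF u] and n = nz[OF u]
    have "(q has_real_derivative ((e * u powr (e - 1)) * (c * u - t) - u powr e * c) / ((c * u - t) * (c * u - t))) (at u)"
      unfolding q_def using p n by (auto intro!: derivative_eq_intros simp: powr_diff divide_simps)
    also have "((e * u powr (e - 1)) * (c * u - t) - u powr e * c) = u powr (e - 1) * ((e - 1) * c * u - e * t)"
      using p by (simp add: powr_diff field_simps)
    finally show "(q has_real_derivative q' u) (at u within {a..b})"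
      unfolding q'_def by (simp add: power2_eq_square has_field_derivative_at_within)
    show "((\<lambda>u. c * u - t * ln u) has_real_derivative c - t / u) (at u within {a..b})"
      using p by (auto intro!: derivative_eq_intros)
  next
    show "continuous_on {a..b} q'"
      unfolding q'_def using pos nz by (intro continuous_intros) force+
    show "(\<forall>u\<in>{a..b}. q' u \<le> 0) \<or> (\<forall>u\<in>{a..b}. q' u \<ge> 0)"
      using sg unfolding q'_def
      by (auto intro!: divide_nonpos_nonneg mult_nonneg_nonpos divide_nonneg_nonneg mult_nonneg_nonneg)
  qed
  also have "integral {a..b} (\<lambda>u. of_real (q u * (c - t / u)) * cis (c * u - t * ln u)) = 
     integral {a..b} (\<lambda>u. of_real (u powr (e - 1)) * cis (c * u - t * ln u))"
  proof (rule integral_cong)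
    fix u assume u: "u \<in> {a..b}"
    have "q u * (c - t / u) = u powr (e - 1)"
      unfolding q_def using pos[OF u] nz[OF u] by (simp add: powr_diff field_simps)
    then show "of_real (q u * (c - t / u)) * cis (c * u - t * ln u) = of_real (u powr (e - 1)) * cis (c * u - t * ln u)" by simp
  qed
  also have "\<bar>q a\<bar> = a powr e / \<bar>c * a - t\<bar>" by (simp add: q_def)
  also have "\<bar>q b\<bar> = b powr e / \<bar>c * b - t\<bar>" by (simp add: q_def)
  finally show ?thesis .
qed

lemma le_four_times: "n \<le> 2 * (x + y) \<Longrightarrow> x \<le> B \<Longrightarrow> y \<le> B \<Longrightarrow> n \<le> 4 * B" for n x y B :: real
  by (simp add: distrib_left)

lemma powr_real_polar: 
  assumes "u > 0" shows "complex_of_real u powr w = of_real (u powr Re w) * cis (Im w * ln u)"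
proof -
  have "w * of_real (ln u) = of_real (Re w * ln u) + \<i> * of_real (Im w * ln u)"
    by (simp add: complex_eq_iff)
  then show ?thesis using assms
    by (simp add: powr_def cis_conv_exp Ln_of_real exp_add exp_of_real[symmetric])
qed

lemma sin_cis: "complex_of_real (sin x) = (cis x - cis (- x)) / (2 * \<i>)"
  by (simp add: complex_eq_iff)

lemma cos_cis: "complex_of_real (cos x) = (cis x + cis (- x)) / 2"
  by (simp add: complex_eq_iff)

text \<open>The sine splits into two exponentials: the one with frequency \<open>c\<close> is
  stationary at \<open>Im s / c\<close>, left of \<open>a\<close>, and the other nowhere on the
  positive axis. Negative real parts with \<open>Im s = 0\<close> serve the functional equation,
  \<open>Re s \<ge> 0\<close> serves the approximations of zeta.\<close>

lemma sin_integral_tail: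
  assumes ab: "0 < a" "a \<le> b" and k: "c > 0" "c * a > Im s" "Im s \<ge> 0"
    and s: "Re s > -1" "Re s \<ge> 0 \<or> Im s = 0"
  shows "norm (integral {a..b} (\<lambda>u. of_real (sin (c * u)) * of_real u powr (- s - 1))) \<le>
     4 * a powr (- Re s) / (c * a - Im s)"
proof -
  define t e where "t = Im s" and "e = - Re s"
  define B where "B = a powr e / (c * a - t)"
  have cu: "c * u > t" if "u \<ge> a" for u
    using k that mult_left_mono[of a u c] unfolding t_def by linarith
  have le: "u powr e / (c * u - t) \<le> B" if "u \<ge> a" for u
  proof (cases "Re s \<ge> 0")
    case True
    then show ?thesis unfolding B_def using that ab k cu[of a]
      by (intro frac_le powr_mono2' ) (auto simp: e_def)
  next
    case False
    then have t0: "t = 0" using s by (simp add: t_def)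
    have "u powr (e - 1) \<le> a powr (e - 1)" using s that ab by (intro powr_mono2') (auto simp: e_def)
    then show ?thesis unfolding B_def t0 using that ab k by (simp add: powr_diff field_simps)
  qed
  have le': "u powr e / \<bar>- c * u - t\<bar> \<le> B" if "u \<ge> a" for u
  proof -
    have "u powr e / \<bar>- c * u - t\<bar> \<le> u powr e / (c * u - t)"
      using that ab k cu[OF that] unfolding t_def by (intro divide_left_mono) auto
    with le[OF that] show ?thesis by linarith
  qed
  have P: "norm (integral {a..b} (\<lambda>u. of_real (u powr (e - 1)) * cis (c * u - t * ln u))) \<le> 4 * B"
  proof -
    have "norm (integral {a..b} (\<lambda>u. of_real (u powr (e - 1)) * cis (c * u - t * ln u))) \<le> 2 * (a powr e / \<bar>c * a - t\<bar> + b powr e / \<bar>c * b - t\<bar>)"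
    proof (rule powr_oscillation_bound[OF ab])
      show "c * u \<noteq> t" if "u \<in> {a..b}" for u using cu[of u] that by auto
      have "(e - 1) * c * u - e * t \<le> 0" if "u \<in> {a..b}" for u
      proof (cases "Re s \<ge> 0")
        case True
        have "(e - 1) * c * u - e * t = - (Re s * (c * u - t)) - c * u" by (simp add: e_def algebra_simps)
        also have "\<dots> \<le> 0" 
        proof -
          have "0 \<le> Re s * (c * u - t)" "0 \<le> c * u"
            using True cu[of u] that k ab by (auto intro!: mult_nonneg_nonneg)
          then show ?thesis by linarith
        qed
        finally show ?thesis .
      next
        case False
        then have "t = 0" using s by (simp add: t_def)
        then show ?thesis using s that ab k by (simp add: e_def mult_nonpos_nonneg)
      qed
      then show "(\<forall>u\<in>{a..b}. (e - 1) * c * u - e * t \<le> 0) \<or> (\<forall>u\<in>{a..b}. (e - 1) * c * u - e * t \<ge> 0)" by blast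
    qed
    then show ?thesis by (rule le_four_times) (use le[of a] le[of b] cu[of a] cu[of b] ab in auto)
  qed
  have M: "norm (integral {a..b} (\<lambda>u. of_real (u powr (e - 1)) * cis (- c * u - t * ln u))) \<le> 4 * B"
  proof -
    have "norm (integral {a..b} (\<lambda>u. of_real (u powr (e - 1)) * cis (- c * u - t * ln u))) \<le> 2 * (a powr e / \<bar>- c * a - t\<bar> + b powr e / \<bar>- c * b - t\<bar>)"
    proof (rule powr_oscillation_bound[OF ab])
      show "- c * u \<noteq> t" if "u \<in> {a..b}" for u using cu[of u] that k ab by (auto simp: t_def)
      have "(e - 1) * (- c) * u - e * t \<ge> 0" if "u \<in> {a..b}" for u
      proof (cases "Re s \<ge> 0")
        case True
        have "(e - 1) * (- c) * u - e * t = Re s * (c * u) + c * u + Re s * t" by (simp add: e_def algebra_simps)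
        also have "\<dots> \<ge> 0" using True that k ab unfolding t_def by (intro add_nonneg_nonneg mult_nonneg_nonneg) auto
        finally show ?thesis .
      next
        case False
        then have "t = 0" using s by (simp add: t_def)
        then show ?thesis using s that ab k by (simp add: e_def mult_nonpos_nonneg)
      qed
      then show "(\<forall>u\<in>{a..b}. (e - 1) * (- c) * u - e * t \<le> 0) \<or> (\<forall>u\<in>{a..b}. (e - 1) * (- c) * u - e * t \<ge> 0)" by blast
    qed
    then show ?thesis by (rule le_four_times) (use le'[of a] le'[of b] ab in auto)
  qed
  have int: "(\<lambda>u. of_real (u powr (e - 1)) * cis (d * u - t * ln u)) integrable_on {a..b}" for d
    using ab by (intro integrable_continuous_real continuous_intros) auto
  have "integral {a..b} (\<lambda>u. of_real (sin (c * u)) * of_real u powr (- s - 1)) =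
     integral {a..b} (\<lambda>u. (of_real (u powr (e - 1)) * cis (c * u - t * ln u) - of_real (u powr (e - 1)) * cis (- c * u - t * ln u)) / (2 * \<i>))"
  proof (rule integral_cong)
    fix u assume "u \<in> {a..b}"
    then have u: "u > 0" using ab by auto
    have "cis (c * u - t * ln u) = cis (c * u) * cis (- t * ln u)" "cis (- c * u - t * ln u) = cis (- (c * u)) * cis (- t * ln u)"
      by (simp_all add: cis_mult)
    then show "of_real (sin (c * u)) * of_real u powr (- s - 1) = (of_real (u powr (e - 1)) * cis (c * u - t * ln u) - of_real (u powr (e - 1)) * cis (- c * u - t * ln u)) / (2 * \<i>)"
      by (simp add: powr_real_polar[OF u] sin_cis t_def e_def field_simps)
  qed
  also have "\<dots> = (integral {a..b} (\<lambda>u. of_real (u powr (e - 1)) * cis (c * u - t * ln u)) - integral {a..b} (\<lambda>u. of_real (u powr (e - 1)) * cis (- c * u - t * ln u))) / (2 * \<i>)"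
    by (intro integral_unique has_integral_divide has_integral_diff integrable_integral int)
  also have "norm \<dots> \<le> (4 * B + 4 * B) / 2"
    using norm_triangle_ineq4[of "integral {a..b} (\<lambda>u. of_real (u powr (e - 1)) * cis (c * u - t * ln u))" "integral {a..b} (\<lambda>u. of_real (u powr (e - 1)) * cis (- c * u - t * ln u))"] P M
    by (simp add: norm_divide norm_mult)
  also have "(4 * B + 4 * B) / 2 = 4 * B" by simp
  finally show ?thesis by (simp add: B_def t_def e_def)
qed

text \<open>The mirror image of the tail estimate: now the stationary point \<open>Im s / c\<close>
  lies beyond \<open>b\<close>. On \<open>Re s = 1/2\<close> the singularity at 0 is integrable, so
  a bound from \<open>\<epsilon>\<close> to \<open>b\<close> that is uniform in
  \<open>\<epsilon>\<close> extends to 0.\<close>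

lemma cos_integral_head:
  assumes b: "0 < b" and k: "c > 0" "c * b < Im s" and s: "Re s = 1/2"
  shows "norm (integral {0..b} (\<lambda>u. of_real (cos (c * u)) * of_real u powr (- s))) \<le> 4 * sqrt b / (Im s - c * b)"
proof -
  define t where "t = Im s"
  define B where "B = b powr (1/2) / (t - c * b)"
  have cu: "c * u \<le> c * b" "c * u < t" if "u \<le> b" for u
  proof -
    show "c * u \<le> c * b" using k that by (intro mult_left_mono) auto
    then show "c * u < t" using k unfolding t_def by linarith
  qed
  have leb: "norm (integral {a..b} (\<lambda>u. of_real (u powr (1/2 - 1)) * cis (d * u - t * ln u))) \<le> 4 * B"
    if a: "0 < a" "a \<le> b" and d: "d = c \<or> d = - c" for a d
  proof -
    have le: "u powr (1/2) / \<bar>d * u - t\<bar> \<le> B" if u: "0 < u" "u \<le> b" for u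
    proof -
      have "0 < c * u" "0 < c * b" using u k b by auto
      then have "t - c * b \<le> \<bar>c * u - t\<bar>" "t - c * b \<le> \<bar>- (c * u) - t\<bar>" using cu[of u] u by linarith+
      then have "t - c * b \<le> \<bar>d * u - t\<bar>" using d by auto
      then show ?thesis unfolding B_def using u k by (intro frac_le powr_mono2) (auto simp: t_def)
    qed
    have "norm (integral {a..b} (\<lambda>u. of_real (u powr (1/2 - 1)) * cis (d * u - t * ln u))) \<le> 2 * (a powr (1/2) / \<bar>d * a - t\<bar> + b powr (1/2) / \<bar>d * b - t\<bar>)"
    proof (rule powr_oscillation_bound[OF a])
      show "d * u \<noteq> t" if "u \<in> {a..b}" for u
      proof -
        have "0 < c * u" using that a k by auto
        then have "c * u \<noteq> t" "- (c * u) \<noteq> t" using cu[of u] that by auto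
        then show ?thesis using d by auto
      qed
      have "(1/2 - 1) * d * u - 1/2 * t \<le> 0" if "u \<in> {a..b}" for u
      proof -
        have "0 < c * u" using that a k by auto
        then have "(1/2 - 1) * (c * u) - 1/2 * t \<le> 0" "(1/2 - 1) * (- (c * u)) - 1/2 * t \<le> 0" using cu[of u] that by auto
        then show ?thesis using d by auto
      qed
      then show "(\<forall>u\<in>{a..b}. (1/2 - 1) * d * u - 1/2 * t \<le> 0) \<or> (\<forall>u\<in>{a..b}. (1/2 - 1) * d * u - 1/2 * t \<ge> 0)" by blast
    qed
    then show ?thesis by (rule le_four_times) (use le[of a] le[of b] a in auto)
  qed
  have main: "norm (integral {a..b} (\<lambda>u. of_real (cos (c * u)) * of_real u powr (- s))) \<le> 4 * B" if a: "0 < a" "a \<le> b" for a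
  proof -
    have int: "(\<lambda>u. of_real (u powr (1/2 - 1)) * cis (d * u - t * ln u)) integrable_on {a..b}" for d
      using a by (intro integrable_continuous_real continuous_intros) auto
    have "integral {a..b} (\<lambda>u. of_real (cos (c * u)) * of_real u powr (- s)) =
       integral {a..b} (\<lambda>u. (of_real (u powr (1/2 - 1)) * cis (c * u - t * ln u) + of_real (u powr (1/2 - 1)) * cis (- c * u - t * ln u)) / 2)"
    proof (rule integral_cong)
      fix u assume "u \<in> {a..b}"
      then have u: "u > 0" using a by auto
      have "cis (c * u - t * ln u) = cis (c * u) * cis (- t * ln u)" "cis (- c * u - t * ln u) = cis (- (c * u)) * cis (- t * ln u)"
        by (simp_all add: cis_mult)
      then show "of_real (cos (c * u)) * of_real u powr (- s) = (of_real (u powr (1/2 - 1)) * cis (c * u - t * ln u) + of_real (u powr (1/2 - 1)) * cis (- c * u - t * ln u)) / 2"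
        by (simp add: powr_real_polar[OF u] cos_cis t_def s field_simps)
    qed
    also have "\<dots> = (integral {a..b} (\<lambda>u. of_real (u powr (1/2 - 1)) * cis (c * u - t * ln u)) + integral {a..b} (\<lambda>u. of_real (u powr (1/2 - 1)) * cis (- c * u - t * ln u))) / 2"
      by (intro integral_unique has_integral_divide has_integral_add integrable_integral int)
    also have "norm \<dots> \<le> (4 * B + 4 * B) / 2"
      using norm_triangle_ineq[of "integral {a..b} (\<lambda>u. of_real (u powr (1/2 - 1)) * cis (c * u - t * ln u))" "integral {a..b} (\<lambda>u. of_real (u powr (1/2 - 1)) * cis (- c * u - t * ln u))"] 
        leb[OF a, of c] leb[OF a, of "-c"]
      by (simp add: norm_divide)
    finally show ?thesis by simp
  qed
  have "norm (integral {0..b} (\<lambda>u. of_real (cos (c * u)) * of_real u powr (- s))) \<le> 4 * B"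
  proof (rule le_of_le_add_powr[of "1/2" b _ _ 2])
    fix \<epsilon> assume \<epsilon>: "0 < \<epsilon>" "\<epsilon> < b"
    have "integral {0..b} (\<lambda>u. of_real (cos (c * u)) * of_real u powr ((1 - s) - 1)) =
       integral {0..\<epsilon>} (\<lambda>u. of_real (cos (c * u)) * of_real u powr ((1 - s) - 1)) + integral {\<epsilon>..b} (\<lambda>u. of_real (cos (c * u)) * of_real u powr ((1 - s) - 1))"
      using \<epsilon> s by (intro integral_combine_powr) (auto intro!: continuous_intros)
    moreover have "norm (integral {0..\<epsilon>} (\<lambda>u. of_real (cos (c * u)) * of_real u powr ((1 - s) - 1))) \<le> \<epsilon> powr Re (1 - s) / Re (1 - s)"
      using \<epsilon> s by (intro powr_integral_near_0) (auto intro!: continuous_intros)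
    ultimately show "norm (integral {0..b} (\<lambda>u. of_real (cos (c * u)) * of_real u powr (- s))) \<le> 4 * B + 2 * \<epsilon> powr (1/2)"
      using main[of \<epsilon>] \<epsilon> s norm_triangle_ineq[of "integral {0..\<epsilon>} (\<lambda>u. of_real (cos (c * u)) * of_real u powr (- s))" "integral {\<epsilon>..b} (\<lambda>u. of_real (cos (c * u)) * of_real u powr (- s))"]
      by simp
  qed (use b in auto)
  then show ?thesis using b by (simp add: B_def t_def powr_half_sqrt)
qed

section \<open>The functional equation\<close>

text \<open>The factor of the functional equation
  \<open>\<zeta>(s) = \<chi>(s) \<zeta>(1 - s)\<close>, in the form in which the Mellin transforms
  of sine and cosine deliver it.\<close>

definition chi :: "complex \<Rightarrow> complex" where
  "chi s = 2 * of_real (2 * pi) powr (s - 1) * Gamma (1 - s) * sin (of_real pi * s / 2)"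

lemma integral_scale_powr:
  fixes h :: "real \<Rightarrow> complex"
  assumes "c > 0" "Re w > 0" "continuous_on UNIV h" "R \<ge> 0"
  shows "integral {0..R} (\<lambda>u. h (c * u) * of_real u powr (w - 1)) =
    of_real c powr (- w) * integral {0..c * R} (\<lambda>v. h v * of_real v powr (w - 1))"
proof -
  let ?f = "\<lambda>v. h v * complex_of_real v powr (w - 1)"
  have "?f integrable_on {0..c * R}"
    using assms
    by (intro set_lebesgue_integral_eq_integral(1) continuous_mult_absolutely_integrable powr_absolutely_integrable)
       (auto intro: continuous_on_subset)
  then have "((\<lambda>u. ?f (c * u)) has_integral (1 / \<bar>c\<bar>) *\<^sub>R integral {0..c * R} ?f) ((\<lambda>x. x / c) ` {0..c * R})"
    using assms by (intro has_integral_stretch_real integrable_integral) auto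
  also have "(\<lambda>x. x / c) ` {0..c * R} = {0..R}"
    using assms by (subst image_divide_atLeastAtMost) auto
  finally have "((\<lambda>u. of_real c powr (1 - w) * ?f (c * u)) has_integral of_real c powr (1 - w) * ((1 / \<bar>c\<bar>) *\<^sub>R integral {0..c * R} ?f)) {0..R}"
    by (rule has_integral_mult_right)
  moreover have "of_real c powr (1 - w) * ?f (c * u) = h (c * u) * of_real u powr (w - 1)" if "u \<in> {0..R}" for u
  proof -
    have "complex_of_real (c * u) powr (w - 1) = of_real c powr (w - 1) * of_real u powr (w - 1)"
      unfolding of_real_mult using assms that by (intro powr_times_real) auto
    moreover have "complex_of_real c powr (1 - w) * of_real c powr (w - 1) = 1"
      using assms by (simp flip: powr_add)
    ultimately show ?thesis by (simp add: mult_ac)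
  qed
  ultimately have "((\<lambda>u. h (c * u) * of_real u powr (w - 1)) has_integral of_real c powr (1 - w) * ((1 / \<bar>c\<bar>) *\<^sub>R integral {0..c * R} ?f)) {0..R}"
    using has_integral_cong by (smt (verit, ccfv_SIG))
  moreover have "of_real c powr (1 - w) * ((1 / \<bar>c\<bar>) *\<^sub>R I) = of_real c powr (- w) * I" for I :: complex
  proof -
    have "complex_of_real c powr (1 - w) = of_real c powr (- w) * of_real c"
      using assms powr_add[of "complex_of_real c" "-w" 1] by simp
    then show ?thesis using assms by (simp add: scaleR_conv_of_real)
  qed
  ultimately show ?thesis by (simp add: integral_unique)
qed

lemma filterlim_mult_at_top: "c > 0 \<Longrightarrow> filterlim (\<lambda>R::real. c * R) at_top at_top" for c :: real
  by real_asymp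

lemma mellin_trig_integrable:
  assumes "Re w > 0"
  shows "(\<lambda>u. cis (d * u) * complex_of_real u powr (w - 1)) integrable_on {0..R}"
  using assms
  by (intro set_lebesgue_integral_eq_integral(1) continuous_mult_absolutely_integrable powr_absolutely_integrable continuous_intros) auto

lemma i_powr: "\<i> powr w = exp (\<i> * (of_real pi * w / 2))"
  by (simp add: powr_def mult_ac)

lemma mellin_cos:
  assumes w: "0 < Re w" "Re w < 1" and c: "c > 0"
  shows "((\<lambda>R. integral {0..R} (\<lambda>u. of_real (cos (c * u)) * of_real u powr (w - 1))) \<longlongrightarrow>
     of_real c powr (- w) * Gamma w * cos (of_real pi * w / 2)) at_top"
proof -
  have "((\<lambda>R. (integral {0..R} (\<lambda>u. cis u * of_real u powr (w - 1)) + integral {0..R} (\<lambda>u. cis (-u) * of_real u powr (w - 1))) / 2)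
     \<longlongrightarrow> (Gamma w * \<i> powr w + Gamma w * \<i> powr (- w)) / 2) at_top"
    by (intro tendsto_divide tendsto_add mellin_cis_plus mellin_cis_minus w tendsto_const) auto
  also have "(\<lambda>R. (integral {0..R} (\<lambda>u. cis u * of_real u powr (w - 1)) + integral {0..R} (\<lambda>u. cis (-u) * of_real u powr (w - 1))) / 2)
     = (\<lambda>R. integral {0..R} (\<lambda>u. of_real (cos u) * of_real u powr (w - 1)))"
  proof
    fix R
    have "integral {0..R} (\<lambda>u. (cis (1 * u) * of_real u powr (w - 1) + cis (- 1 * u) * of_real u powr (w - 1)) / 2) =
      (integral {0..R} (\<lambda>u. cis (1 * u) * of_real u powr (w - 1)) + integral {0..R} (\<lambda>u. cis (- 1 * u) * of_real u powr (w - 1))) / 2"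
      using w by (intro integral_unique has_integral_divide has_integral_add integrable_integral mellin_trig_integrable)
    then show "(integral {0..R} (\<lambda>u. cis u * of_real u powr (w - 1)) + integral {0..R} (\<lambda>u. cis (-u) * of_real u powr (w - 1))) / 2 =
       integral {0..R} (\<lambda>u. of_real (cos u) * of_real u powr (w - 1))"
      by (simp add: cos_cis distrib_right)
  qed
  also have "(Gamma w * \<i> powr w + Gamma w * \<i> powr (- w)) / 2 = Gamma w * cos (of_real pi * w / 2)"
    by (simp add: i_powr cos_exp_eq distrib_left)
  finally have "((\<lambda>R. integral {0..c * R} (\<lambda>u. of_real (cos u) * of_real u powr (w - 1))) \<longlongrightarrow> Gamma w * cos (of_real pi * w / 2)) at_top"
    using filterlim_compose filterlim_mult_at_top[OF c] by blast
  from tendsto_mult_left[OF this, of "of_real c powr (- w)"]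
  have "((\<lambda>R. of_real c powr (- w) * integral {0..c * R} (\<lambda>u. of_real (cos u) * of_real u powr (w - 1))) \<longlongrightarrow>
      of_real c powr (- w) * Gamma w * cos (of_real pi * w / 2)) at_top" by (simp add: mult.assoc)
  then show ?thesis
  proof (rule Lim_transform_eventually)
    show "\<forall>\<^sub>F R in at_top. of_real c powr (- w) * integral {0..c * R} (\<lambda>u. of_real (cos u) * of_real u powr (w - 1)) =
       integral {0..R} (\<lambda>u. of_real (cos (c * u)) * of_real u powr (w - 1))"
      using eventually_ge_at_top[of 0]
    proof eventually_elim
      case (elim R)
      then show ?case using integral_scale_powr[OF c w(1), of "\<lambda>u. of_real (cos u)" R]
        by (simp add: continuous_intros)
    qed
  qed
qed

lemma mellin_sin:
  assumes w: "0 < Re w" "Re w < 1" and c: "c > 0"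
  shows "((\<lambda>R. integral {0..R} (\<lambda>u. of_real (sin (c * u)) * of_real u powr (w - 1))) \<longlongrightarrow>
     of_real c powr (- w) * Gamma w * sin (of_real pi * w / 2)) at_top"
proof -
  have "((\<lambda>R. (integral {0..R} (\<lambda>u. cis u * of_real u powr (w - 1)) - integral {0..R} (\<lambda>u. cis (-u) * of_real u powr (w - 1))) / (2 * \<i>))
     \<longlongrightarrow> (Gamma w * \<i> powr w - Gamma w * \<i> powr (- w)) / (2 * \<i>)) at_top"
    by (intro tendsto_divide tendsto_diff mellin_cis_plus mellin_cis_minus w tendsto_const) auto
  also have "(\<lambda>R. (integral {0..R} (\<lambda>u. cis u * of_real u powr (w - 1)) - integral {0..R} (\<lambda>u. cis (-u) * of_real u powr (w - 1))) / (2 * \<i>))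
     = (\<lambda>R. integral {0..R} (\<lambda>u. of_real (sin u) * of_real u powr (w - 1)))"
  proof
    fix R
    have *: "integral {0..R} (\<lambda>u. (cis (1 * u) * of_real u powr (w - 1) - cis (- 1 * u) * of_real u powr (w - 1)) / (2 * \<i>)) =
      (integral {0..R} (\<lambda>u. cis (1 * u) * of_real u powr (w - 1)) - integral {0..R} (\<lambda>u. cis (- 1 * u) * of_real u powr (w - 1))) / (2 * \<i>)"
      using w by (intro integral_unique has_integral_divide has_integral_diff integrable_integral mellin_trig_integrable)
    show "(integral {0..R} (\<lambda>u. cis u * of_real u powr (w - 1)) - integral {0..R} (\<lambda>u. cis (-u) * of_real u powr (w - 1))) / (2 * \<i>) =
       integral {0..R} (\<lambda>u. of_real (sin u) * of_real u powr (w - 1))"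
    proof -
      have "(\<lambda>u. (cis (1 * u) * complex_of_real u powr (w - 1) - cis (- 1 * u) * of_real u powr (w - 1)) / (2 * \<i>)) =
        (\<lambda>u. of_real (sin u) * of_real u powr (w - 1))"
        by (rule ext) (simp only: sin_cis mult_1_left times_divide_eq_left left_diff_distrib mult_minus_left)
      from *[unfolded this] show ?thesis by simp
    qed
  qed
  also have "(Gamma w * \<i> powr w - Gamma w * \<i> powr (- w)) / (2 * \<i>) = Gamma w * sin (of_real pi * w / 2)"
    by (simp add: i_powr sin_exp_eq' right_diff_distrib diff_divide_distrib) (simp add: field_simps)
  finally have "((\<lambda>R. integral {0..c * R} (\<lambda>u. of_real (sin u) * of_real u powr (w - 1))) \<longlongrightarrow> Gamma w * sin (of_real pi * w / 2)) at_top"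
    using filterlim_compose filterlim_mult_at_top[OF c] by blast
  from tendsto_mult_left[OF this, of "of_real c powr (- w)"]
  have "((\<lambda>R. of_real c powr (- w) * integral {0..c * R} (\<lambda>u. of_real (sin u) * of_real u powr (w - 1))) \<longlongrightarrow>
      of_real c powr (- w) * Gamma w * sin (of_real pi * w / 2)) at_top" by (simp add: mult.assoc)
  then show ?thesis
  proof (rule Lim_transform_eventually)
    show "\<forall>\<^sub>F R in at_top. of_real c powr (- w) * integral {0..c * R} (\<lambda>u. of_real (sin u) * of_real u powr (w - 1)) =
       integral {0..R} (\<lambda>u. of_real (sin (c * u)) * of_real u powr (w - 1))"
      using eventually_ge_at_top[of 0]
    proof eventually_elim
      case (elim R)
      then show ?case using integral_scale_powr[OF c w(1), of "\<lambda>u. of_real (sin u)" R]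
        by (simp add: continuous_intros)
    qed
  qed
qed

lemma two_pi_k_powr: "complex_of_real (2 * pi * real k) powr a = of_real (2 * pi) powr a * of_nat k powr a"
  unfolding of_real_mult[of "2 * pi"] by (subst powr_times_real) auto

text \<open>The cosine transform at \<open>1 - s\<close>. In the critical strip every frequency
  completed to the half-line yields one term of the dual sum.\<close>

lemma chi_cos_integral:
  assumes s: "0 < Re s" "Re s < 1" and k: "k \<ge> 1"
  shows "((\<lambda>R. 2 * integral {0..R} (\<lambda>u. of_real (cos (2 * pi * real k * u)) * of_real u powr (- s))) \<longlongrightarrow>
     chi s * of_nat k powr (s - 1)) at_top"
proof -
  have "cos (of_real pi * (1 - s) / 2) = sin (of_real pi * s / 2)"
    by (simp add: right_diff_distrib diff_divide_distrib cos_diff)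
  moreover have "((\<lambda>R. 2 * integral {0..R} (\<lambda>u. of_real (cos (2 * pi * real k * u)) * of_real u powr ((1 - s) - 1))) \<longlongrightarrow>
     2 * (of_real (2 * pi * real k) powr (- (1 - s)) * Gamma (1 - s) * cos (of_real pi * (1 - s) / 2))) at_top"
    using s k by (intro tendsto_mult tendsto_const mellin_cos) auto
  moreover have "2 * (of_real (2 * pi * real k) powr (- (1 - s)) * Gamma (1 - s) * sin (of_real pi * s / 2)) = chi s * of_nat k powr (s - 1)"
    unfolding chi_def minus_diff_eq two_pi_k_powr by (simp only: mult_ac)
  moreover have "(1 - s) - 1 = - s" by simp
  ultimately show ?thesis by (simp only:)
qed

text \<open>The same value in the strip to the left, from the sine transform at \<open>- s\<close>.
  There the series over \<open>k\<close> converges absolutely, so these are the terms of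
  \<open>chi s\<close> times \<open>zeta (1 - s)\<close>. The recurrence
  \<open>Gamma (1 - s) = - s * Gamma (- s)\<close> absorbs the factor \<open>s\<close>.\<close>

lemma chi_sin_integral:
  assumes s: "- 1 < Re s" "Re s < 0" and k: "k \<ge> 1"
  shows "((\<lambda>R. s / of_real (pi * real k) * integral {0..R} (\<lambda>u. of_real (sin (2 * pi * real k * u)) * of_real u powr (- s - 1))) \<longlongrightarrow>
     chi s * of_nat k powr (s - 1)) at_top"
proof -
  have "((\<lambda>R. s / of_real (pi * real k) * integral {0..R} (\<lambda>u. of_real (sin (2 * pi * real k * u)) * of_real u powr (- s - 1))) \<longlongrightarrow>
     s / of_real (pi * real k) * (of_real (2 * pi * real k) powr (- (- s)) * Gamma (- s) * sin (of_real pi * (- s) / 2))) at_top"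
    using s k by (intro tendsto_mult tendsto_const mellin_sin) auto
  moreover have "s / of_real (pi * real k) * (of_real (2 * pi * real k) powr (- (- s)) * Gamma (- s) * sin (of_real pi * (- s) / 2)) = chi s * of_nat k powr (s - 1)"
  proof -
    have "s \<noteq> 0" using s by auto
    then have "Gamma (1 - s) = - s * Gamma (- s)"
    proof -
      have "- s \<notin> \<int>\<^sub>\<le>\<^sub>0"
      proof
        assume "- s \<in> \<int>\<^sub>\<le>\<^sub>0"
        then obtain n where "- s = of_int n" "n \<le> 0" by (elim nonpos_Ints_cases) auto
        then have "Re (- s) \<le> 0" by simp
        then show False using s by simp
      qed
      then show ?thesis using Gamma_plus1[of "-s"] by simp
    qed
    moreover have "complex_of_real (2 * pi * real k) powr s = of_real (2 * pi * real k) powr (s - 1) * of_real (2 * pi * real k)"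
      using powr_add[of "complex_of_real (2 * pi * real k)" "s - 1" 1] k by simp
    moreover have "sin (of_real pi * (- s) / 2) = - sin (of_real pi * s / 2)" by simp
    moreover have "s / of_real (pi * real k) * (P * of_real (2 * pi * real k) * G * (- S)) = 2 * P * (- s * G) * S" for P G S
      using k by (simp add: field_simps)
    moreover have "2 * of_real (2 * pi * real k) powr (s - 1) * Gamma (1 - s) * sin (of_real pi * s / 2) = chi s * of_nat k powr (s - 1)"
      unfolding chi_def two_pi_k_powr by (simp only: mult_ac)
    ultimately show ?thesis by (simp only: minus_minus)
  qed
  ultimately show ?thesis by simp
qed

text \<open>On this segment the Fourier expansion is valid from 0 on, and the tail estimate applies
  because \<open>Im s = 0\<close>. The tails beyond \<open>R\<close> are
  \<open>O(R powr (- x - 1) / k^2)\<close>, so they can be summed over \<open>k\<close>, and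
  \<open>x > -1\<close> makes the total vanish as \<open>R\<close> grows.\<close>

lemma zeta0_functional_real:
  assumes x: "-1 < x" "x < - 1/2"
  defines "s \<equiv> complex_of_real x"
  shows "zeta0 s = chi s * zeta0 (1 - s)"
proof -
  define a where "a = (\<lambda>k R. s / of_real (pi * real k) * integral {0..R} (\<lambda>u. of_real (sin (2 * pi * real k * u)) * of_real u powr (- s - 1)))"
  define A where "A = (\<lambda>k::nat. chi s * of_nat k powr (s - 1))"
  define C where "C = norm s / pi * (2 / pi)"
  have s: "Re s = x" "Im s = 0" "s \<noteq> 1" using x by (auto simp: s_def complex_eq_iff)
  have aA: "(a k \<longlongrightarrow> A k) at_top" if "k \<ge> 1" for k
    unfolding a_def A_def using s x that by (intro chi_sin_integral) auto
  have diff: "norm (a k R - A k) \<le> C * R powr (- x - 1) * (1 / (real k)\<^sup>2)" if k: "k \<ge> 1" and R: "R > 0" for k R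
  proof (rule tendsto_upperbound)
    show "((\<lambda>R'. norm (a k R - a k R')) \<longlongrightarrow> norm (a k R - A k)) at_top"
      by (intro tendsto_intros aA k)
    show "\<forall>\<^sub>F R' in at_top. norm (a k R - a k R') \<le> C * R powr (- x - 1) * (1 / (real k)\<^sup>2)"
      using eventually_ge_at_top[of R]
    proof eventually_elim
      case (elim R')
      let ?f = "\<lambda>u. of_real (sin (2 * pi * real k * u)) * complex_of_real u powr (- s - 1)"
      have "integral {0..R'} ?f = integral {0..R} ?f + integral {R..R'} ?f"
        using s x elim R by (intro integral_combine_powr) (auto intro!: continuous_intros)
      then have "a k R - a k R' = - (s / of_real (pi * real k) * integral {R..R'} ?f)"
        unfolding a_def by (simp add: algebra_simps)
      then have "norm (a k R - a k R') = norm s / (pi * real k) * norm (integral {R..R'} ?f)"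
        by (simp add: norm_mult norm_divide)
      also have "\<dots> \<le> norm s / (pi * real k) * (4 * R powr (- Re s) / (2 * pi * real k * R - Im s))"
        using elim R s x k by (intro mult_left_mono sin_integral_tail) auto
      also have "\<dots> = C * R powr (- x - 1) * (1 / (real k)\<^sup>2)"
        using s R k by (simp add: C_def powr_diff field_simps power2_eq_square)
      finally show ?case .
    qed
  qed auto
  have sumA: "(\<lambda>K. \<Sum>k=1..K. A k) \<longlonglongrightarrow> chi s * zeta0 (1 - s)"
  proof -
    have "(\<lambda>n. 1 / of_nat (Suc n) powr (1 - s)) sums zeta0 (1 - s)"
      using s x by (intro zeta0_sums) auto
    then have "(\<lambda>K. chi s * (\<Sum>n<K. 1 / of_nat (Suc n) powr (1 - s))) \<longlonglongrightarrow> chi s * zeta0 (1 - s)"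
      unfolding sums_def by (intro tendsto_intros)
    moreover have "chi s * (\<Sum>n<K. 1 / of_nat (Suc n) powr (1 - s)) = (\<Sum>k=1..K. A k)" for K
    proof -
      have e: "1 / of_nat (Suc n) powr (1 - s) = (of_nat (Suc n) :: complex) powr (s - 1)" for n
        using powr_minus[of "of_nat (Suc n) :: complex" "1 - s"] by (simp add: field_simps)
      show ?thesis unfolding A_def e sum_distrib_left
        by (rule sum.reindex_bij_witness[of _ "\<lambda>n. n - 1" Suc]) auto
    qed
    ultimately show ?thesis by simp
  qed
  \<comment> \<open>By the convention \<open>0 powr a = 0\<close> the lower endpoint contributes
    nothing, so \<open>em R s\<close> itself is the expansion over the interval from 0 to
    \<open>R\<close>.\<close>
  have em0: "em 0 s = 0" by (simp add: em_def)
  have bd: "norm (em R s - chi s * zeta0 (1 - s)) \<le> C * R powr (- x - 1) * (pi\<^sup>2 / 6)" if R: "R \<ge> 1" for R :: nat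
  proof (rule tendsto_upperbound)
    have "(\<lambda>K. \<Sum>k=1..K. a k R) \<longlonglongrightarrow> em R s"
      using em_fourier[of s 0 R] s x em0 unfolding a_def by simp
    then show "(\<lambda>K. norm ((\<Sum>k=1..K. a k R) - (\<Sum>k=1..K. A k))) \<longlonglongrightarrow> norm (em R s - chi s * zeta0 (1 - s))"
      by (intro tendsto_norm tendsto_diff sumA)
    have "norm ((\<Sum>k=1..K. a k R) - (\<Sum>k=1..K. A k)) \<le> C * R powr (- x - 1) * (pi\<^sup>2 / 6)" for K
    proof -
      have "norm ((\<Sum>k=1..K. a k R) - (\<Sum>k=1..K. A k)) \<le> (\<Sum>k=1..K. norm (a k R - A k))"
        unfolding sum_subtractf[symmetric] by (rule norm_sum)
      also have "\<dots> \<le> (\<Sum>k=1..K. C * R powr (- x - 1) * (1 / (real k)\<^sup>2))"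
        using R by (intro sum_mono diff) auto
      also have "\<dots> = C * R powr (- x - 1) * (\<Sum>k=1..K. 1 / (real k)\<^sup>2)"
        by (simp add: sum_distrib_left)
      also have "\<dots> \<le> C * R powr (- x - 1) * (pi\<^sup>2 / 6)"
      proof (rule mult_left_mono)
        have "(\<Sum>k=1..K. 1 / (real k)\<^sup>2) = (\<Sum>k<K. 1 / (real k + 1)\<^sup>2)"
          by (rule sum.reindex_bij_witness[of _ Suc "\<lambda>n. n - 1"]) (auto simp: add.commute)
        also have "\<dots> \<le> pi\<^sup>2 / 6"
          using sum_le_suminf[of "\<lambda>k. 1 / (real k + 1)\<^sup>2" "{..<K}"] inverse_squares_sums
          by (auto simp: sums_iff add.commute)
        finally show "(\<Sum>k=1..K. 1 / (real k)\<^sup>2) \<le> pi\<^sup>2 / 6" .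
      qed (simp add: C_def)
      finally show ?thesis .
    qed
    then show "\<forall>\<^sub>F K in sequentially. norm ((\<Sum>k=1..K. a k R) - (\<Sum>k=1..K. A k)) \<le> C * R powr (- x - 1) * (pi\<^sup>2 / 6)"
      by simp
  qed auto
  have "(\<lambda>R. C * real R powr (- x - 1) * (pi\<^sup>2 / 6)) \<longlonglongrightarrow> 0"
    using x by real_asymp
  then have "(\<lambda>R. em R s - chi s * zeta0 (1 - s)) \<longlonglongrightarrow> 0"
    by (rule Lim_null_comparison[rotated]) (use bd in \<open>auto intro!: eventually_sequentiallyI[of 1]\<close>)
  moreover have "(\<lambda>R. em R s - chi s * zeta0 (1 - s)) \<longlonglongrightarrow> zeta0 s - chi s * zeta0 (1 - s)"
    using s x by (intro tendsto_diff em_LIMSEQ tendsto_const) auto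
  ultimately show ?thesis using LIMSEQ_unique by fastforce
qed

lemma chi_holomorphic: "chi holomorphic_on {s. Re s < 1}"
  unfolding chi_def
  by (intro holomorphic_intros) (auto elim!: nonpos_Ints_cases simp: complex_eq_iff)

text \<open>The identity theorem, starting from the real segment. The point 0 is removed because
  \<open>1 - s\<close> meets the pole there.\<close>

lemma zeta0_functional:
  assumes "- 1 < Re s" "Re s < 1" "s \<noteq> 0"
  shows "zeta0 s = chi s * zeta0 (1 - s)"
proof -
  define S where "S = {s. - 1 < Re s} \<inter> {s. Re s < 1} - {0::complex}"
  have o: "open ({s. - 1 < Re s} \<inter> {s. Re s < 1})"
    by (intro open_Int open_halfspace_Re_gt open_halfspace_Re_lt)
  have "zeta0 s - chi s * zeta0 (1 - s) = 0"
  proof (rule analytic_continuation[where f = "\<lambda>s. zeta0 s - chi s * zeta0 (1 - s)" and w = s and S = S and U = "complex_of_real ` {-1<..<-1/2}" and \<xi> = "of_real (-3/4)"])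
    have "(\<lambda>s. zeta0 (1 - s)) holomorphic_on S"
      by (intro holomorphic_on_compose[of "\<lambda>s. 1 - s" S zeta0, unfolded o_def] holomorphic_intros 
            holomorphic_on_subset[OF zeta0_holomorphic]) (auto simp: S_def)
    then show "(\<lambda>s. zeta0 s - chi s * zeta0 (1 - s)) holomorphic_on S"
      by (intro holomorphic_on_diff holomorphic_on_mult holomorphic_on_subset[OF zeta0_holomorphic]
            holomorphic_on_subset[OF chi_holomorphic]) (auto simp: S_def)
    show "open S" unfolding S_def using o by (rule open_delete)
    have "connected ({s. - 1 < Re s} \<inter> {s::complex. Re s < 1})"
      by (intro convex_connected convex_Int convex_halfspace_Re_gt convex_halfspace_Re_lt)
    then show "connected S" unfolding S_def by (intro connected_open_delete o) auto
    show "complex_of_real (-3/4) islimpt complex_of_real ` {-1<..<-1/2}"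
    proof -
      have "(-3/4::real) islimpt {-1<..<-1/2}"
        by (intro interior_limit_point) auto
      then show ?thesis
        unfolding islimpt_approachable by (metis (no_types, lifting) dist_of_real image_eqI of_real_eq_iff bex_imageD)
    qed
    show "zeta0 z - chi z * zeta0 (1 - z) = 0" if "z \<in> complex_of_real ` {-1<..<-1/2}" for z
      using that zeta0_functional_real by auto
  qed (use assms in \<open>auto simp: S_def\<close>)
  then show ?thesis by simp
qed

section \<open>Identification of \<open>zeta\<close> and the phase of \<open>chi\<close> on the
  critical line\<close>

lemma zeta_unique:
  assumes f: "f holomorphic_on (- {1})" "\<And>s. Re s > 1 \<Longrightarrow> (\<lambda>n. 1 / of_nat (Suc n) powr s) sums f s" "f 1 = 0"
    and g: "g holomorphic_on (- {1})" "\<And>s. Re s > 1 \<Longrightarrow> (\<lambda>n. 1 / of_nat (Suc n) powr s) sums g s" "g 1 = 0"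
  shows "f = (g :: complex \<Rightarrow> complex)"
proof
  fix z
  show "f z = g z"
  proof (cases "z = 1")
    case False
    show ?thesis
    proof (rule analytic_continuation_open[of "{s. Re s > 1}" "- {1}" f g z])
      show "open {s. Re s > 1}" by (rule open_halfspace_Re_gt)
      show "{s. Re s > 1} \<noteq> {}" using complex_Re_numeral[of "Num.Bit0 Num.One"] by (metis empty_iff mem_Collect_eq one_less_numeral_iff semiring_norm(76))
      show "connected (- {1::complex})" by (intro connected_punctured_universe) simp
      show "f w = g w" if "w \<in> {s. Re s > 1}" for w
        using f(2)[of w] g(2)[of w] that sums_unique2 by blast
    qed (use f g False in auto)
  qed (use f g in simp)
qed

text \<open>The Euler-Maclaurin limit stops at \<open>Re s = -1\<close>, while \<open>zeta\<close>
  is characterised on the whole punctured plane; the functional equation supplies the remaining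
  values. At the pole the value 0 is that of \<open>zeta\<close>.\<close>

definition zeta_ext :: "complex \<Rightarrow> complex" where
  "zeta_ext s = (if s = 1 then 0 else if Re s > - 1 then zeta0 s else chi s * zeta0 (1 - s))"

lemma zeta_ext_holomorphic: "zeta_ext holomorphic_on (- {1})"
proof -
  have 1: "zeta_ext holomorphic_on ({s. Re s > -1} - {1})"
    using zeta0_holomorphic by (rule holomorphic_transform) (auto simp: zeta_ext_def)
  have "(\<lambda>s. zeta0 (1 - s)) holomorphic_on {s. Re s < 0}"
    by (intro holomorphic_on_compose[of "\<lambda>s. 1 - s" "{s. Re s < 0}" zeta0, unfolded o_def] holomorphic_intros 
            holomorphic_on_subset[OF zeta0_holomorphic]) auto
  then have "(\<lambda>s. chi s * zeta0 (1 - s)) holomorphic_on {s. Re s < 0}"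
    by (intro holomorphic_on_mult holomorphic_on_subset[OF chi_holomorphic]) auto
  then have 2: "zeta_ext holomorphic_on {s. Re s < 0}"
  proof (rule holomorphic_transform)
    fix s :: complex assume "s \<in> {s. Re s < 0}"
    then have "Re s < 0" "s \<noteq> 1" "s \<noteq> 0" by auto
    then show "chi s * zeta0 (1 - s) = zeta_ext s"
      using zeta0_functional[of s] by (simp add: zeta_ext_def)
  qed
  have "zeta_ext holomorphic_on (({s. Re s > -1} - {1}) \<union> {s. Re s < 0})"
    by (intro holomorphic_on_Un 1 2 open_delete open_halfspace_Re_gt open_halfspace_Re_lt)
  also have "({s. Re s > -1} - {1}) \<union> {s. Re s < 0} = - {1::complex}" by force
  finally show ?thesis .
qed

lemma zeta_eq_zeta_ext: "zeta = zeta_ext"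
  unfolding zeta_def
proof (rule the_equality)
  show *: "zeta_ext holomorphic_on - {1} \<and> (\<forall>s. 1 < Re s \<longrightarrow> (\<lambda>n. 1 / of_nat (Suc n) powr s) sums zeta_ext s) \<and> zeta_ext 1 = 0"
    using zeta_ext_holomorphic zeta0_sums by (auto simp: zeta_ext_def)
  show "f = zeta_ext" if "f holomorphic_on - {1} \<and> (\<forall>s. 1 < Re s \<longrightarrow> (\<lambda>n. 1 / of_nat (Suc n) powr s) sums f s) \<and> f 1 = 0" for f
    using zeta_unique[of f zeta_ext] that * by blast
qed

lemma zeta_holomorphic: "zeta holomorphic_on (- {1})"
  unfolding zeta_eq_zeta_ext by (rule zeta_ext_holomorphic)

lemma zeta_eq_zeta0: "s \<noteq> 1 \<Longrightarrow> Re s > -1 \<Longrightarrow> zeta s = zeta0 s"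
  by (simp add: zeta_eq_zeta_ext zeta_ext_def)

lemma em_tendsto_zeta: "s \<noteq> 1 \<Longrightarrow> Re s > -1 \<Longrightarrow> (\<lambda>n. em n s) \<longlonglongrightarrow> zeta s"
  using em_LIMSEQ zeta_eq_zeta0 by metis

lemma zeta_functional: 
  assumes "0 < Re s" "Re s < 1" shows "zeta s = chi s * zeta (1 - s)"
proof -
  have "s \<noteq> 0" "s \<noteq> 1" "1 - s \<noteq> 1" using assms by auto
  then show ?thesis using zeta0_functional[of s] assms by (simp add: zeta_eq_zeta0)
qed

lemma zeta_cnj:
  assumes "s \<noteq> 1" "Re s > -1"
  shows "zeta (cnj s) = cnj (zeta s)"
proof -
  have "cnj s \<noteq> 1" using assms by (metis complex_cnj_cnj complex_cnj_one)
  have "em n (cnj s) = cnj (em n s)" for n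
  proof -
    have "cnj (of_nat m powr a) = of_nat m powr cnj a" for m a by (subst cnj_powr) auto
    then show ?thesis by (simp add: em_def)
  qed
  moreover have "(\<lambda>n. cnj (em n s)) \<longlonglongrightarrow> cnj (zeta s)"
    using assms by (intro tendsto_cnj em_tendsto_zeta)
  moreover have "(\<lambda>n. em n (cnj s)) \<longlonglongrightarrow> zeta (cnj s)"
    using assms \<open>cnj s \<noteq> 1\<close> by (intro em_tendsto_zeta) auto
  ultimately show ?thesis using LIMSEQ_unique by force
qed

text \<open>The symmetric form of \<open>chi\<close>, from Legendre duplication at
  \<open>(1 - s) / 2\<close> and reflection at \<open>s / 2\<close>. On the critical line its two
  Gamma values are conjugate, which exposes the phase.\<close>

lemma chi_Gamma_quotient:
  assumes "0 < Re s" "Re s < 1"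
  shows "chi s = of_real pi powr (s - 1/2) * Gamma ((1 - s) / 2) / Gamma (s / 2)"
proof -
  have ni: "z \<notin> \<int>\<^sub>\<le>\<^sub>0" if "Re z > 0" for z :: complex
    using that by (auto elim!: nonpos_Ints_cases)
  have G: "Gamma z \<noteq> 0" if "Re z > 0" for z :: complex
    using ni[OF that] by (simp add: Gamma_eq_zero_iff)
  have dup: "Gamma ((1 - s) / 2) * Gamma (1 - s / 2) = exp (s * of_real (ln 2)) * of_real (sqrt pi) * Gamma (1 - s)"
    using Gamma_legendre_duplication[of "(1 - s) / 2"] ni[of "(1 - s) / 2"] ni[of "(1 - s) / 2 + 1/2"] assms
    by (simp add: diff_divide_distrib add_divide_distrib algebra_simps)
  have refl: "Gamma (s / 2) * Gamma (1 - s / 2) * sin (of_real pi * s / 2) = of_real pi"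
  proof -
    have eq: "Gamma (s / 2) * Gamma (1 - s / 2) = of_real pi / sin (of_real pi * s / 2)"
      using Gamma_reflection_complex[of "s / 2"] by simp
    have "Gamma (s / 2) * Gamma (1 - s / 2) \<noteq> 0" using assms by (auto simp: G)
    then have "sin (of_real pi * s / 2) \<noteq> 0" using eq by auto
    then show ?thesis using eq by simp
  qed
  have p2: "complex_of_real (2 * pi) powr (s - 1) = exp (s * of_real (ln 2)) / 2 * (of_real pi powr (s - 1))"
  proof -
    have "complex_of_real (2 * pi) powr (s - 1) = of_real 2 powr (s - 1) * of_real pi powr (s - 1)"
      unfolding of_real_mult by (subst powr_times_real) auto
    moreover have "complex_of_real 2 powr (s - 1) = exp (s * of_real (ln 2)) / 2"
      using Ln_of_real[of 2] exp_of_real[of "ln 2", where 'a = complex] by (simp add: powr_def left_diff_distrib exp_diff)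
    ultimately show ?thesis by simp
  qed
  have pp: "complex_of_real pi powr (s - 1/2) * of_real (sqrt pi) = of_real pi powr (s - 1) * of_real pi"
  proof -
    have "complex_of_real pi powr (s - 1/2) = of_real pi powr (s - 1) * of_real pi powr (1/2)"
      by (simp flip: powr_add)
    moreover have "complex_of_real pi powr (1/2) = of_real (sqrt pi)"
      using powr_of_real[of pi "1/2"] by (simp add: powr_half_sqrt)
    moreover have "complex_of_real (sqrt pi) * of_real (sqrt pi) = of_real pi"
      by (simp flip: of_real_mult)
    ultimately show ?thesis by (simp add: mult.assoc)
  qed
  have nz: "Gamma (s / 2) \<noteq> 0" "Gamma (1 - s / 2) \<noteq> 0" using assms by (auto intro!: G)
  have "chi s * (Gamma (s / 2) * Gamma (1 - s / 2)) * of_real (sqrt pi) =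
      of_real pi powr (s - 1) * (exp (s * of_real (ln 2)) * of_real (sqrt pi) * Gamma (1 - s)) * (Gamma (s / 2) * Gamma (1 - s / 2) * sin (of_real pi * s / 2))"
    unfolding chi_def p2 by (simp add: mult_ac)
  also have "\<dots> = (of_real pi powr (s - 1) * of_real pi) * Gamma ((1 - s) / 2) * Gamma (1 - s / 2)"
    unfolding refl dup[symmetric] by (simp add: mult_ac)
  also have "\<dots> = of_real pi powr (s - 1/2) * of_real (sqrt pi) * Gamma ((1 - s) / 2) * Gamma (1 - s / 2)"
    by (simp add: pp)
  finally have "chi s * Gamma (s / 2) * (Gamma (1 - s / 2) * of_real (sqrt pi)) = 
      of_real pi powr (s - 1/2) * Gamma ((1 - s) / 2) * (Gamma (1 - s / 2) * of_real (sqrt pi))"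
    by (simp only: mult_ac)
  then have "chi s * Gamma (s / 2) = of_real pi powr (s - 1/2) * Gamma ((1 - s) / 2)"
    using nz by simp
  then show ?thesis using nz by (simp add: field_simps)
qed

text \<open>The quotient has Gamma at \<open>1/4 - \<i> t/2\<close> over Gamma at
  \<open>1/4 + \<i> t/2\<close>, so \<open>chi\<close> is a pure phase. Writing both through
  \<open>ln_Gamma\<close> makes the phase minus twice \<open>rs_theta\<close>, with no ambiguity of
  branch.\<close>

lemma chi_critical: "chi (Complex (1/2) t) = exp (- 2 * \<i> * of_real (rs_theta t))"
proof -
  define g where "g = ln_Gamma (Complex (1/4) (t/2))"
  have ni: "z \<notin> \<int>\<^sub>\<le>\<^sub>0" if "Re z > 0" for z :: complex
    using that by (auto elim!: nonpos_Ints_cases)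
  have h: "Complex (1/2) t / 2 = Complex (1/4) (t/2)" "(1 - Complex (1/2) t) / 2 = cnj (Complex (1/4) (t/2))"
    by (simp_all add: complex_eq_iff)
  have G: "Gamma (Complex (1/4) (t/2)) = exp g"
    using ni[of "Complex (1/4) (t/2)"] by (simp add: Gamma_complex_altdef g_def)
  have "chi (Complex (1/2) t) = of_real pi powr (Complex (1/2) t - 1/2) * cnj (exp g) / exp g"
    by (subst chi_Gamma_quotient) (simp_all add: h cnj_Gamma[symmetric] G)
  also have "Complex (1/2) t - 1/2 = \<i> * t" by (simp add: complex_eq_iff)
  also have "of_real pi powr (\<i> * t) = exp (\<i> * of_real (t * ln pi))"
    by (simp add: powr_def Ln_of_real mult_ac)
  also have "exp (\<i> * of_real (t * ln pi)) * cnj (exp g) / exp g = exp (\<i> * of_real (t * ln pi) + cnj g - g)"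
    by (simp add: exp_add exp_diff exp_cnj)
  also have "\<i> * of_real (t * ln pi) + cnj g - g = - 2 * \<i> * of_real (rs_theta t)"
    by (simp add: rs_theta_def g_def complex_eq_iff algebra_simps)
  finally show ?thesis .
qed

lemma norm_chi_critical:
  assumes "Re s = 1/2" shows "norm (chi s) = 1"
proof -
  have "s = Complex (1/2) (Im s)" using assms by (simp add: complex_eq_iff)
  then have "chi s = exp (- 2 * \<i> * of_real (rs_theta (Im s)))" using chi_critical by metis
  then show ?thesis by simp
qed

text \<open>By the functional equation the rotated value of zeta equals its own conjugate, so
  \<open>Re\<close> in \<open>hardy_Z\<close> loses nothing. From here on the ladder equation can be
  read in terms of the modulus of zeta.\<close>

lemma hardy_Z_squared: "(hardy_Z t)\<^sup>2 = (norm (zeta (Complex (1/2) t)))\<^sup>2"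
proof -
  let ?s = "Complex (1/2) t" and ?e = "exp (\<i> * of_real (rs_theta t))"
  have "1 - ?s = cnj ?s" by (simp add: complex_eq_iff)
  moreover have "?s \<noteq> 1" by (simp add: complex_eq_iff)
  ultimately have "zeta ?s = chi ?s * cnj (zeta ?s)"
    using zeta_functional[of ?s] zeta_cnj[of ?s] by simp
  then have "?e * zeta ?s = ?e * exp (- 2 * \<i> * of_real (rs_theta t)) * cnj (zeta ?s)"
    by (metis chi_critical mult.assoc)
  also have "?e * exp (- 2 * \<i> * of_real (rs_theta t)) = cnj ?e"
    by (simp add: exp_cnj flip: exp_add)
  finally have "?e * zeta ?s = cnj (?e * zeta ?s)" by simp
  then have "Im (?e * zeta ?s) = 0" by (simp add: complex_eq_iff)
  then have "(hardy_Z t)\<^sup>2 = (norm (?e * zeta ?s))\<^sup>2"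
    unfolding cmod_power2 hardy_Z_def by simp
  also have "norm (?e * zeta ?s) = norm (zeta ?s)" by (simp add: norm_mult)
  finally show ?thesis .
qed

section \<open>Approximate functional equations\<close>

lemma sum_inverse_squares_le:
  assumes "finite S" "0 \<notin> S"
  shows "(\<Sum>k\<in>S. 1 / (real k)\<^sup>2) \<le> pi\<^sup>2 / 6"
proof -
  have "(\<Sum>k\<in>S. 1 / (real k)\<^sup>2) = (\<Sum>k\<in>(\<lambda>k. k - 1) ` S. 1 / (real k + 1)\<^sup>2)"
  proof (subst sum.reindex)
    show "inj_on (\<lambda>k. k - 1) S"
      using assms by (intro inj_onI) (metis Suc_pred' neq0_conv)
    have "1 / (real k)\<^sup>2 = 1 / (real (k - 1) + 1)\<^sup>2" if "k \<in> S" for k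
      using assms that by (cases k) auto
    then show "(\<Sum>k\<in>S. 1 / (real k)\<^sup>2) = sum ((\<lambda>k. 1 / (real k + 1)\<^sup>2) \<circ> (\<lambda>k. k - 1)) S"
      by (intro sum.cong) auto
  qed
  also have "\<dots> \<le> pi\<^sup>2 / 6"
    using sum_le_suminf[of "\<lambda>k. 1 / (real k + 1)\<^sup>2" "(\<lambda>k. k - 1) ` S"] inverse_squares_sums assms
    by (auto simp: sums_iff add.commute)
  finally show ?thesis .
qed

text \<open>The common frame of both approximations. \<open>J\<close> holds the frequencies that
  need individual treatment, \<open>b R\<close> is a substitute for their total and \<open>L\<close>
  its limit; every other frequency costs at most \<open>B / k^2\<close>. The number of frequencies
  tends to infinity for fixed \<open>R\<close>, and only then does \<open>R\<close>.\<close>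

lemma norm_em_fourier_le:
  assumes "s \<noteq> 1" "Re s > - 1" "N \<ge> 1" and fin: "finite J"
    and bd: "\<And>R k. R \<ge> N \<Longrightarrow> k \<ge> 1 \<Longrightarrow> k \<notin> J \<Longrightarrow>
      norm (s / of_real (pi * real k) * integral {real N..real R} (\<lambda>u. of_real (sin (2 * pi * real k * u)) * of_real u powr (- s - 1))) \<le> B / (real k)\<^sup>2"
    and lim: "\<And>k. k \<in> J \<Longrightarrow> k \<ge> 1"
    and b: "\<And>R. R \<ge> N \<Longrightarrow> norm ((\<Sum>k\<in>J. s / of_real (pi * real k) * integral {real N..real R} (\<lambda>u. of_real (sin (2 * pi * real k * u)) * of_real u powr (- s - 1))) - b R) \<le> D"
    and bl: "b \<longlonglongrightarrow> L"
    and "B \<ge> 0"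
  shows "norm (zeta s - em N s - L) \<le> D + B * (pi\<^sup>2 / 6)"
proof -
  define a where "a = (\<lambda>k R. s / of_real (pi * real k) * integral {real N..real R} (\<lambda>u. of_real (sin (2 * pi * real k * u)) * of_real u powr (- s - 1)))"
  have main: "norm (em R s - em N s - b R) \<le> D + B * (pi\<^sup>2 / 6)" if R: "R \<ge> N" for R
  proof (rule tendsto_upperbound)
    have "(\<lambda>K. \<Sum>k=1..K. a k R) \<longlonglongrightarrow> em R s - em N s"
      unfolding a_def using assms R by (intro em_fourier) auto
    then show "(\<lambda>K. norm ((\<Sum>k=1..K. a k R) - b R)) \<longlonglongrightarrow> norm (em R s - em N s - b R)"
      by (intro tendsto_intros)
    have "norm ((\<Sum>k=1..K. a k R) - b R) \<le> D + B * (pi\<^sup>2 / 6)" if K: "K \<ge> Max (insert 0 J)" for K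
    proof -
      have sub: "J \<subseteq> {1..K}" using lim K fin Max_ge[of "insert 0 J"] by fastforce
      have "(\<Sum>k=1..K. a k R) - b R = (\<Sum>k\<in>{1..K} - J. a k R) + ((\<Sum>k\<in>J. a k R) - b R)"
        using sub by (subst sum.subset_diff[OF sub]) auto
      then have "norm ((\<Sum>k=1..K. a k R) - b R) \<le> norm (\<Sum>k\<in>{1..K} - J. a k R) + norm ((\<Sum>k\<in>J. a k R) - b R)"
        by (simp only:) (rule norm_triangle_ineq)
      also have "norm (\<Sum>k\<in>{1..K} - J. a k R) \<le> (\<Sum>k\<in>{1..K} - J. B / (real k)\<^sup>2)"
        unfolding a_def using R by (intro sum_norm_le bd) auto
      also have "\<dots> = B * (\<Sum>k\<in>{1..K} - J. 1 / (real k)\<^sup>2)" by (simp add: sum_distrib_left)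
      also have "\<dots> \<le> B * (pi\<^sup>2 / 6)"
        using \<open>B \<ge> 0\<close> by (intro mult_left_mono sum_inverse_squares_le) auto
      also have "norm ((\<Sum>k\<in>J. a k R) - b R) \<le> D" unfolding a_def using b[OF R] .
      finally show ?thesis by simp
    qed
    then show "\<forall>\<^sub>F K in sequentially. norm ((\<Sum>k=1..K. a k R) - b R) \<le> D + B * (pi\<^sup>2 / 6)"
      by (rule eventually_sequentiallyI)
  qed auto
  show ?thesis
  proof (rule tendsto_upperbound)
    show "(\<lambda>R. norm (em R s - em N s - b R)) \<longlonglongrightarrow> norm (zeta s - em N s - L)"
      using assms by (intro tendsto_intros em_tendsto_zeta) auto
    show "\<forall>\<^sub>F R in sequentially. norm (em R s - em N s - b R) \<le> D + B * (pi\<^sup>2 / 6)"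
      using main by (rule eventually_sequentiallyI)
  qed auto
qed

text \<open>The Hardy-Littlewood approximation: for \<open>N \<ge> t / \<pi>\<close> no frequency is stationary on \<open>[N, \<infinity>)\<close>.\<close>

lemma zeta_minus_em_le:
  assumes s: "s \<noteq> 1" "Re s \<ge> 0" "Im s \<ge> 0" and N: "N \<ge> 1" "Im s \<le> pi * real N"
  shows "norm (zeta s - em N s) \<le> norm s * real N powr (- Re s - 1)"
proof -
  \<comment> \<open>The tail estimate with a denominator of at least \<open>pi * k * N\<close>. The
    factor \<open>pi\<^sup>2 / 6\<close> later turns the constant \<open>4 / pi\<^sup>2\<close> into
    2/3.\<close>
  define B where "B = norm s / pi * (4 * real N powr (- Re s - 1) / pi)"
  have "norm (zeta s - em N s - 0) \<le> 0 + B * (pi\<^sup>2 / 6)"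
  proof (rule norm_em_fourier_le[where J = "{}" and b = "\<lambda>_. 0"])
    fix R k :: nat assume R: "R \<ge> N" and k: "k \<ge> 1"
    let ?I = "integral {real N..real R} (\<lambda>u. of_real (sin (2 * pi * real k * u)) * complex_of_real u powr (- s - 1))"
    have "real N \<le> real k * real N" using k mult_right_mono[of 1 "real k" "real N"] by simp
    then have kN: "pi * real N \<le> pi * real k * real N" by (simp add: mult.assoc)
    have pos: "pi * real k * real N > 0" using k N by simp
    have lt: "Im s < 2 * pi * real k * real N" and ge: "pi * real k * real N \<le> 2 * pi * real k * real N - Im s"
      using N kN pos by linarith+
    have "norm ?I \<le> 4 * real N powr (- Re s) / (2 * pi * real k * real N - Im s)"
      using N R k s lt by (intro sin_integral_tail) auto
    also have "\<dots> \<le> 4 * real N powr (- Re s) / (pi * real k * real N)"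
      by (intro frac_le order_refl pos ge) auto
    also have "\<dots> = 4 * real N powr (- Re s - 1) / pi / real k" using N by (simp add: powr_diff)
    finally have "norm s / (pi * real k) * norm ?I \<le> norm s / (pi * real k) * (4 * real N powr (- Re s - 1) / pi / real k)"
      by (intro mult_left_mono) auto
    then show "norm (s / of_real (pi * real k) * ?I) \<le> B / (real k)\<^sup>2"
      by (simp add: norm_mult norm_divide B_def power2_eq_square mult_ac)
  qed (use assms in \<open>auto simp: B_def\<close>)
  also have "0 + B * (pi\<^sup>2 / 6) = (2/3) * (norm s * real N powr (- Re s - 1))"
    by (simp add: B_def power2_eq_square)
  also have "\<dots> \<le> 1 * (norm s * real N powr (- Re s - 1))" by (intro mult_right_mono) auto
  finally show ?thesis by simp
qed

text \<open>Integration by parts between integers, where the sine vanishes, leaves no boundary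
  terms. The power in the cosine form is integrable at 0 when \<open>Re s = 1/2\<close>, so that
  form can be completed to the transform that yields \<open>chi\<close>.\<close>

lemma sin_integral_eq_cos_integral:
  fixes s :: complex
  assumes "1 \<le> N" "N \<le> R" "k \<ge> 1"
  shows "s / of_real (pi * real k) * integral {real N..real R} (\<lambda>u. of_real (sin (2 * pi * real k * u)) * of_real u powr (- s - 1)) =
     2 * integral {real N..real R} (\<lambda>u. of_real (cos (2 * pi * real k * u)) * of_real u powr (- s))"
proof -
  let ?S = "\<lambda>u. of_real (sin (2 * pi * real k * u)) * complex_of_real u powr (- s - 1)"
  let ?C = "\<lambda>u. of_real (cos (2 * pi * real k * u)) * complex_of_real u powr (- s)"
  have iS: "?S integrable_on {real N..real R}" and iC: "?C integrable_on {real N..real R}"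
    using assms by (auto intro!: integrable_continuous_real continuous_intros continuous_on_powr_real)
  have "((\<lambda>u. of_real (sin (2 * pi * real k * u)) * (- s * of_real u powr (- s - 1)) + 
            of_real (2 * pi * real k * cos (2 * pi * real k * u)) * of_real u powr (- s)) has_integral
     (of_real (sin (2 * pi * real k * real R)) * of_real (real R) powr (- s) - of_real (sin (2 * pi * real k * real N)) * of_real (real N) powr (- s))) {real N..real R}"
  proof (rule fundamental_theorem_of_calculus)
    fix u assume "u \<in> {real N..real R}"
    then have u: "u > 0" using assms by auto
    have "((\<lambda>u. sin (2 * pi * real k * u)) has_real_derivative 2 * pi * real k * cos (2 * pi * real k * u)) (at u within {real N..real R})"
      by (auto intro!: derivative_eq_intros)
    then show "((\<lambda>u. of_real (sin (2 * pi * real k * u)) * of_real u powr (- s)) has_vector_derivative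
        of_real (sin (2 * pi * real k * u)) * (- s * of_real u powr (- s - 1)) + 
            of_real (2 * pi * real k * cos (2 * pi * real k * u)) * of_real u powr (- s)) (at u within {real N..real R})"
      by (intro has_vector_derivative_mult has_vector_derivative_powr_real u has_vector_derivative_of_real)
         (simp add: has_real_derivative_iff_has_vector_derivative)
  qed (use assms in auto)
  then have "((\<lambda>u. - s * ?S u + of_real (2 * pi * real k) * ?C u) has_integral 0) {real N..real R}"
    unfolding sin_2pi_nat by (simp add: mult_ac)
  moreover have "((\<lambda>u. - s * ?S u + of_real (2 * pi * real k) * ?C u) has_integral 
      - s * integral {real N..real R} ?S + of_real (2 * pi * real k) * integral {real N..real R} ?C) {real N..real R}"
    by (intro has_integral_add has_integral_mult_right integrable_integral iS iC)
  ultimately have "- s * integral {real N..real R} ?S + of_real (2 * pi * real k) * integral {real N..real R} ?C = 0"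
    using has_integral_unique by blast
  then have "s * integral {real N..real R} ?S = of_real (2 * pi * real k) * integral {real N..real R} ?C"
    by (simp add: algebra_simps)
  then show ?thesis using assms(3) by (simp add: field_simps)
qed

text \<open>An approximate functional equation: with \<open>t / (2 \<pi> N)\<close> kept away from the integers, exactly the
  frequencies \<open>k \<le> j\<close> have a stationary point beyond \<open>N\<close>.\<close>

lemma approximate_functional_equation:
  assumes s: "Re s = 1/2" and N: "N \<ge> 1"
    and t: "2 * pi * real N * (real j + 1/2) \<le> Im s" "Im s \<le> 2 * pi * real N * (real j + 5/8)"
  shows "norm (zeta s - (\<Sum>n=1..N. of_nat n powr (- s)) - chi s * (\<Sum>k=1..j. of_nat k powr (s - 1)))
           \<le> 16 * (real j + 1)\<^sup>2 / sqrt N"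
proof -
  define t where "t = Im s"
  define q where "q = 1 / sqrt (real N)"
  have q0: "q > 0" and qN: "real N powr (- 1/2) = q" using N 
    by (simp_all add: q_def powr_minus powr_half_sqrt[symmetric] field_simps powr_minus_divide)
  have pN: "pi * real N \<le> t" 
  proof -
    have "pi * real N = 2 * pi * real N * (1/2)" by simp
    also have "\<dots> \<le> 2 * pi * real N * (real j + 1/2)" by (intro mult_left_mono) auto
    also have "\<dots> \<le> t" using t unfolding t_def by simp
    finally show ?thesis .
  qed
  have p3: "pi > 3" using pi_gt3 .
  have tN: "t \<ge> 3 * real N" using pN p3 mult_right_mono[of 3 pi "real N"] by linarith
  have t3: "t \<ge> 3" using tN N by simp
  have s1: "s \<noteq> 1" using t3 by (auto simp: t_def)
  have ns: "norm s \<le> 2 * t"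
  proof -
    have "norm s \<le> \<bar>Re s\<bar> + \<bar>Im s\<bar>" by (rule cmod_le)
    then show ?thesis using s t3 by (simp add: t_def)
  qed
  \<comment> \<open>The cosine integrals completed to start at 0; they tend to the dual sum as
    \<open>R\<close> grows. The error of the completion is the integral from 0 to \<open>N\<close>,
    left of every stationary point.\<close>
  define b where "b = (\<lambda>R::nat. \<Sum>k=1..j. 2 * integral {0..real R} (\<lambda>u. of_real (cos (2 * pi * real k * u)) * of_real u powr (- s)))"
  define B where "B = norm s * q / real N * (real j + 1) * 16 / (3 * pi\<^sup>2)"
  have "norm (zeta s - em N s - chi s * (\<Sum>k=1..j. of_nat k powr (s - 1))) \<le> 3 * real j * q + B * (pi\<^sup>2 / 6)"
  proof (rule norm_em_fourier_le[where J = "{1..j}" and b = b])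
    fix R k :: nat assume R: "R \<ge> N" and k: "k \<ge> 1" "k \<notin> {1..j}"
    let ?I = "integral {real N..real R} (\<lambda>u. of_real (sin (2 * pi * real k * u)) * complex_of_real u powr (- s - 1))"
    have "real k \<ge> real j + 1" using k by simp
    \<comment> \<open>At \<open>k = j + 1\<close> both sides are 3/8: this is the room that the
      upper bound \<open>j + 5/8\<close> leaves below the next frequency.\<close>
    then have "real k - real j - 5/8 \<ge> 3/8 * real k / (real j + 1)"
      using mult_nonneg_nonneg[of "real j" "real k - (real j + 1)"] by (simp add: field_simps)
    then have "2 * pi * real N * (3/8 * real k / (real j + 1)) \<le> 2 * pi * real N * (real k - real j - 5/8)"
      by (intro mult_left_mono) auto
    also have "\<dots> \<le> 2 * pi * real k * real N - t"
      using t unfolding t_def by (simp add: algebra_simps)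
    finally have ge: "2 * pi * real N * (3/8 * real k / (real j + 1)) \<le> 2 * pi * real k * real N - t" .
    have pos: "2 * pi * real N * (3/8 * real k / (real j + 1)) > 0" using N k by simp
    have lt: "Im s < 2 * pi * real k * real N" using ge pos unfolding t_def by linarith
    have "norm ?I \<le> 4 * real N powr (- Re s) / (2 * pi * real k * real N - Im s)"
      using N R k s lt t3 unfolding t_def by (intro sin_integral_tail) auto
    also have "\<dots> \<le> 4 * real N powr (- Re s) / (2 * pi * real N * (3/8 * real k / (real j + 1)))"
      by (intro frac_le order_refl pos ge[unfolded t_def]) auto
    also have "\<dots> = 16 * q * (real j + 1) / (3 * pi * real N * real k)"
    proof -
      have "real N powr (- Re s) = q" using qN unfolding s by simp
      then show ?thesis using N k by (simp add: field_simps)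
    qed
    finally have "norm s / (pi * real k) * norm ?I \<le> norm s / (pi * real k) * (16 * q * (real j + 1) / (3 * pi * real N * real k))"
      by (intro mult_left_mono) auto
    then show "norm (s / of_real (pi * real k) * ?I) \<le> B / (real k)\<^sup>2"
      by (simp add: norm_mult norm_divide B_def power2_eq_square mult_ac)
  next
    fix R :: nat assume R: "R \<ge> N"
    let ?C = "\<lambda>k u. of_real (cos (2 * pi * real k * u)) * complex_of_real u powr (- s)"
    have "(\<Sum>k=1..j. s / of_real (pi * real k) * integral {real N..real R} (\<lambda>u. of_real (sin (2 * pi * real k * u)) * of_real u powr (- s - 1))) - b R
       = (\<Sum>k=1..j. - (2 * integral {0..real N} (?C k)))"
      unfolding b_def sum_subtractf[symmetric]
    proof (intro sum.cong refl)
      fix k assume "k \<in> {1..j}"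
      then have k: "k \<ge> 1" by simp
      have "integral {0..real R} (\<lambda>u. of_real (cos (2 * pi * real k * u)) * of_real u powr ((1 - s) - 1)) =
         integral {0..real N} (\<lambda>u. of_real (cos (2 * pi * real k * u)) * of_real u powr ((1 - s) - 1)) + 
         integral {real N..real R} (\<lambda>u. of_real (cos (2 * pi * real k * u)) * of_real u powr ((1 - s) - 1))"
        using R s by (intro integral_combine_powr) (auto intro!: continuous_intros)
      then show "s / of_real (pi * real k) * integral {real N..real R} (\<lambda>u. of_real (sin (2 * pi * real k * u)) * of_real u powr (- s - 1)) -
          2 * integral {0..real R} (?C k) = - (2 * integral {0..real N} (?C k))"
        by (subst sin_integral_eq_cos_integral[OF N R k]) (simp add: algebra_simps)
    qed
    also have "norm \<dots> \<le> (\<Sum>k=1..j. 3 * q)"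
    proof (rule sum_norm_le)
      fix k assume k: "k \<in> {1..j}"
      \<comment> \<open>The lower bound \<open>j + 1/2\<close> leaves half a unit above the last
        dual frequency, hence a denominator of at least \<open>pi * N\<close>.\<close>
      have "2 * pi * real k * real N + pi * real N = 2 * pi * real N * (real k + 1/2)" by (simp add: algebra_simps)
      also have "\<dots> \<le> 2 * pi * real N * (real j + 1/2)" using k by (intro mult_left_mono) auto
      also have "\<dots> \<le> t" using t by (simp add: t_def)
      finally have ge: "pi * real N \<le> t - 2 * pi * real k * real N" by simp
      have pos: "pi * real N > 0" using N by simp
      have lt: "2 * pi * real k * real N < Im s" using ge pos unfolding t_def by linarith
      have "norm (integral {0..real N} (?C k)) \<le> 4 * sqrt (real N) / (Im s - 2 * pi * real k * real N)"
        using N k s lt by (intro cos_integral_head) auto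
      also have "\<dots> \<le> 4 * sqrt (real N) / (pi * real N)"
        by (intro frac_le order_refl pos ge[unfolded t_def]) auto
      also have "\<dots> \<le> 4 * sqrt (real N) / (3 * real N)"
        using p3 N by (intro divide_left_mono mult_right_mono) auto
      also have "\<dots> = 4 / 3 * q" using N by (simp add: q_def field_simps)
      finally show "norm (- (2 * integral {0..real N} (?C k))) \<le> 3 * q" using q0 by (simp add: norm_mult)
    qed
    also have "\<dots> = 3 * real j * q" by simp
    finally show "norm ((\<Sum>k=1..j. s / of_real (pi * real k) * integral {real N..real R} (\<lambda>u. of_real (sin (2 * pi * real k * u)) * of_real u powr (- s - 1))) - b R) \<le> 3 * real j * q" .
  next
    have "(\<lambda>R. \<Sum>k=1..j. 2 * integral {0..real R} (\<lambda>u. of_real (cos (2 * pi * real k * u)) * of_real u powr (- s))) \<longlonglongrightarrow> (\<Sum>k=1..j. chi s * of_nat k powr (s - 1))"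
      using s by (intro tendsto_sum filterlim_compose[OF chi_cos_integral filterlim_real_sequentially]) auto
    then show "b \<longlonglongrightarrow> chi s * (\<Sum>k=1..j. of_nat k powr (s - 1))"
      unfolding b_def by (simp add: sum_distrib_left)
  qed (use s s1 N q0 in \<open>auto simp: B_def\<close>)
  also have "B * (pi\<^sup>2 / 6) \<le> 12 * (real j + 1)\<^sup>2 * q"
  proof -
    \<comment> \<open>The constant is \<open>2 * 2 * (13/4)\<close>, from
      \<open>norm s \<le> 2 * t\<close> and \<open>pi \<le> 13/4\<close>.\<close>
    have "norm s \<le> 13 * (real j + 1) * real N"
    proof -
      have "t \<le> 2 * pi * real N * (real j + 1)"
        unfolding t_def by (rule order_trans[OF t(2)]) (intro mult_left_mono, auto)
      also have "\<dots> \<le> 2 * (13/4) * real N * (real j + 1)"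
        using pi_less_4 pi_approx by (intro mult_right_mono) auto
      finally have "2 * t \<le> 13 * (real j + 1) * real N" by (simp add: algebra_simps)
      with ns show ?thesis by linarith
    qed
    then have "norm s / real N \<le> 13 * (real j + 1)" using N by (simp add: field_simps)
    then have "norm s / real N * (q * (real j + 1) * (8/9)) \<le> 13 * (real j + 1) * (q * (real j + 1) * (8/9))"
      using q0 by (intro mult_right_mono) auto
    also have "13 * (real j + 1) * (q * (real j + 1) * (8/9)) = (104/9) * ((real j + 1)\<^sup>2 * q)" by (simp add: power2_eq_square)
    also have "(104/9) * ((real j + 1)\<^sup>2 * q) \<le> 12 * ((real j + 1)\<^sup>2 * q)" using q0 by (intro mult_right_mono) auto
    finally have "norm s / real N * (q * (real j + 1) * (8/9)) \<le> 12 * ((real j + 1)\<^sup>2 * q)" .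
    moreover have "B * (pi\<^sup>2 / 6) = norm s / real N * (q * (real j + 1) * (8/9))"
      using N by (simp add: B_def field_simps)
    ultimately show ?thesis by (simp only: mult.assoc)
  qed
  finally have 1: "norm (zeta s - em N s - chi s * (\<Sum>k=1..j. of_nat k powr (s - 1))) \<le> 3 * real j * q + 12 * (real j + 1)\<^sup>2 * q" by simp
  have "em N s - (\<Sum>n=1..N. of_nat n powr (- s)) = - (of_nat N powr (- s) / 2) - of_nat N powr (1 - s) / (1 - s)"
    by (simp add: em_def)
  also have "norm \<dots> \<le> norm (of_nat N powr (- s) / 2) + norm (of_nat N powr (1 - s) / (1 - s))"
    using norm_triangle_ineq4[of "- (of_nat N powr (- s) / 2)" "of_nat N powr (1 - s) / (1 - s)"] by simp
  also have "norm (of_nat N powr (- s) / 2) = q / 2"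
    using norm_powr_of_nonneg_real[of "real N" "-s"] s qN by (simp add: norm_divide)
  also have "norm (of_nat N powr (1 - s) / (1 - s)) \<le> q / 3"
  proof -
    have n: "norm (of_nat N powr (1 - s) :: complex) = sqrt (real N)"
      using norm_powr_of_nonneg_real[of "real N" "1-s"] s by (simp add: powr_half_sqrt)
    have "norm (1 - s) \<ge> 3 * real N" using abs_Im_le_cmod[of "1 - s"] tN by (simp add: t_def)
    then have "sqrt (real N) / norm (1 - s) \<le> sqrt (real N) / (3 * real N)"
      using N by (intro divide_left_mono) (auto intro!: mult_pos_pos)
    also have "\<dots> = q / 3" using N by (simp add: q_def field_simps)
    finally show ?thesis by (simp add: norm_divide n)
  qed
  finally have 2: "norm (em N s - (\<Sum>n=1..N. of_nat n powr (- s))) \<le> q / 2 + q / 3" by simp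
  have "zeta s - (\<Sum>n=1..N. of_nat n powr (- s)) - chi s * (\<Sum>k=1..j. of_nat k powr (s - 1)) =
    (zeta s - em N s - chi s * (\<Sum>k=1..j. of_nat k powr (s - 1))) + (em N s - (\<Sum>n=1..N. of_nat n powr (- s)))" by simp
  also have "norm \<dots> \<le> (3 * real j * q + 12 * (real j + 1)\<^sup>2 * q) + (q / 2 + q / 3)"
    using 1 2 norm_triangle_mono by blast
  also have "\<dots> = (3 * real j + 12 * (real j + 1)\<^sup>2 + 5/6) * q" by (simp add: algebra_simps)
  also have "\<dots> \<le> 16 * (real j + 1)\<^sup>2 * q"
    using q0 by (intro mult_right_mono) (auto simp: power2_eq_square algebra_simps)
  finally show ?thesis by (simp add: q_def)
qed

section \<open>Mean values of Dirichlet polynomials\<close>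

lemma norm_integral_cis_le:
  assumes "a \<le> b" "\<nu> \<noteq> 0"
  shows "norm (integral {a..b} (\<lambda>t. cis (\<nu> * t))) \<le> 2 / \<bar>\<nu>\<bar>"
proof -
  have "((\<lambda>t. cis (\<nu> * t)) has_integral (cis (\<nu> * b) / (\<i> * \<nu>) - cis (\<nu> * a) / (\<i> * \<nu>))) {a..b}"
  proof (rule fundamental_theorem_of_calculus[OF assms(1)])
    fix t
    have "((\<lambda>t. cis (\<nu> * t)) has_derivative (\<lambda>x. (x * \<nu>) *\<^sub>R (\<i> * cis (\<nu> * t)))) (at t within {a..b})"
      by (auto intro!: derivative_eq_intros)
    then have "((\<lambda>t. cis (\<nu> * t)) has_vector_derivative \<nu> *\<^sub>R (\<i> * cis (\<nu> * t))) (at t within {a..b})"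
      unfolding has_vector_derivative_def by simp
    from has_vector_derivative_divide[OF this, of "\<i> * \<nu>"] assms(2)
    show "((\<lambda>t. cis (\<nu> * t) / (\<i> * \<nu>)) has_vector_derivative cis (\<nu> * t)) (at t within {a..b})"
      by (simp add: scaleR_conv_of_real)
  qed
  then have "integral {a..b} (\<lambda>t. cis (\<nu> * t)) = cis (\<nu> * b) / (\<i> * \<nu>) - cis (\<nu> * a) / (\<i> * \<nu>)"
    by (rule integral_unique)
  also have "norm \<dots> \<le> norm (cis (\<nu> * b) / (\<i> * \<nu>)) + norm (cis (\<nu> * a) / (\<i> * \<nu>))"
    by (rule norm_triangle_ineq4)
  also have "\<dots> = 2 / \<bar>\<nu>\<bar>" by (simp add: norm_divide norm_mult)
  finally show ?thesis .
qed

text \<open>The thresholds \<open>c n\<close> and \<open>d m\<close> let a term enter at a given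
  height, as is needed for a sum whose length grows with \<open>t\<close>. A pair of terms is
  integrated from the later entry on; the diagonal keeps the remaining length, and an off-diagonal
  pair is bounded by its oscillation alone.\<close>

lemma dirichlet_polynomial_mean_product:
  fixes \<alpha> \<beta> c d :: "nat \<Rightarrow> real"
  assumes fin: "finite M" "finite S" "S \<subseteq> M" "0 \<notin> M" and ab: "a \<le> b"
    and M: "\<And>m. m \<in> M \<Longrightarrow> \<alpha> m \<ge> 0 \<and> a \<le> d m \<and> d m \<le> b"
    and S: "\<And>n. n \<in> S \<Longrightarrow> \<beta> n \<ge> 0 \<and> a \<le> c n \<and> c n \<le> b"
  defines "F \<equiv> (\<lambda>t. \<Sum>m\<in>M. of_real (if d m \<le> t then \<alpha> m else 0) * cis (- (t * ln (real m))))"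
    and "G \<equiv> (\<lambda>t. \<Sum>n\<in>S. of_real (if c n \<le> t then \<beta> n else 0) * cis (- (t * ln (real n))))"
  shows "(\<lambda>t. F t * cnj (G t)) integrable_on {a..b}"
    and "norm (integral {a..b} (\<lambda>t. F t * cnj (G t)) - of_real (\<Sum>n\<in>S. \<alpha> n * \<beta> n * (b - max (c n) (d n))))
           \<le> (\<Sum>n\<in>S. \<Sum>m\<in>M - {n}. 2 * (\<alpha> m * \<beta> n) / \<bar>ln (real m / real n)\<bar>)"
proof -
  define I where "I = (\<lambda>n m. integral {max (c n) (d m)..b} (\<lambda>t. cis ((ln (real n) - ln (real m)) * t)))"
  define f where "f = (\<lambda>n m t. of_real (\<alpha> m * \<beta> n) * (if t \<in> {max (c n) (d m)..b} then cis ((ln (real n) - ln (real m)) * t) else 0))"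
  have f: "(f n m has_integral of_real (\<alpha> m * \<beta> n) * I n m) {a..b}" if "n \<in> S" "m \<in> M" for n m
  proof -
    have "(\<lambda>t. cis ((ln (real n) - ln (real m)) * t)) integrable_on {max (c n) (d m)..b}"
      by (intro integrable_continuous_real continuous_intros)
    then show ?thesis unfolding f_def I_def using S[OF that(1)] M[OF that(2)]
      by (intro has_integral_mult_right) (subst has_integral_restrict, auto)
  qed
  have FG: "F t * cnj (G t) = (\<Sum>n\<in>S. \<Sum>m\<in>M. f n m t)" if "t \<in> {a..b}" for t
  proof -
    have "F t * cnj (G t) = (\<Sum>m\<in>M. \<Sum>n\<in>S. (of_real (if d m \<le> t then \<alpha> m else 0) * cis (- (t * ln (real m)))) * cnj (of_real (if c n \<le> t then \<beta> n else 0) * cis (- (t * ln (real n)))))"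
      unfolding F_def G_def cnj_sum by (rule sum_product)
    also have "\<dots> = (\<Sum>m\<in>M. \<Sum>n\<in>S. f n m t)"
    proof (intro sum.cong refl)
      fix m n
      have "cis ((ln (real n) - ln (real m)) * t) = cis (- (t * ln (real m))) * cis (t * ln (real n))"
        unfolding cis_mult by (simp add: algebra_simps)
      then show "(of_real (if d m \<le> t then \<alpha> m else 0) * cis (- (t * ln (real m)))) * cnj (of_real (if c n \<le> t then \<beta> n else 0) * cis (- (t * ln (real n)))) = f n m t"
        using that by (auto simp: f_def cis_cnj)
    qed
    also have "\<dots> = (\<Sum>n\<in>S. \<Sum>m\<in>M. f n m t)" by (rule sum.swap)
    finally show ?thesis .
  qed
  have "((\<lambda>t. \<Sum>n\<in>S. \<Sum>m\<in>M. f n m t) has_integral (\<Sum>n\<in>S. \<Sum>m\<in>M. of_real (\<alpha> m * \<beta> n) * I n m)) {a..b}"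
    using fin by (intro has_integral_sum f) auto
  then have hi: "((\<lambda>t. F t * cnj (G t)) has_integral (\<Sum>n\<in>S. \<Sum>m\<in>M. of_real (\<alpha> m * \<beta> n) * I n m)) {a..b}"
    using FG by (subst has_integral_cong) auto
  then show "(\<lambda>t. F t * cnj (G t)) integrable_on {a..b}" by blast
  have diag: "I n n = of_real (b - max (c n) (d n))" if "n \<in> S" for n
  proof -
    have "max (c n) (d n) \<le> b" using that S M fin by auto
    then show ?thesis by (simp add: I_def scaleR_conv_of_real)
  qed
  have "integral {a..b} (\<lambda>t. F t * cnj (G t)) = (\<Sum>n\<in>S. \<Sum>m\<in>M. of_real (\<alpha> m * \<beta> n) * I n m)"
    using hi by (rule integral_unique)
  also have "\<dots> = (\<Sum>n\<in>S. of_real (\<alpha> n * \<beta> n) * I n n + (\<Sum>m\<in>M - {n}. of_real (\<alpha> m * \<beta> n) * I n m))"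
    using fin by (intro sum.cong refl sum.remove) auto
  also have "\<dots> = of_real (\<Sum>n\<in>S. \<alpha> n * \<beta> n * (b - max (c n) (d n))) + (\<Sum>n\<in>S. \<Sum>m\<in>M - {n}. of_real (\<alpha> m * \<beta> n) * I n m)"
    using diag by (simp add: sum.distrib)
  finally have "integral {a..b} (\<lambda>t. F t * cnj (G t)) - of_real (\<Sum>n\<in>S. \<alpha> n * \<beta> n * (b - max (c n) (d n))) = (\<Sum>n\<in>S. \<Sum>m\<in>M - {n}. of_real (\<alpha> m * \<beta> n) * I n m)"
    by simp
  also have "norm \<dots> \<le> (\<Sum>n\<in>S. \<Sum>m\<in>M - {n}. 2 * (\<alpha> m * \<beta> n) / \<bar>ln (real m / real n)\<bar>)"
  proof (intro sum_norm_le)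
    fix n m assume n: "n \<in> S" and m: "m \<in> M - {n}"
    have pos: "real n > 0" "real m > 0" using n m fin by (auto intro!: gr0I)
    have nz: "ln (real n) - ln (real m) \<noteq> 0" using pos m by auto
    have "norm (I n m) \<le> 2 / \<bar>ln (real n) - ln (real m)\<bar>"
      unfolding I_def using S[OF n] M[of m] m nz by (intro norm_integral_cis_le) auto
    also have "\<bar>ln (real n) - ln (real m)\<bar> = \<bar>ln (real m / real n)\<bar>"
      using pos by (simp add: ln_div abs_minus_commute)
    finally have "(\<alpha> m * \<beta> n) * norm (I n m) \<le> (\<alpha> m * \<beta> n) * (2 / \<bar>ln (real m / real n)\<bar>)"
      using S[OF n] M[of m] m by (intro mult_left_mono) auto
    then show "norm (of_real (\<alpha> m * \<beta> n) * I n m) \<le> 2 * (\<alpha> m * \<beta> n) / \<bar>ln (real m / real n)\<bar>"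
      using S[OF n] M[of m] m by (simp add: norm_mult mult_ac)
  qed
  finally show "norm (integral {a..b} (\<lambda>t. F t * cnj (G t)) - of_real (\<Sum>n\<in>S. \<alpha> n * \<beta> n * (b - max (c n) (d n))))
           \<le> (\<Sum>n\<in>S. \<Sum>m\<in>M - {n}. 2 * (\<alpha> m * \<beta> n) / \<bar>ln (real m / real n)\<bar>)" .
qed

lemma harm_le_ln: "n \<ge> 1 \<Longrightarrow> harm n \<le> 1 + ln (real n)"
proof (induction n rule: dec_induct)
  case base
  then show ?case by (simp add: harm_expand)
next
  case (step n)
  have "ln (real n / real (Suc n)) \<le> real n / real (Suc n) - 1"
    using step by (intro ln_le_minus_one) auto
  also have "\<dots> = - inverse (real (Suc n))" by (simp add: field_simps)
  finally have "inverse (real (Suc n)) \<le> ln (real (Suc n)) - ln (real n)"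
    using step by (simp add: ln_div)
  then show ?case using step by (simp add: harm_Suc)
qed

lemma sum_powr_le:
  assumes "0 \<le> \<sigma>" "\<sigma> < 1"
  shows "(\<Sum>n=1..N. real n powr (- \<sigma>)) \<le> real N powr (1 - \<sigma>) / (1 - \<sigma>)"
proof (induction N)
  case (Suc N)
  have "real (Suc N) powr (- \<sigma>) \<le> (real (Suc N) powr (1 - \<sigma>) - real N powr (1 - \<sigma>)) / (1 - \<sigma>)"
  proof (cases "N = 0")
    case True
    then show ?thesis using assms by (simp add: field_simps)
  next
    case False
    have "\<exists>z. real N < z \<and> z < real (Suc N) \<and> real (Suc N) powr (1 - \<sigma>) - real N powr (1 - \<sigma>) = (real (Suc N) - real N) * ((1 - \<sigma>) * z powr (1 - \<sigma> - 1))"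
      using False by (intro MVT2) (auto intro!: derivative_eq_intros)
    then obtain z where z: "real N < z" "z < real (Suc N)" "real (Suc N) powr (1 - \<sigma>) - real N powr (1 - \<sigma>) = (1 - \<sigma>) * z powr (- \<sigma>)"
      by auto
    have "real (Suc N) powr (- \<sigma>) \<le> z powr (- \<sigma>)" using z assms False by (intro powr_mono2') auto
    then show ?thesis using z assms by simp
  qed
  then show ?case using Suc by (simp add: diff_divide_distrib)
qed simp

lemma inverse_abs_ln_le:
  assumes "m \<ge> 1" "n \<ge> 1" "m \<noteq> n"
  shows "1 / \<bar>ln (real m / real n)\<bar> \<le> real (max m n) / \<bar>real m - real n\<bar>"
proof -
  define l L where "l = min m n" and "L = max m n"
  have lL: "1 \<le> l" "l < L" using assms by (auto simp: l_def L_def)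
  have "\<bar>ln (real m / real n)\<bar> = ln (real L) - ln (real l)"
    using assms by (auto simp: l_def L_def ln_div max_def min_def)
  moreover have "\<bar>real m - real n\<bar> = real L - real l" using assms by (auto simp: l_def L_def max_def min_def)
  moreover have "(real L - real l) / real L \<le> ln (real L) - ln (real l)"
    using ln_le_minus_one[of "real l / real L"] lL by (simp add: ln_div diff_divide_distrib)
  moreover have "(real L - real l) / real L > 0" using lL by simp
  ultimately have "1 / \<bar>ln (real m / real n)\<bar> \<le> 1 / ((real L - real l) / real L)"
    by (simp only:) (intro divide_left_mono mult_pos_pos, auto)
  then show ?thesis using \<open>\<bar>real m - real n\<bar> = real L - real l\<close> by (simp add: L_def)
qed

lemma sum_inverse_distance_le:
  assumes "1 \<le> n" "n \<le> N"
  shows "(\<Sum>m\<in>{1..N} - {n}. 1 / \<bar>real m - real n\<bar>) \<le> 2 * (1 + ln (real N))"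
proof -
  have h: "harm k \<le> 1 + ln (real N)" if "k \<le> N" for k
  proof (cases "k = 0")
    case True
    then show ?thesis using assms by (simp add: harm_def)
  next
    case False
    then have "harm k \<le> 1 + ln (real k)" by (intro harm_le_ln) auto
    also have "\<dots> \<le> 1 + ln (real N)" using that False by simp
    finally show ?thesis .
  qed
  have eq: "{1..N} - {n} = {1..<n} \<union> {n<..N}" using assms by auto
  have "(\<Sum>m\<in>{1..N} - {n}. 1 / \<bar>real m - real n\<bar>) = (\<Sum>m\<in>{1..<n}. 1 / \<bar>real m - real n\<bar>) + (\<Sum>m\<in>{n<..N}. 1 / \<bar>real m - real n\<bar>)"
    unfolding eq by (rule sum.union_disjoint) auto
  also have "(\<Sum>m\<in>{1..<n}. 1 / \<bar>real m - real n\<bar>) = harm (n - 1)"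
    unfolding harm_def
    by (rule sum.reindex_bij_witness[of _ "\<lambda>k. n - k" "\<lambda>m. n - m"]) (auto simp: of_nat_diff divide_simps)
  also have "(\<Sum>m\<in>{n<..N}. 1 / \<bar>real m - real n\<bar>) = harm (N - n)"
    unfolding harm_def
    by (rule sum.reindex_bij_witness[of _ "\<lambda>k. n + k" "\<lambda>m. m - n"]) (auto simp: of_nat_diff divide_simps)
  also have "harm (n - 1) + harm (N - n) \<le> (1 + ln (real N)) + (1 + ln (real N))"
    using assms by (intro add_mono h) auto
  finally show ?thesis by simp
qed

text \<open>The inverse logarithm is at most \<open>max m n\<close> over the distance of
  \<open>m\<close> and \<open>n\<close>, and the maximum is the minimum plus that distance. The
  distance part gives the product of the two sums; the minimum part leaves
  \<open>n powr (1 - 2 * \<sigma>)\<close> times a harmonic sum over the distances.\<close>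

lemma offdiagonal_sum_le:
  assumes "1/2 \<le> \<sigma>" "\<sigma> \<le> 1" "X \<le> N"
  shows "(\<Sum>n=1..X. \<Sum>m\<in>{1..N} - {n}. 2 * (real m powr (- \<sigma>) * real n powr (- \<sigma>)) / \<bar>ln (real m / real n)\<bar>)
     \<le> 2 * (\<Sum>n=1..X. real n powr (- \<sigma>)) * (\<Sum>m=1..N. real m powr (- \<sigma>)) + 4 * (1 + ln (real N)) * (\<Sum>n=1..X. real n powr (1 - 2 * \<sigma>))"
proof -
  have pt: "2 * (real m powr (- \<sigma>) * real n powr (- \<sigma>)) / \<bar>ln (real m / real n)\<bar> \<le>
      2 * (real m powr (- \<sigma>) * real n powr (- \<sigma>)) + 2 * real n powr (1 - 2 * \<sigma>) * (1 / \<bar>real m - real n\<bar>)"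
    if n: "n \<ge> 1" and m: "m \<ge> 1" "m \<noteq> n" for m n
  proof -
    define p where "p = real m powr (- \<sigma>) * real n powr (- \<sigma>)"
    define l where "l = real (min m n)"
    define \<delta> where "\<delta> = \<bar>real m - real n\<bar>"
    have \<delta>: "\<delta> > 0" using m by (simp add: \<delta>_def)
    have p: "p \<ge> 0" by (simp add: p_def)
    have L: "real (max m n) = l + \<delta>" by (auto simp: l_def \<delta>_def max_def min_def)
    have "p * (1 / \<bar>ln (real m / real n)\<bar>) \<le> p * ((l + \<delta>) / \<delta>)"
      using inverse_abs_ln_le[OF m(1) n m(2)] p unfolding L \<delta>_def[symmetric] by (intro mult_left_mono) auto
    also have "\<dots> = p + p * l / \<delta>" using \<delta> by (simp add: field_simps)
    also have "p * l \<le> real n powr (1 - 2 * \<sigma>)"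
    proof (cases "n < m")
      case True
      have "p * l = real m powr (- \<sigma>) * (real n powr (- \<sigma>) * real n powr 1)" using True n by (simp add: p_def l_def)
      also have "\<dots> = real m powr (- \<sigma>) * real n powr (1 - \<sigma>)" unfolding powr_add[symmetric] by simp
      also have "\<dots> \<le> real n powr (- \<sigma>) * real n powr (1 - \<sigma>)"
        using True n assms by (intro mult_right_mono powr_mono2') auto
      also have "\<dots> = real n powr (1 - 2 * \<sigma>)" unfolding powr_add[symmetric] by simp
      finally show ?thesis .
    next
      case False
      then have mn: "m < n" using m by simp
      have "p * l = real n powr (- \<sigma>) * (real m powr (- \<sigma>) * real m powr 1)" using mn m by (simp add: p_def l_def)
      also have "\<dots> = real n powr (- \<sigma>) * real m powr (1 - \<sigma>)" unfolding powr_add[symmetric] by simp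
      also have "\<dots> \<le> real n powr (- \<sigma>) * real n powr (1 - \<sigma>)"
        using mn m assms by (intro mult_left_mono powr_mono2) auto
      also have "\<dots> = real n powr (1 - 2 * \<sigma>)" unfolding powr_add[symmetric] by simp
      finally show ?thesis .
    qed
    finally have "p * (1 / \<bar>ln (real m / real n)\<bar>) \<le> p + real n powr (1 - 2 * \<sigma>) / \<delta>"
      using \<delta> by (simp add: divide_right_mono)
    then show ?thesis unfolding p_def[symmetric] \<delta>_def[symmetric] by simp
  qed
  have "(\<Sum>n=1..X. \<Sum>m\<in>{1..N} - {n}. 2 * (real m powr (- \<sigma>) * real n powr (- \<sigma>)) / \<bar>ln (real m / real n)\<bar>)
     \<le> (\<Sum>n=1..X. \<Sum>m\<in>{1..N} - {n}. 2 * (real m powr (- \<sigma>) * real n powr (- \<sigma>)) + 2 * real n powr (1 - 2 * \<sigma>) * (1 / \<bar>real m - real n\<bar>))"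
    by (intro sum_mono pt) auto
  also have "\<dots> = (\<Sum>n=1..X. (\<Sum>m\<in>{1..N} - {n}. 2 * (real m powr (- \<sigma>) * real n powr (- \<sigma>))) + 2 * real n powr (1 - 2 * \<sigma>) * (\<Sum>m\<in>{1..N} - {n}. 1 / \<bar>real m - real n\<bar>))"
    by (simp add: sum.distrib sum_distrib_left)
  also have "\<dots> \<le> (\<Sum>n=1..X. (\<Sum>m=1..N. 2 * (real m powr (- \<sigma>) * real n powr (- \<sigma>))) + 2 * real n powr (1 - 2 * \<sigma>) * (2 * (1 + ln (real N))))"
    using assms by (intro sum_mono add_mono sum_mono2 mult_left_mono sum_inverse_distance_le) auto
  also have "\<dots> = 2 * (\<Sum>n=1..X. real n powr (- \<sigma>)) * (\<Sum>m=1..N. real m powr (- \<sigma>)) + 4 * (1 + ln (real N)) * (\<Sum>n=1..X. real n powr (1 - 2 * \<sigma>))"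
  proof -
    have *: "(\<Sum>m=1..N. 2 * (real m powr (- \<sigma>) * real n powr (- \<sigma>))) = 2 * real n powr (- \<sigma>) * (\<Sum>m=1..N. real m powr (- \<sigma>))" for n
      by (simp add: sum_distrib_left mult_ac)
    have "(\<Sum>n=1..X. 2 * a n * P + 2 * b n * (2 * W)) = 2 * (\<Sum>n=1..X. a n) * P + 4 * W * (\<Sum>n=1..X. b n)" for a b :: "nat \<Rightarrow> real" and P W
      by (simp add: sum.distrib sum_distrib_left sum_distrib_right mult_ac)
    then show ?thesis unfolding * .
  qed
  finally show ?thesis .
qed

lemma nat_powr_critical: "m \<ge> 1 \<Longrightarrow> (of_nat m :: complex) powr (- Complex \<sigma> t) = of_real (real m powr (- \<sigma>)) * cis (- (t * ln (real m)))"
  using powr_real_polar[of "real m" "- Complex \<sigma> t"] by simp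

section \<open>The mean square on the critical line\<close>

lemma zeta_line_continuous:
  assumes "\<sigma> \<noteq> 1 \<or> 0 \<notin> S"
  shows "continuous_on S (\<lambda>t. zeta (Complex \<sigma> t))"
proof -
  have "continuous_on S (\<lambda>t. Complex \<sigma> t)" unfolding Complex_eq by (intro continuous_intros)
  moreover have "continuous_on (Complex \<sigma> ` S) zeta"
    using assms by (intro holomorphic_on_imp_continuous_on holomorphic_on_subset[OF zeta_holomorphic]) (auto simp: complex_eq_iff)
  ultimately show ?thesis using continuous_on_compose by (auto simp: o_def)
qed

text \<open>For \<open>N \<ge> t\<close> no dual sum appears. The three summands of the factor come
  from the distance of \<open>zeta\<close> to \<open>em\<close> and from the two correction terms
  inside \<open>em\<close>.\<close>

lemma zeta_minus_dirichlet_polynomial_le: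
  assumes "\<sigma> \<ge> 0" "t \<ge> 1" "t \<le> real N"
  shows "norm (zeta (Complex \<sigma> t) - (\<Sum>n=1..N. of_nat n powr (- Complex \<sigma> t))) \<le>
           (norm (Complex \<sigma> t) / N + 1/2 + N / t) * real N powr (- \<sigma>)"
proof -
  let ?s = "Complex \<sigma> t"
  have N: "N \<ge> 1" using assms by auto
  have "Im ?s \<le> 1 * real N" using assms by simp
  also have "\<dots> \<le> pi * real N" using pi_gt3 by (intro mult_right_mono) auto
  finally have tN: "Im ?s \<le> pi * real N" .
  have s1: "?s \<noteq> 1" using assms by (auto simp: complex_eq_iff)
  have "norm (zeta ?s - em N ?s) \<le> norm ?s * real N powr (- Re ?s - 1)"
    using assms s1 N tN by (intro zeta_minus_em_le) auto
  also have "\<dots> = norm ?s / N * real N powr (- \<sigma>)" using N by (simp add: powr_diff)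
  finally have 1: "norm (zeta ?s - em N ?s) \<le> norm ?s / N * real N powr (- \<sigma>)" .
  have n1: "norm (of_nat N powr (- ?s) / 2 :: complex) = 1/2 * real N powr (- \<sigma>)"
    using norm_powr_of_nonneg_real[of "real N" "- ?s"] by (simp add: norm_divide)
  have n2: "norm (of_nat N powr (1 - ?s) / (1 - ?s)) \<le> N / t * real N powr (- \<sigma>)"
  proof -
    have e: "norm (of_nat N powr (1 - ?s) :: complex) = real N * real N powr (- \<sigma>)"
      using norm_powr_of_nonneg_real[of "real N" "1 - ?s"] N powr_add[of "real N" 1 "- \<sigma>"] by simp
    have "norm (1 - ?s) \<ge> t" using abs_Im_le_cmod[of "1 - ?s"] assms by simp
    then have "real N * real N powr (- \<sigma>) / norm (1 - ?s) \<le> real N * real N powr (- \<sigma>) / t"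
      using assms by (intro divide_left_mono) (auto intro!: mult_pos_pos)
    then show ?thesis unfolding norm_divide e by simp
  qed
  have "zeta ?s - (\<Sum>n=1..N. of_nat n powr (- ?s)) = (zeta ?s - em N ?s) - (of_nat N powr (- ?s) / 2 + of_nat N powr (1 - ?s) / (1 - ?s))"
    by (simp add: em_def)
  also have "norm \<dots> \<le> norm (zeta ?s - em N ?s) + norm (of_nat N powr (- ?s) / 2 + of_nat N powr (1 - ?s) / (1 - ?s))"
    by (rule norm_triangle_ineq4)
  also have "\<dots> \<le> norm ?s / N * real N powr (- \<sigma>) + (1/2 * real N powr (- \<sigma>) + N / t * real N powr (- \<sigma>))"
    using n1 n2 norm_triangle_ineq[of "of_nat N powr (- ?s) / 2" "of_nat N powr (1 - ?s) / (1 - ?s)"]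
    by (intro add_mono 1) linarith
  finally show ?thesis by (simp add: distrib_right)
qed

lemma norm_dirichlet_sum_le:
  assumes "\<And>n. n \<in> S \<Longrightarrow> a n \<ge> 0 \<and> a n \<le> b n"
  shows "norm (\<Sum>n\<in>S. of_real (a n) * cis (\<theta> n)) \<le> (\<Sum>n\<in>S. b n)"
  using assms by (intro sum_norm_le) (auto simp: norm_mult)

text \<open>Squaring the approximation \<open>A + w * D\<close> directly would pair \<open>A\<close>
  with the oscillating \<open>w = chi\<close>. Expanding around \<open>A\<close> leaves the cross
  term \<open>z * cnj A\<close> instead, in which \<open>z\<close> may be replaced by the long
  polynomial \<open>P\<close>; \<open>w\<close> then enters only through its modulus 1.\<close>

lemma norm_square_expansion:
  fixes z A P D E w :: complex
  assumes "z - A = w * D + E" "norm w = 1"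
  shows "\<bar>(norm z)\<^sup>2 - Re (D * cnj D + 2 * (P * cnj A) - A * cnj A)\<bar> \<le> 2 * norm (z - P) * norm A + 2 * norm D * norm E + (norm E)\<^sup>2"
proof -
  have 1: "(norm z)\<^sup>2 = (norm (z - A))\<^sup>2 + 2 * Re (z * cnj A) - Re (A * cnj A)"
    unfolding cmod_power2 by (simp add: power2_eq_square algebra_simps)
  have 2: "(norm (z - A))\<^sup>2 = Re (D * cnj D) + 2 * Re (w * D * cnj E) + (norm E)\<^sup>2"
  proof -
    have "(norm (z - A))\<^sup>2 = (norm (w * D))\<^sup>2 + 2 * Re (w * D * cnj E) + (norm E)\<^sup>2"
      unfolding assms(1) cmod_power2 by (simp add: power2_eq_square algebra_simps)
    moreover have "(norm (w * D))\<^sup>2 = Re (D * cnj D)"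
      using assms(2) by (simp add: norm_mult complex_norm_square[symmetric] power_mult_distrib cmod_power2 power2_eq_square)
    ultimately show ?thesis by simp
  qed
  have "(norm z)\<^sup>2 - Re (D * cnj D + 2 * (P * cnj A) - A * cnj A) = 2 * Re ((z - P) * cnj A) + 2 * Re (w * D * cnj E) + (norm E)\<^sup>2"
    unfolding 1 2 by (simp add: algebra_simps)
  moreover have "\<bar>Re ((z - P) * cnj A)\<bar> \<le> norm (z - P) * norm A"
    using abs_Re_le_cmod[of "(z - P) * cnj A"] by (simp add: norm_mult)
  moreover have "\<bar>Re (w * D * cnj E)\<bar> \<le> norm D * norm E"
    using abs_Re_le_cmod[of "w * D * cnj E"] assms(2) by (simp add: norm_mult)
  moreover have "(norm E)\<^sup>2 \<ge> 0" by simp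
  ultimately show ?thesis by linarith
qed

lemma integral_inverse_le_ln:
  fixes a b :: real
  assumes "1 \<le> a" "a \<le> b"
  shows "(\<lambda>t. 1 / t) integrable_on {a..b}" "integral {a..b} (\<lambda>t. 1 / t) \<le> ln b"
proof -
  have "((\<lambda>t. 1 / t) has_integral (ln b - ln a)) {a..b}"
  proof (rule fundamental_theorem_of_calculus)
    fix t assume "t \<in> {a..b}"
    then have "(ln has_real_derivative 1 / t) (at t within {a..b})"
      using assms by (auto intro!: derivative_eq_intros)
    then show "(ln has_vector_derivative 1 / t) (at t within {a..b})"
      by (simp add: has_real_derivative_iff_has_vector_derivative)
  qed (use assms in auto)
  then show "(\<lambda>t. 1 / t) integrable_on {a..b}" "integral {a..b} (\<lambda>t. 1 / t) \<le> ln b"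
    using assms by (auto simp: has_integral_iff)
qed

lemma integral_inverse_sqrt_le:
  assumes "1 \<le> a" "a \<le> b"
  shows "(\<lambda>t. 1 / sqrt t) integrable_on {a..b}" "integral {a..b} (\<lambda>t. 1 / sqrt t) \<le> 2 * sqrt b"
proof -
  have "((\<lambda>t. 1 / sqrt t) has_integral (2 * sqrt b - 2 * sqrt a)) {a..b}"
    using assms by (intro fundamental_theorem_of_calculus)
      (auto intro!: derivative_eq_intros simp: has_real_derivative_iff_has_vector_derivative[symmetric] field_simps)
  then show "(\<lambda>t. 1 / sqrt t) integrable_on {a..b}" "integral {a..b} (\<lambda>t. 1 / sqrt t) \<le> 2 * sqrt b"
    using assms by (auto simp: has_integral_iff)
qed

lemma sum_inverse_sqrt_le: "(\<Sum>n=1..N. real n powr (- (1/2))) \<le> 2 * sqrt N"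
  using sum_powr_le[of "1/2" N] by (simp add: powr_half_sqrt)

lemma powr_half_product: "n \<ge> 1 \<Longrightarrow> real n powr (- (1/2)) * real n powr (- (1/2)) = 1 / n"
  by (simp add: powr_minus powr_half_sqrt field_simps)

lemma offdiagonal_half_le:
  assumes "X \<le> N" "1 \<le> N"
  shows "(\<Sum>n=1..X. \<Sum>m\<in>{1..N} - {n}. 2 * (real m powr (- (1/2)) * real n powr (- (1/2))) / \<bar>ln (real m / real n)\<bar>)
     \<le> 8 * sqrt X * sqrt N + 4 * (1 + ln (real N)) * X"
proof -
  have "(\<Sum>n=1..X. \<Sum>m\<in>{1..N} - {n}. 2 * (real m powr (- (1/2)) * real n powr (- (1/2))) / \<bar>ln (real m / real n)\<bar>)
     \<le> 2 * (\<Sum>n=1..X. real n powr (- (1/2))) * (\<Sum>m=1..N. real m powr (- (1/2))) + 4 * (1 + ln (real N)) * (\<Sum>n=1..X. real n powr (1 - 2 * (1/2)))"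
    using assms by (intro offdiagonal_sum_le) auto
  also have "\<dots> \<le> 2 * (2 * sqrt X) * (2 * sqrt N) + 4 * (1 + ln (real N)) * X"
    using assms by (intro add_mono mult_mono mult_left_mono sum_inverse_sqrt_le sum_nonneg mult_nonneg_nonneg) auto
  finally show ?thesis by simp
qed

text \<open>\<open>c\<close> is the spacing of the heights at which \<open>A\<close> gains a term,
  \<open>X\<close> the length of \<open>A\<close> at height \<open>T\<close>, and \<open>M\<close>
  the length of the long polynomial. The dual sum contributes \<open>T H_j\<close>; the products
  with \<open>A\<close>, twice with plus and once with minus, contribute \<open>T H_X - T\<close>.
  Above \<open>T1\<close> the quotient \<open>t / c\<close> is at least
  \<open>8 * (j + 1/2) + 1\<close>, so rounding it down to \<open>N\<close> raises
  \<open>t / (2 \<pi> N)\<close> above \<open>j + 1/2\<close> by at most 1/8. \<open>j\<close> stays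
  free here and is tied to \<open>T\<close> afterwards.\<close>

lemma critical_mean_square_error:
  fixes T :: real and j :: nat
  defines "c \<equiv> 2 * pi * (real j + 1/2)" 
  defines "T1 \<equiv> c * (8 * (real j + 1/2) + 1)" and "X \<equiv> nat \<lfloor>T / c\<rfloor>" and "M \<equiv> nat \<lceil>T\<rceil>"
    and "e \<equiv> 16 * (real j + 1)\<^sup>2 * sqrt (2 * c)"
  assumes j: "j \<ge> 1" and T: "T \<ge> T1"
  shows "\<bar>integral {T1..T} (\<lambda>t. (norm (zeta (Complex (1/2) t)))\<^sup>2) - T * (harm X + harm j - 1)\<bar> \<le>
     T1 * harm j + T1 * harm X + c + (8 * j + 4 * (1 + ln j) * j) + 2 * (8 * sqrt X * sqrt M + 4 * (1 + ln M) * X)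
     + (8 * X + 4 * (1 + ln X) * X) + (16 * sqrt M * sqrt X + e\<^sup>2) * ln T + 8 * sqrt j * e * sqrt T"
proof -
  define \<kappa> where "\<kappa> = real j + 1/2"
  have \<kappa>: "\<kappa> \<ge> 3/2" using j by (simp add: \<kappa>_def)
  have c\<kappa>: "c = 2 * pi * \<kappa>" by (simp add: c_def \<kappa>_def)
  have c1: "c \<ge> 9" 
  proof -
    have "2 * 3 * (3/2) \<le> 2 * pi * \<kappa>" using \<kappa> pi_gt3 by (intro mult_mono) auto
    then show ?thesis by (simp add: c\<kappa>)
  qed
  have T1\<kappa>: "T1 = c * (8 * \<kappa> + 1)" by (simp add: T1_def \<kappa>_def)
  have T1c: "T1 \<ge> c * 13" unfolding T1\<kappa> using c1 \<kappa> by (intro mult_left_mono) auto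
  have T11: "T1 \<ge> 1" using T1c c1 by linarith
  have Xle: "real X \<le> T / c" using T11 T c1 by (simp add: X_def)
  have X1: "X \<ge> 1"
  proof -
    have "13 \<le> T / c" using T1c T c1 by (simp add: field_simps)
    then have "1 \<le> \<lfloor>T / c\<rfloor>" by linarith
    then show ?thesis unfolding X_def by linarith
  qed
  have MT: "T \<le> real M" "M \<ge> 1" unfolding M_def using T T11 by linarith+
  have XM: "X \<le> M"
  proof -
    have "T / c \<le> T" using c1 T11 T by (simp add: field_simps)
    then have "real X \<le> real M" using Xle MT by linarith
    then show ?thesis by simp
  qed
  define \<alpha> where "\<alpha> = (\<lambda>n::nat. real n powr (- (1/2)))"
  have \<alpha>0: "\<alpha> n \<ge> 0" for n by (simp add: \<alpha>_def)
  \<comment> \<open>Term \<open>n\<close> of \<open>A\<close> is switched on at height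
    \<open>c * n\<close>, or at \<open>T1\<close> if that is later.\<close>
  define cn where "cn = (\<lambda>n::nat. max T1 (c * n))"
  define P where "P = (\<lambda>t. \<Sum>m\<in>{1..M}. of_real (if T1 \<le> t then \<alpha> m else 0) * cis (- (t * ln (real m))))"
  define A where "A = (\<lambda>t. \<Sum>n\<in>{1..X}. of_real (if cn n \<le> t then \<alpha> n else 0) * cis (- (t * ln (real n))))"
  define D where "D = (\<lambda>t. \<Sum>k\<in>{1..j}. of_real (if T1 \<le> t then \<alpha> k else 0) * cis (- (t * ln (real k))))"
  define z where "z = (\<lambda>t. zeta (Complex (1/2) t))"
  define diag where "diag = (\<Sum>n=1..X. \<alpha> n * \<alpha> n * (T - max (cn n) T1))"
  define offJ offXM offX where "offJ = 8 * real j + 4 * (1 + ln j) * j" 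
    and "offXM = 8 * sqrt X * sqrt M + 4 * (1 + ln M) * X" and "offX = 8 * real X + 4 * (1 + ln X) * X"
  have cnT: "cn n \<le> T" if "n \<in> {1..X}" for n
  proof -
    have "c * real n \<le> c * (T / c)" using that Xle c1 by (intro mult_left_mono) auto
    then show ?thesis using T c1 by (simp add: cn_def)
  qed
  have cnT1: "T1 \<le> cn n" for n by (simp add: cn_def)
  note mv = dirichlet_polynomial_mean_product[OF _ _ _ _ T]
  have iPA: "(\<lambda>t. P t * cnj (A t)) integrable_on {T1..T}" and
    PA: "norm (integral {T1..T} (\<lambda>t. P t * cnj (A t)) - of_real diag) \<le> offXM"
  proof -
    show "(\<lambda>t. P t * cnj (A t)) integrable_on {T1..T}"
      unfolding P_def A_def by (rule mv(1)) (use XM \<alpha>0 T cnT cnT1 in auto)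
    have "norm (integral {T1..T} (\<lambda>t. P t * cnj (A t)) - of_real diag) \<le> (\<Sum>n=1..X. \<Sum>m\<in>{1..M} - {n}. 2 * (\<alpha> m * \<alpha> n) / \<bar>ln (real m / real n)\<bar>)"
      unfolding P_def A_def diag_def by (rule mv(2)) (use XM \<alpha>0 T cnT cnT1 in auto)
    also have "\<dots> \<le> offXM" unfolding offXM_def \<alpha>_def using XM MT by (intro offdiagonal_half_le) auto
    finally show "norm (integral {T1..T} (\<lambda>t. P t * cnj (A t)) - of_real diag) \<le> offXM" .
  qed
  have iAA: "(\<lambda>t. A t * cnj (A t)) integrable_on {T1..T}" and
    AA: "norm (integral {T1..T} (\<lambda>t. A t * cnj (A t)) - of_real diag) \<le> offX"
  proof -
    show "(\<lambda>t. A t * cnj (A t)) integrable_on {T1..T}"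
      unfolding A_def by (rule mv(1)) (use \<alpha>0 T cnT cnT1 in auto)
    have "norm (integral {T1..T} (\<lambda>t. A t * cnj (A t)) - of_real (\<Sum>n=1..X. \<alpha> n * \<alpha> n * (T - max (cn n) (cn n)))) \<le> (\<Sum>n=1..X. \<Sum>m\<in>{1..X} - {n}. 2 * (\<alpha> m * \<alpha> n) / \<bar>ln (real m / real n)\<bar>)"
      unfolding A_def by (rule mv(2)) (use \<alpha>0 T cnT cnT1 in auto)
    also have "(\<Sum>n=1..X. \<alpha> n * \<alpha> n * (T - max (cn n) (cn n))) = diag"
      unfolding diag_def by (simp add: cn_def)
    also have "(\<Sum>n=1..X. \<Sum>m\<in>{1..X} - {n}. 2 * (\<alpha> m * \<alpha> n) / \<bar>ln (real m / real n)\<bar>) \<le> 8 * sqrt X * sqrt X + 4 * (1 + ln (real X)) * X"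
      unfolding \<alpha>_def using X1 by (intro offdiagonal_half_le) auto
    also have "\<dots> = offX" by (simp add: offX_def)
    finally show "norm (integral {T1..T} (\<lambda>t. A t * cnj (A t)) - of_real diag) \<le> offX" .
  qed
  have iDD: "(\<lambda>t. D t * cnj (D t)) integrable_on {T1..T}" and
    DD: "norm (integral {T1..T} (\<lambda>t. D t * cnj (D t)) - of_real ((T - T1) * harm j)) \<le> offJ"
  proof -
    show "(\<lambda>t. D t * cnj (D t)) integrable_on {T1..T}"
      unfolding D_def by (rule mv(1)) (use \<alpha>0 T in auto)
    have "norm (integral {T1..T} (\<lambda>t. D t * cnj (D t)) - of_real (\<Sum>n=1..j. \<alpha> n * \<alpha> n * (T - max T1 T1))) \<le> (\<Sum>n=1..j. \<Sum>m\<in>{1..j} - {n}. 2 * (\<alpha> m * \<alpha> n) / \<bar>ln (real m / real n)\<bar>)"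
      unfolding D_def by (rule mv(2)) (use \<alpha>0 T in auto)
    also have "(\<Sum>n=1..j. \<alpha> n * \<alpha> n * (T - max T1 T1)) = (T - T1) * harm j"
      unfolding harm_def sum_distrib_left \<alpha>_def by (intro sum.cong refl) (simp add: powr_half_product field_simps)
    also have "(\<Sum>n=1..j. \<Sum>m\<in>{1..j} - {n}. 2 * (\<alpha> m * \<alpha> n) / \<bar>ln (real m / real n)\<bar>) \<le> 8 * sqrt j * sqrt j + 4 * (1 + ln (real j)) * j"
      unfolding \<alpha>_def using j by (intro offdiagonal_half_le) auto
    also have "\<dots> = offJ" by (simp add: offJ_def)
    finally show "norm (integral {T1..T} (\<lambda>t. D t * cnj (D t)) - of_real ((T - T1) * harm j)) \<le> offJ" .
  qed
  \<comment> \<open>Entering at about \<open>c * n\<close> costs each of the \<open>X\<close> terms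
    about \<open>c\<close> after division by \<open>n\<close>; as \<open>c * X\<close> is
    \<open>T\<close> up to \<open>c\<close>, this is the \<open>- T\<close> of the main term. Terms
    that enter at \<open>T1\<close> instead account for the error
    \<open>T1 * harm X\<close>.\<close>
  have diag: "\<bar>diag - (T * harm X - T)\<bar> \<le> T1 * harm X + c"
  proof -
    have "diag = (\<Sum>n=1..X. T * inverse (real n) - cn n * inverse (real n))"
      unfolding diag_def \<alpha>_def by (intro sum.cong refl) (auto simp: powr_half_product cn_def field_simps)
    also have "\<dots> = T * harm X - (\<Sum>n=1..X. cn n * inverse (real n))"
      by (simp add: sum_subtractf harm_def sum_distrib_left)
    finally have d: "diag = T * harm X - (\<Sum>n=1..X. cn n * inverse (real n))" .
    have "(\<Sum>n=1..X. cn n * inverse (real n)) \<ge> (\<Sum>n=1..X. c)"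
      by (intro sum_mono) (auto simp: cn_def field_simps)
    moreover have "(\<Sum>n=1..X. cn n * inverse (real n)) \<le> (\<Sum>n=1..X. c + T1 * inverse (real n))"
      using c1 T11 by (intro sum_mono) (auto simp: cn_def field_simps max_def)
    moreover have "(\<Sum>n=1..X. c + T1 * inverse (real n)) = c * X + T1 * harm X"
      by (simp add: sum.distrib harm_def sum_distrib_left)
    moreover have "c * X \<le> T" using Xle c1 by (simp add: field_simps)
    moreover have "T \<le> c * X + c"
    proof -
      have "T / c \<le> real X + 1" unfolding X_def using T T11 c1 by linarith
      then show ?thesis using c1 by (simp add: field_simps)
    qed
    moreover have "T1 * harm X \<ge> 0" using T11 harm_nonneg[of X, where 'a = real] by simp
    ultimately show ?thesis unfolding d using c1 by (simp add: abs_le_iff mult.commute)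
  qed
  have eq: "(\<Sum>n=1..M. of_nat n powr (- Complex (1/2) t)) = P t" if "t \<ge> T1" for t
    unfolding P_def using that by (intro sum.cong refl) (subst nat_powr_critical, auto simp: \<alpha>_def)
  have e0: "e \<ge> 0" unfolding e_def using c1 by simp
  have SA: "norm (A t) \<le> 2 * sqrt X" for t
  proof -
    have "norm (A t) \<le> (\<Sum>n\<in>{1..X}. \<alpha> n)" unfolding A_def using \<alpha>0 by (intro norm_dirichlet_sum_le) auto
    then show ?thesis using sum_inverse_sqrt_le[of X] unfolding \<alpha>_def by linarith
  qed
  have SD: "norm (D t) \<le> 2 * sqrt j" for t
  proof -
    have "norm (D t) \<le> (\<Sum>n\<in>{1..j}. \<alpha> n)" unfolding D_def using \<alpha>0 by (intro norm_dirichlet_sum_le) auto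
    then show ?thesis using sum_inverse_sqrt_le[of j] unfolding \<alpha>_def by linarith
  qed
  have zP: "norm (z t - P t) \<le> 4 * sqrt M / t" if t: "t \<in> {T1..T}" for t
  proof -
    have t1: "t \<ge> 1" "t \<le> M" using t T11 MT by auto
    have "norm (z t - P t) \<le> (norm (Complex (1/2) t) / M + 1/2 + M / t) * real M powr (- (1/2))"
      using zeta_minus_dirichlet_polynomial_le[of "1/2" t M] t t1 eq[of t] by (simp add: z_def)
    also have "\<dots> \<le> (4 * (M / t)) * real M powr (- (1/2))"
    proof (intro mult_right_mono)
      have "norm (Complex (1/2) t) \<le> 2 * t" using cmod_le[of "Complex (1/2) t"] t1 by simp
      then have "norm (Complex (1/2) t) / M \<le> 2" using t1 MT by (simp add: field_simps)
      moreover have "1 \<le> M / t" using t1 by simp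
      ultimately show "norm (Complex (1/2) t) / M + 1/2 + M / t \<le> 4 * (M / t)" by linarith
    qed simp
    also have "real M powr (- (1/2)) = 1 / sqrt M"
      using powr_half_sqrt[of "real M"] powr_minus_divide[of "real M" "1/2"] by simp
    also have "4 * (M / t) * (1 / sqrt M) = 4 * (M / sqrt M) / t" by simp
    also have "\<dots> = 4 * sqrt M / t" by (simp add: real_div_sqrt)
    finally show ?thesis .
  qed
  have AFE: "\<exists>E. z t - A t = chi (Complex (1/2) t) * cnj (D t) + E \<and> norm E \<le> e / sqrt t" if t: "t \<in> {T1..T}" for t
  proof -
    \<comment> \<open>The length of the first sum varies with \<open>t\<close>; the thresholds in
      \<open>A\<close> reproduce exactly this sum at every height.\<close>
    define N where "N = nat \<lfloor>t / c\<rfloor>"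
    have tc: "t / c \<ge> 8 * \<kappa> + 1" using t c1 unfolding T1\<kappa> by (simp add: field_simps)
    have N: "real N \<le> t / c" "t / c < real N + 1" unfolding N_def using tc \<kappa> by linarith+
    have N8: "real N \<ge> 8 * \<kappa>" using N tc by linarith
    have N1: "N \<ge> 1" using N8 \<kappa> by auto
    have NX: "N \<le> X"
    proof -
      have "t / c \<le> T / c" using t c1 by (intro divide_right_mono) auto
      then show ?thesis unfolding N_def X_def by (intro nat_mono floor_mono)
    qed
    let ?s = "Complex (1/2) t"
    have tN: "c * N \<le> t" "t \<le> c * N + c" using N c1 by (simp_all add: field_simps)
    have lo: "2 * pi * real N * (real j + 1/2) \<le> Im ?s" using tN by (simp add: c\<kappa> \<kappa>_def mult_ac)
    have hi: "Im ?s \<le> 2 * pi * real N * (real j + 5/8)"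
    proof -
      \<comment> \<open>\<open>N \<ge> 8 * \<kappa>\<close> turns the rounding error
        \<open>c\<close> into an eighth of \<open>2 * pi * N\<close>, which is the gap between
        \<open>j + 1/2\<close> and \<open>j + 5/8\<close>.\<close>
      have "c \<le> 2 * pi * (real N / 8)" unfolding c\<kappa> using N8 by (intro mult_left_mono) auto
      then have "t \<le> c * N + 2 * pi * (real N / 8)" using tN by linarith
      also have "\<dots> = 2 * pi * real N * (real j + 5/8)" by (simp add: c\<kappa> \<kappa>_def algebra_simps)
      finally show ?thesis by simp
    qed
    have A: "(\<Sum>n=1..N. of_nat n powr (- ?s)) = A t"
    proof -
      have "A t = (\<Sum>n\<in>{1..N}. of_real (if cn n \<le> t then \<alpha> n else 0) * cis (- (t * ln (real n))))"
        unfolding A_def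
      proof (rule sum.mono_neutral_right)
        show "\<forall>n\<in>{1..X} - {1..N}. of_real (if cn n \<le> t then \<alpha> n else 0) * cis (- (t * ln (real n))) = 0"
        proof
          fix n assume "n \<in> {1..X} - {1..N}"
          then have "real n \<ge> real N + 1" by auto
          then have "real n > t / c" using N by linarith
          then have "c * n > t" using c1 by (simp add: field_simps)
          then show "of_real (if cn n \<le> t then \<alpha> n else 0) * cis (- (t * ln (real n))) = 0" by (simp add: cn_def)
        qed
      qed (use NX in auto)
      also have "\<dots> = (\<Sum>n=1..N. of_nat n powr (- ?s))"
      proof (intro sum.cong refl)
        fix n assume n: "n \<in> {1..N}"
        have "c * n \<le> c * N" using n c1 by simp
        then have "cn n \<le> t" using tN t by (simp add: cn_def)
        then show "of_real (if cn n \<le> t then \<alpha> n else 0) * cis (- (t * ln (real n))) = of_nat n powr (- ?s)"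
          using n by (subst nat_powr_critical) (auto simp: \<alpha>_def)
      qed
      finally show ?thesis by simp
    qed
    \<comment> \<open>On the critical line \<open>k powr (s - 1)\<close> is the conjugate of
      \<open>k powr (- s)\<close>, so the dual sum is the conjugate of a polynomial of the same
      shape as \<open>A\<close>.\<close>
    have Dd: "(\<Sum>k=1..j. of_nat k powr (?s - 1)) = cnj (D t)"
    proof -
      have "of_nat k powr (?s - 1) = cnj (of_real (\<alpha> k) * cis (- (t * ln (real k))))" if "k \<ge> 1" for k
      proof -
        have "?s - 1 = cnj (- ?s)" by (simp add: complex_eq_iff)
        then have "of_nat k powr (?s - 1) = cnj (of_nat k powr (- ?s))" by (subst cnj_powr) auto
        then show ?thesis using that by (simp add: nat_powr_critical \<alpha>_def)
      qed
      then show ?thesis unfolding D_def cnj_sum using t by (intro sum.cong refl) auto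
    qed
    have "norm (z t - A t - chi ?s * cnj (D t)) \<le> 16 * (real j + 1)\<^sup>2 / sqrt N"
      using approximate_functional_equation[of ?s N j] N1 lo hi unfolding A Dd z_def by simp
    also have "\<dots> \<le> e / sqrt t"
    proof -
      have "t \<le> 2 * c * N"
      proof -
        have "c * 1 \<le> c * real N" using N1 c1 by (intro mult_left_mono) auto
        then show ?thesis using tN by simp
      qed
      then have "sqrt t \<le> sqrt (2 * c) * sqrt N" using real_sqrt_le_mono[of t "2 * c * N"] by (simp add: real_sqrt_mult)
      then have "(16 * (real j + 1)\<^sup>2) * sqrt t \<le> (16 * (real j + 1)\<^sup>2) * (sqrt (2 * c) * sqrt N)" by (intro mult_left_mono) auto
      then show ?thesis using N1 t T11 unfolding e_def by (simp add: field_simps)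
    qed
    finally show ?thesis by (intro exI[of _ "z t - A t - chi ?s * cnj (D t)"]) simp
  qed
  define g where "g = (\<lambda>t. D t * cnj (D t) + 2 * (P t * cnj (A t)) - A t * cnj (A t))"
  define J where "J = integral {T1..T} (\<lambda>t. D t * cnj (D t)) + 2 * integral {T1..T} (\<lambda>t. P t * cnj (A t)) - integral {T1..T} (\<lambda>t. A t * cnj (A t))"
  have gJ: "(g has_integral J) {T1..T}" unfolding g_def J_def
    by (intro has_integral_diff has_integral_add has_integral_mult_right integrable_integral iDD iPA iAA)
  \<comment> \<open>The replacement of zeta by \<open>P\<close> and the square of \<open>E\<close>
    cost order \<open>1 / t\<close>; the product of \<open>D\<close> and \<open>E\<close> costs
    order \<open>1 / sqrt t\<close>.\<close>
  define h where "h = (\<lambda>t. (16 * sqrt M * sqrt X + e\<^sup>2) * (1 / t) + 4 * sqrt j * e * (1 / sqrt t))"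
  have pt: "\<bar>(norm (z t))\<^sup>2 - Re (g t)\<bar> \<le> h t" if t: "t \<in> {T1..T}" for t
  proof -
    have t1: "t \<ge> 1" using t T11 by auto
    obtain E where E: "z t - A t = chi (Complex (1/2) t) * cnj (D t) + E" "norm E \<le> e / sqrt t"
      using AFE[OF t] by blast
    have "norm (chi (Complex (1/2) t)) = 1" by (intro norm_chi_critical) simp
    from norm_square_expansion[OF E(1) this, of "P t"]
    have "\<bar>(norm (z t))\<^sup>2 - Re (g t)\<bar> \<le> 2 * norm (z t - P t) * norm (A t) + 2 * norm (D t) * norm E + (norm E)\<^sup>2"
      unfolding g_def by (simp add: mult.commute)
    also have "\<dots> \<le> 2 * (4 * sqrt M / t) * (2 * sqrt X) + 2 * (2 * sqrt j) * (e / sqrt t) + (e / sqrt t)\<^sup>2"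
      using SA SD zP[OF t] E(2) t1 by (intro add_mono mult_mono mult_left_mono power_mono mult_nonneg_nonneg) auto
    also have "\<dots> = h t" using t1 unfolding h_def by (simp add: power_divide field_simps)
    finally show ?thesis .
  qed
  have iz: "(\<lambda>t. (norm (z t))\<^sup>2) integrable_on {T1..T}"
    unfolding z_def by (intro integrable_continuous_real continuous_intros zeta_line_continuous) auto
  have gR: "((\<lambda>t. Re (g t)) has_integral Re J) {T1..T}" using gJ by (rule has_integral_Re)
  have ih: "h integrable_on {T1..T}" and hle: "integral {T1..T} h \<le> (16 * sqrt M * sqrt X + e\<^sup>2) * ln T + 8 * sqrt j * e * sqrt T"
  proof -
    note i1 = integral_inverse_le_ln[OF T11 T] and i2 = integral_inverse_sqrt_le[OF T11 T]
    have hi: "(h has_integral (16 * sqrt M * sqrt X + e\<^sup>2) * integral {T1..T} (\<lambda>t. 1 / t) + 4 * sqrt j * e * integral {T1..T} (\<lambda>t. 1 / sqrt t)) {T1..T}"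
      unfolding h_def by (intro has_integral_add has_integral_mult_right integrable_integral i1(1) i2(1))
    then show "h integrable_on {T1..T}" by blast
    have "integral {T1..T} h = (16 * sqrt M * sqrt X + e\<^sup>2) * integral {T1..T} (\<lambda>t. 1 / t) + 4 * sqrt j * e * integral {T1..T} (\<lambda>t. 1 / sqrt t)"
      using hi by (rule integral_unique)
    also have "\<dots> \<le> (16 * sqrt M * sqrt X + e\<^sup>2) * ln T + 4 * sqrt j * e * (2 * sqrt T)"
      using e0 i1(2) i2(2) by (intro add_mono mult_left_mono) auto
    finally show "integral {T1..T} h \<le> (16 * sqrt M * sqrt X + e\<^sup>2) * ln T + 8 * sqrt j * e * sqrt T" by simp
  qed
  have "integral {T1..T} (\<lambda>t. (norm (z t))\<^sup>2) - Re J = integral {T1..T} (\<lambda>t. (norm (z t))\<^sup>2 - Re (g t))"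
    using integral_unique[OF gR] iz gR by (subst integral_diff) auto
  also have "norm \<dots> \<le> integral {T1..T} h"
    using pt iz gR ih by (intro integral_norm_bound_integral integrable_diff) auto
  finally have main: "\<bar>integral {T1..T} (\<lambda>t. (norm (z t))\<^sup>2) - Re J\<bar> \<le> (16 * sqrt M * sqrt X + e\<^sup>2) * ln T + 8 * sqrt j * e * sqrt T"
    using hle by simp
  have re: "\<bar>Re w - r\<bar> \<le> norm (w - of_real r)" for w r
    using abs_Re_le_cmod[of "w - of_real r"] by simp
  have "Re J = Re (integral {T1..T} (\<lambda>t. D t * cnj (D t))) + 2 * Re (integral {T1..T} (\<lambda>t. P t * cnj (A t))) - Re (integral {T1..T} (\<lambda>t. A t * cnj (A t)))"
    unfolding J_def by simp
  moreover have "\<bar>Re (integral {T1..T} (\<lambda>t. D t * cnj (D t))) - (T - T1) * harm j\<bar> \<le> offJ"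
    using re DD order_trans by blast
  moreover have "\<bar>Re (integral {T1..T} (\<lambda>t. P t * cnj (A t))) - diag\<bar> \<le> offXM"
    using re PA order_trans by blast
  moreover have "\<bar>Re (integral {T1..T} (\<lambda>t. A t * cnj (A t))) - diag\<bar> \<le> offX"
    using re AA order_trans by blast
  ultimately have J: "\<bar>Re J - (T * harm j - T1 * harm j + diag)\<bar> \<le> offJ + 2 * offXM + offX"
    unfolding left_diff_distrib by linarith
  have comb: "\<bar>I - r\<bar> \<le> H \<Longrightarrow> \<bar>r - (u - v + d)\<bar> \<le> e1 \<Longrightarrow> \<bar>d - (x - T)\<bar> \<le> e2 \<Longrightarrow> v \<ge> 0 \<Longrightarrow>
      \<bar>I - (x + u - T)\<bar> \<le> v + e2 + e1 + H" for I r H u v d e1 e2 x :: real by linarith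
  have "T1 * harm j \<ge> 0" using T11 harm_nonneg[of j, where 'a = real] by simp
  from comb[OF main J diag this]
  have "\<bar>integral {T1..T} (\<lambda>t. (norm (z t))\<^sup>2) - T * (harm X + harm j - 1)\<bar> \<le>
     T1 * harm j + (T1 * harm X + c) + (offJ + 2 * offXM + offX) + ((16 * sqrt M * sqrt X + e\<^sup>2) * ln T + 8 * sqrt j * e * sqrt T)"
    by (simp only: distrib_left right_diff_distrib mult_1_right)
  then show ?thesis unfolding z_def offJ_def offXM_def offX_def by (simp only: add.assoc)
qed

text \<open>A crude bound from a polynomial of length about \<open>t\<close>. It covers the stretch
  below \<open>T1\<close>, which is no longer than a power of \<open>ln T\<close>, and the
  truncation of the damped integral.\<close>

lemma norm_zeta_critical_le:
  assumes "t \<ge> 1"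
  shows "(norm (zeta (Complex (1/2) t)))\<^sup>2 \<le> 36 * (t + 1)"
proof -
  define N where "N = nat \<lceil>t\<rceil>"
  have N: "t \<le> real N" "real N \<le> t + 1" "N \<ge> 1" unfolding N_def using assms by linarith+
  let ?P = "\<Sum>n=1..N. of_nat n powr (- Complex (1/2) t) :: complex"
  have r: "real N powr (- (1/2)) = 1 / sqrt N"
    using powr_half_sqrt[of "real N"] powr_minus_divide[of "real N" "1/2"] by simp
  have "norm (zeta (Complex (1/2) t) - ?P) \<le> (norm (Complex (1/2) t) / N + 1/2 + N / t) * real N powr (- (1/2))"
    using assms N by (intro zeta_minus_dirichlet_polynomial_le) auto
  also have "\<dots> \<le> 4 * real N powr (- (1/2))"
  proof (intro mult_right_mono)
    have "norm (Complex (1/2) t) \<le> 3/2 * t" using cmod_le[of "Complex (1/2) t"] assms by simp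
    then have "norm (Complex (1/2) t) / N \<le> 3/2" using assms N by (simp add: field_simps)
    moreover have "N / t \<le> 2" using N assms by (simp add: field_simps)
    ultimately show "norm (Complex (1/2) t) / N + 1/2 + N / t \<le> 4" by linarith
  qed simp
  also have "\<dots> \<le> 4 * sqrt N"
  proof -
    have "sqrt N \<ge> 1" using N by simp
    then have "1 / sqrt N \<le> 1 / 1" by (intro divide_left_mono) auto
    then show ?thesis unfolding r using \<open>sqrt N \<ge> 1\<close> by linarith
  qed
  finally have 1: "norm (zeta (Complex (1/2) t) - ?P) \<le> 4 * sqrt N" .
  have "norm ?P \<le> (\<Sum>n=1..N. real n powr (- (1/2)))"
    by (intro sum_norm_le) (auto simp: nat_powr_critical norm_mult)
  also have "\<dots> \<le> 2 * sqrt N" by (rule sum_inverse_sqrt_le)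
  finally have "norm (zeta (Complex (1/2) t)) \<le> 6 * sqrt N"
    using 1 norm_triangle_ineq[of "zeta (Complex (1/2) t) - ?P" ?P] by simp
  then have "(norm (zeta (Complex (1/2) t)))\<^sup>2 \<le> (6 * sqrt N)\<^sup>2" by (intro power_mono) auto
  then show ?thesis using N by (simp add: power_mult_distrib)
qed

section \<open>The energy function and its two-term asymptotics\<close>

definition zeta_energy :: "real \<Rightarrow> real" where
  "zeta_energy T = integral {0..T} (\<lambda>t. (norm (zeta (Complex (1/2) t)))\<^sup>2)"

lemma zeta_square_integrable: "(\<lambda>t. (norm (zeta (Complex (1/2) t)))\<^sup>2) integrable_on {a..b}"
  by (intro integrable_continuous_real continuous_intros zeta_line_continuous) auto

lemma zeta_energy_combine:
  assumes "0 \<le> a" "a \<le> b"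
  shows "zeta_energy b = zeta_energy a + integral {a..b} (\<lambda>t. (norm (zeta (Complex (1/2) t)))\<^sup>2)"
  unfolding zeta_energy_def using assms
  by (intro Henstock_Kurzweil_Integration.integral_combine[symmetric] zeta_square_integrable)

lemma zeta_energy_le:
  assumes "T \<ge> 1"
  shows "zeta_energy T \<le> zeta_energy 1 + 36 * (T + 1) * T"
proof -
  have "integral {1..T} (\<lambda>t. (norm (zeta (Complex (1/2) t)))\<^sup>2) \<le> integral {1..T} (\<lambda>_. 36 * (T + 1))"
  proof (intro integral_le zeta_square_integrable)
    fix t assume "t \<in> {1..T}"
    then show "(norm (zeta (Complex (1/2) t)))\<^sup>2 \<le> 36 * (T + 1)"
      using norm_zeta_critical_le[of t] by auto
  qed auto
  also have "\<dots> = 36 * (T + 1) * (T - 1)" using assms by simp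
  also have "\<dots> \<le> 36 * (T + 1) * T" using assms by (intro mult_left_mono) auto
  finally show ?thesis using zeta_energy_combine[of 1 T] assms by simp
qed

lemma zeta_energy_nonneg: "zeta_energy T \<ge> 0"
  unfolding zeta_energy_def by (intro integral_nonneg zeta_square_integrable) auto

text \<open>The number of frequencies on the dual side of the approximate functional equation: any power of
  \<open>ln T\<close> above the second makes the off-diagonal terms negligible.\<close>

definition freq :: "real \<Rightarrow> nat" where "freq T = nat \<lceil>(ln T) ^ 4\<rceil>"
text \<open>\<open>slope T\<close> and \<open>cutoff T\<close> are the \<open>c\<close> and
  \<open>X\<close> of the error estimate for \<open>j = freq T\<close>.\<close>

definition slope :: "real \<Rightarrow> real" where "slope T = 2 * pi * (real (freq T) + 1/2)"
definition cutoff :: "real \<Rightarrow> nat" where "cutoff T = nat \<lfloor>T / slope T\<rfloor>"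

lemma freq_bounds: "(ln T) ^ 4 \<le> real (freq T)" "real (freq T) \<le> (ln T) ^ 4 + 1"
proof -
  have "0 \<le> (ln T) ^ 4" by simp
  then show "(ln T) ^ 4 \<le> real (freq T)" "real (freq T) \<le> (ln T) ^ 4 + 1"
    unfolding freq_def by linarith+
qed

lemma slope_bounds: "6 * (ln T) ^ 4 \<le> slope T" "slope T \<le> 7 * ((ln T) ^ 4 + 2)" "slope T > 0"
proof -
  have "2 * 3 * (ln T) ^ 4 \<le> 2 * pi * (real (freq T) + 1/2)"
    using freq_bounds(1)[of T] pi_gt3 by (intro mult_mono) auto
  then show "6 * (ln T) ^ 4 \<le> slope T" by (simp add: slope_def)
  have "2 * pi * (real (freq T) + 1/2) \<le> 2 * (7/2) * ((ln T) ^ 4 + 2)"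
    using freq_bounds(2)[of T] pi_approx by (intro mult_mono) auto
  then show "slope T \<le> 7 * ((ln T) ^ 4 + 2)" by (simp add: slope_def)
  show "slope T > 0" unfolding slope_def by (intro mult_pos_pos) auto
qed

lemma freq_at_top: "filterlim freq sequentially at_top"
proof -
  have "filterlim (\<lambda>T::real. (ln T) ^ 4) at_top at_top" by real_asymp
  then have "filterlim (\<lambda>T. real (freq T)) at_top at_top"
    by (rule filterlim_at_top_mono) (intro always_eventually allI freq_bounds)
  then show ?thesis by (simp add: filterlim_sequentially_iff_filterlim_real)
qed

lemma cutoff_bounds:
  assumes "T \<ge> 0"
  shows "real (cutoff T) \<le> T / slope T" "T / slope T \<le> real (cutoff T) + 1"
proof -
  have "T / slope T \<ge> 0" using assms slope_bounds(3)[of T] by simp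
  then show "real (cutoff T) \<le> T / slope T" "T / slope T \<le> real (cutoff T) + 1"
    unfolding cutoff_def by linarith+
qed

lemma cutoff_at_top: "filterlim cutoff sequentially at_top"
proof -
  have "filterlim (\<lambda>T::real. T / (7 * ((ln T) ^ 4 + 2)) - 1) at_top at_top" by real_asymp
  moreover have "\<forall>\<^sub>F T in at_top. T / (7 * ((ln T) ^ 4 + 2)) - 1 \<le> real (cutoff T)"
    using eventually_ge_at_top[of 0]
  proof eventually_elim
    case (elim T)
    have "T / (7 * ((ln T) ^ 4 + 2)) \<le> T / slope T"
      using elim slope_bounds[of T] by (intro divide_left_mono mult_pos_pos) (auto intro: add_nonneg_pos)
    then show ?case using cutoff_bounds[OF elim] by linarith
  qed
  ultimately have "filterlim (\<lambda>T. real (cutoff T)) at_top at_top"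
    by (rule filterlim_at_top_mono)
  then show ?thesis by (simp add: filterlim_sequentially_iff_filterlim_real)
qed

text \<open>With \<open>X\<close> about \<open>T / slope T\<close> and \<open>slope T\<close> about
  \<open>2 \<pi> j\<close>, the sum \<open>ln X + ln j\<close> is \<open>ln T - ln (2 \<pi>)\<close>
  up to \<open>o(1)\<close>. So \<open>j\<close> drops out, and each harmonic number leaves one
  Euler constant.\<close>

lemma harm_main_term:
  "((\<lambda>T. harm (cutoff T) + harm (freq T) - 1 - ln T) \<longlongrightarrow> 2 * euler_mascheroni - ln (2 * pi) - 1) at_top"
proof -
  have 1: "((\<lambda>T. harm (cutoff T) - ln (real (cutoff T))) \<longlongrightarrow> (euler_mascheroni :: real)) at_top"
    using filterlim_compose[OF euler_mascheroni_LIMSEQ cutoff_at_top] by simp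
  have 2: "((\<lambda>T. harm (freq T) - ln (real (freq T))) \<longlongrightarrow> (euler_mascheroni :: real)) at_top"
    using filterlim_compose[OF euler_mascheroni_LIMSEQ freq_at_top] by simp
  have 3: "((\<lambda>T. real (cutoff T) * slope T / T) \<longlongrightarrow> 1) at_top"
  proof (rule tendsto_sandwich)
    show "((\<lambda>T::real. 1 - 7 * ((ln T) ^ 4 + 2) / T) \<longlongrightarrow> 1) at_top" by real_asymp
    show "((\<lambda>T::real. 1) \<longlongrightarrow> 1) at_top" by simp
    show "\<forall>\<^sub>F T in at_top. 1 - 7 * ((ln T) ^ 4 + 2) / T \<le> real (cutoff T) * slope T / T"
      using eventually_gt_at_top[of 0]
    proof eventually_elim
      case (elim T)
      have "T \<le> (real (cutoff T) + 1) * slope T"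
        using cutoff_bounds(2)[of T] elim slope_bounds(3)[of T] by (simp add: pos_divide_le_eq)
      then have "T - 7 * ((ln T) ^ 4 + 2) \<le> real (cutoff T) * slope T"
        using slope_bounds(2)[of T] by (simp add: distrib_right)
      then have "(T - 7 * ((ln T) ^ 4 + 2)) / T \<le> real (cutoff T) * slope T / T"
        using elim by (intro divide_right_mono) auto
      then show ?case using elim by (simp add: diff_divide_distrib)
    qed
    show "\<forall>\<^sub>F T in at_top. real (cutoff T) * slope T / T \<le> 1"
      using eventually_gt_at_top[of 0]
    proof eventually_elim
      case (elim T)
      then show ?case using cutoff_bounds(1)[of T] slope_bounds(3)[of T] by (simp add: field_simps)
    qed
  qed
  have 4: "((\<lambda>T. slope T / real (freq T)) \<longlongrightarrow> 2 * pi) at_top"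
  proof -
    have "(\<lambda>n. 2 * pi * (real n + 1/2) / real n) \<longlonglongrightarrow> 2 * pi" by real_asymp
    then show ?thesis unfolding slope_def using filterlim_compose freq_at_top by blast
  qed
  have "((\<lambda>T. (harm (cutoff T) - ln (real (cutoff T))) + (harm (freq T) - ln (real (freq T))) + ln (real (cutoff T) * slope T / T) - ln (slope T / real (freq T)) - 1)
     \<longlongrightarrow> euler_mascheroni + euler_mascheroni + ln 1 - ln (2 * pi) - 1) at_top"
    by (intro tendsto_intros 1 2 3 4) auto
  moreover have "\<forall>\<^sub>F T in at_top. (harm (cutoff T) - ln (real (cutoff T))) + (harm (freq T) - ln (real (freq T))) + ln (real (cutoff T) * slope T / T) - ln (slope T / real (freq T)) - 1
     = harm (cutoff T) + harm (freq T) - 1 - ln T"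
  proof -
    have "\<forall>\<^sub>F T in at_top. cutoff T \<ge> 1" "\<forall>\<^sub>F T in at_top. freq T \<ge> 1"
      using cutoff_at_top freq_at_top unfolding filterlim_at_top by auto
    then show ?thesis using eventually_gt_at_top[of 0]
    proof eventually_elim
      case (elim T)
      then show ?case using slope_bounds(3)[of T] by (simp add: ln_div ln_mult)
    qed
  qed
  ultimately show ?thesis by (auto elim: Lim_transform_eventually)
qed

lemma zeta_energy_error:
  obtains U where "\<forall>\<^sub>F T in at_top. \<bar>zeta_energy T - T * (harm (cutoff T) + harm (freq T) - 1)\<bar> \<le> U T"
    and "((\<lambda>T. U T / T) \<longlongrightarrow> 0) at_top"
proof -
  define K where "K = zeta_energy 1"
  \<comment> \<open>The error estimate with every quantity replaced by an explicit bound, plus the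
    energy below \<open>T1\<close>. The dominant term is \<open>sqrt (M X) ln T\<close>, of order
    \<open>T / ln T\<close>; with exponent \<open>b\<close> in place of 4 it would be
    \<open>T (ln T) powr (1 - b / 2)\<close>.\<close>
  define U where "U = (\<lambda>T::real. K + 36 * (63 * ((ln T)^4+2)^2 + 1) * (63 * ((ln T)^4+2)^2) +
     (63 * ((ln T)^4+2)^2 * ((ln T)^4+2) + 63 * ((ln T)^4+2)^2 * (1 + ln T) + 7 * ((ln T)^4+2) + (8 * ((ln T)^4+2) + 4 * (1 + ((ln T)^4+2)) * ((ln T)^4+2)) 
     + 2 * (8 * sqrt (T / (6 * (ln T)^4)) * sqrt (T + 1) + 4 * (1 + ln (T + 1)) * (T / (6 * (ln T)^4)))
     + (8 * (T / (6 * (ln T)^4)) + 4 * (1 + ln T) * (T / (6 * (ln T)^4))) + (16 * sqrt (T + 1) * sqrt (T / (6 * (ln T)^4)) + (60 * ((ln T)^4+2)^3)\<^sup>2) * ln T + 8 * sqrt ((ln T)^4+2) * (60 * ((ln T)^4+2)^3) * sqrt T))"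
  have lim: "((\<lambda>T. U T / T) \<longlongrightarrow> 0) at_top" unfolding U_def by real_asymp
  have T1ev: "\<forall>\<^sub>F T::real in at_top. 63 * ((ln T)^4+2)^2 \<le> T" by real_asymp
  have "\<forall>\<^sub>F T in at_top. \<bar>zeta_energy T - T * (harm (cutoff T) + harm (freq T) - 1)\<bar> \<le> U T"
    using T1ev eventually_ge_at_top[of 3]
  proof eventually_elim
    case (elim T)
    \<comment> \<open>\<open>J\<close> bounds \<open>j + 1\<close>. Then
      \<open>c \<le> 7 * J\<close>, and the other factor of \<open>T1\<close> is at most
      \<open>9 * J\<close>, whence the 63; the 60 below is \<open>16 * (15/4)\<close>.\<close>
    define J where "J = (ln T)^4 + 2"
    define j where "j = freq T"
    define c where "c = slope T"
    define T1 where "T1 = c * (8 * (real j + 1/2) + 1)"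
    define X where "X = cutoff T"
    define M where "M = nat \<lceil>T\<rceil>"
    define e where "e = 16 * (real j + 1)\<^sup>2 * sqrt (2 * c)"
    define Xu where "Xu = T / (6 * (ln T)^4)"
    have l1: "ln T \<ge> 1" using elim ln_ge_iff[of T 1] exp_le by simp
    have l4: "(ln T)^4 \<ge> 1" using l1 by (rule one_le_power)
    have J3: "J \<ge> 3" using l4 by (simp add: J_def)
    have j1: "j \<ge> 1" using freq_bounds(1)[of T] l4 by (simp add: j_def)
    have jJ: "real j + 1 \<le> J" using freq_bounds(2)[of T] by (simp add: j_def J_def)
    have cJ: "c \<le> 7 * J" and c0: "c > 0" using slope_bounds[of T] by (simp_all add: c_def J_def)
    have T1J: "T1 \<le> 63 * J^2"
    proof -
      have "T1 \<le> 7 * J * (9 * J)" unfolding T1_def using cJ c0 jJ J3 by (intro mult_mono) auto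
      then show ?thesis by (simp add: power2_eq_square)
    qed
    have T10: "T1 \<ge> 0" unfolding T1_def using c0 by simp
    have T11: "T1 \<ge> 1"
    proof -
      have "6 * 1 \<le> c" using slope_bounds(1)[of T] l4 by (simp add: c_def)
      then have "6 * 1 \<le> c * (8 * (real j + 1/2) + 1)" by (intro mult_mono) auto
      then show ?thesis by (simp add: T1_def)
    qed
    have T1T: "T1 \<le> T" using T1J elim by (simp add: J_def)
    have Xu: "real X \<le> Xu"
    proof -
      have "T / slope T \<le> T / (6 * (ln T)^4)" using elim slope_bounds[of T] l4 by (intro divide_left_mono mult_pos_pos) auto
      then show ?thesis using cutoff_bounds(1)[of T] elim unfolding X_def Xu_def by linarith
    qed
    have XT: "real X \<le> T"
    proof -
      have "Xu \<le> T / 1" unfolding Xu_def using elim l4 by (intro divide_left_mono) auto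
      then show ?thesis using Xu by simp
    qed
    have X1: "X \<ge> 1"
    proof -
      have "c * 1 \<le> c * (8 * (real j + 1/2) + 1)" using c0 by (intro mult_left_mono) auto
      then have "c \<le> T" using T1T unfolding T1_def by linarith
      then have "1 \<le> T / c" using c0 by simp
      then have "1 \<le> \<lfloor>T / c\<rfloor>" by linarith
      then show ?thesis unfolding X_def cutoff_def c_def by linarith
    qed
    have M: "real M \<le> T + 1" "real M \<ge> T" "M \<ge> 1" unfolding M_def using elim by linarith+
    have hX: "harm X \<le> 1 + ln T" using harm_le_ln[OF X1] XT X1 by (smt (verit) ln_le_cancel_iff of_nat_1 of_nat_mono)
    have lnj: "ln (real j) \<le> J" using ln_le_minus_one[of "real j"] j1 jJ by simp
    have hj: "harm j \<le> J" using harm_le_ln[OF j1] ln_le_minus_one[of "real j"] j1 jJ by simp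
    have e0: "e \<ge> 0" by (simp add: e_def c0 less_imp_le)
    have eJ: "e \<le> 60 * J^3"
    proof -
      have "sqrt (2 * c) \<le> sqrt (14 * J)" using cJ by simp
      also have "\<dots> \<le> 15/4 * J"
      proof (rule real_le_lsqrt)
        have "14 * J \<le> 225/16 * J * J" using J3 mult_left_mono[of 1 J "225/16 * J"] by simp
        then show "14 * J \<le> (15/4 * J)\<^sup>2" by (simp add: power2_eq_square)
      qed (use J3 in auto)
      finally have s: "sqrt (2 * c) \<le> 15/4 * J" .
      have "16 * (real j + 1)\<^sup>2 * sqrt (2 * c) \<le> 16 * J\<^sup>2 * (15/4 * J)"
        using jJ s c0 J3 by (intro mult_mono power_mono) auto
      then show ?thesis by (simp add: e_def power2_eq_square power3_eq_cube)
    qed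
    have lnX: "0 \<le> ln (real X)" "ln (real X) \<le> ln T" using X1 XT by auto
    have lnM: "0 \<le> ln (real M)" "ln (real M) \<le> ln (T + 1)" using M by auto
    have "\<bar>integral {T1..T} (\<lambda>t. (norm (zeta (Complex (1/2) t)))\<^sup>2) - T * (harm X + harm j - 1)\<bar> \<le>
       T1 * harm j + T1 * harm X + c + (8 * j + 4 * (1 + ln j) * j) + 2 * (8 * sqrt X * sqrt M + 4 * (1 + ln M) * X)
       + (8 * X + 4 * (1 + ln X) * X) + (16 * sqrt M * sqrt X + e\<^sup>2) * ln T + 8 * sqrt j * e * sqrt T"
      using critical_mean_square_error[OF j1, of T] T1T
      unfolding T1_def c_def X_def M_def e_def j_def cutoff_def slope_def by simp
    also have "\<dots> \<le> 63 * J^2 * J + 63 * J^2 * (1 + ln T) + 7 * J + (8 * J + 4 * (1 + J) * J) + 2 * (8 * sqrt Xu * sqrt (T + 1) + 4 * (1 + ln (T + 1)) * Xu)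
       + (8 * Xu + 4 * (1 + ln T) * Xu) + (16 * sqrt (T + 1) * sqrt Xu + (60 * J^3)\<^sup>2) * ln T + 8 * sqrt J * (60 * J^3) * sqrt T"
      using T1J T10 hX hj cJ jJ lnj Xu M lnX lnM e0 eJ l1 J3 harm_nonneg[of X, where 'a = real] harm_nonneg[of j, where 'a = real] elim j1
      by (intro add_mono mult_mono power_mono mult_left_mono mult_right_mono real_sqrt_le_mono order_refl mult_nonneg_nonneg add_nonneg_nonneg) auto
    finally have main: "\<bar>integral {T1..T} (\<lambda>t. (norm (zeta (Complex (1/2) t)))\<^sup>2) - T * (harm X + harm j - 1)\<bar> \<le> U T - (K + 36 * (63 * J^2 + 1) * (63 * J^2))"
      unfolding U_def J_def Xu_def by simp
    have "zeta_energy T1 \<le> K + 36 * (T1 + 1) * T1" using zeta_energy_le[OF T11] by (simp add: K_def)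
    also have "\<dots> \<le> K + 36 * (63 * J^2 + 1) * (63 * J^2)"
      using T1J T10 by (intro add_mono mult_mono order_refl) auto
    finally have "\<bar>zeta_energy T1\<bar> \<le> K + 36 * (63 * J^2 + 1) * (63 * J^2)" using zeta_energy_nonneg[of T1] by simp
    moreover have "zeta_energy T = zeta_energy T1 + integral {T1..T} (\<lambda>t. (norm (zeta (Complex (1/2) t)))\<^sup>2)"
      using T10 T1T by (rule zeta_energy_combine)
    ultimately show "\<bar>zeta_energy T - T * (harm (cutoff T) + harm (freq T) - 1)\<bar> \<le> U T"
      using main unfolding X_def j_def by linarith
  qed
  then show ?thesis using lim that by blast
qed

lemma zeta_energy_asymptotics:
  "((\<lambda>T. zeta_energy T / T - ln T) \<longlongrightarrow> 2 * euler_mascheroni - ln (2 * pi) - 1) at_top"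
proof -
  obtain U where U: "\<forall>\<^sub>F T in at_top. \<bar>zeta_energy T - T * (harm (cutoff T) + harm (freq T) - 1)\<bar> \<le> U T"
    "((\<lambda>T. U T / T) \<longlongrightarrow> 0) at_top"
    using zeta_energy_error by blast
  have "((\<lambda>T. zeta_energy T / T - (harm (cutoff T) + harm (freq T) - 1)) \<longlongrightarrow> 0) at_top"
  proof (rule Lim_null_comparison[OF _ U(2)])
    show "\<forall>\<^sub>F T in at_top. norm (zeta_energy T / T - (harm (cutoff T) + harm (freq T) - 1)) \<le> U T / T"
      using U(1) eventually_gt_at_top[of 0]
    proof eventually_elim
      case (elim T)
      have "zeta_energy T / T - (harm (cutoff T) + harm (freq T) - 1) = (zeta_energy T - T * (harm (cutoff T) + harm (freq T) - 1)) / T"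
        using elim by (simp add: field_simps)
      then show ?case using elim by (simp add: divide_right_mono)
    qed
  qed
  from tendsto_add[OF this harm_main_term] show ?thesis by simp
qed

text \<open>To the right of the critical line the exponent may be lowered to at most \<open>3/4\<close> in all error terms.\<close>

lemma mean_square_right_of_critical:
  assumes \<sigma>: "\<sigma> > 1/2"
  obtains K p where "p < 1" "\<And>Y Y'. Y \<ge> 1 \<Longrightarrow> Y \<le> Y' \<Longrightarrow> Y' \<le> 2 * Y \<Longrightarrow>
    \<bar>integral {Y..Y'} (\<lambda>t. (norm (zeta (Complex \<sigma> t)))\<^sup>2) - (Y' - Y) * (\<Sum>n=1..nat \<lceil>2 * Y\<rceil>. real n powr (- 2 * \<sigma>))\<bar>
      \<le> K * (1 + ln (3 * Y)) * Y powr p"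
proof -
  define \<tau> where "\<tau> = min \<sigma> (3/4)"
  have \<tau>: "1/2 < \<tau>" "\<tau> \<le> 3/4" "\<tau> \<le> \<sigma>" using \<sigma> by (auto simp: \<tau>_def)
  \<comment> \<open>The order of the off-diagonal terms, the product of two sums of order
    \<open>Y powr (1 - \<tau>)\<close>. It lies below 1 because \<open>\<tau> > 1/2\<close>.\<close>
  define p where "p = 2 - 2 * \<tau>"
  define K1 where "K1 = 24 * (\<sigma> + 5) + (\<sigma> + 5)\<^sup>2"
  have K10: "K1 \<ge> 0" using \<sigma> by (simp add: K1_def)
  have main: "\<bar>integral {Y..Y'} (\<lambda>t. (norm (zeta (Complex \<sigma> t)))\<^sup>2) - (Y' - Y) * (\<Sum>n=1..nat \<lceil>2 * Y\<rceil>. real n powr (- 2 * \<sigma>))\<bar>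
      \<le> (K1 + 360) * (1 + ln (3 * Y)) * Y powr p" if Y: "Y \<ge> 1" "Y \<le> Y'" "Y' \<le> 2 * Y" for Y Y'
  proof -
    \<comment> \<open>At least \<open>2 * Y\<close> and hence at least \<open>t\<close> on the whole
      interval, so that a single polynomial approximates zeta without a dual sum.\<close>
    define N where "N = nat \<lceil>2 * Y\<rceil>"
    have N: "2 * Y \<le> real N" "real N \<le> 3 * Y" "N \<ge> 1" unfolding N_def using Y by linarith+
    define \<alpha> where "\<alpha> = (\<lambda>n::nat. real n powr (- \<sigma>))"
    define P where "P = (\<lambda>t. \<Sum>m\<in>{1..N}. of_real (if Y \<le> t then \<alpha> m else 0) * cis (- (t * ln (real m))))"
    have \<alpha>le: "\<alpha> n \<le> real n powr (- \<tau>)" if "n \<ge> 1" for n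
      unfolding \<alpha>_def using \<tau> that by (intro powr_mono) auto
    have Npow: "real N powr x \<le> 3 * Y powr x" if "0 \<le> x" "x \<le> 1" for x
    proof -
      have "real N powr x \<le> (3 * Y) powr x" using N that by (intro powr_mono2) auto
      also have "\<dots> = 3 powr x * Y powr x" using Y by (simp add: powr_mult)
      also have "\<dots> \<le> 3 powr 1 * Y powr x" using that by (intro mult_right_mono powr_mono) auto
      finally show ?thesis by simp
    qed
    have S\<tau>: "(\<Sum>n=1..N. real n powr (- \<tau>)) \<le> 12 * Y powr (1 - \<tau>)"
    proof -
      have "(\<Sum>n=1..N. real n powr (- \<tau>)) \<le> real N powr (1 - \<tau>) / (1 - \<tau>)" using \<tau> by (intro sum_powr_le) auto
      also have "\<dots> \<le> real N powr (1 - \<tau>) / (1/4)" using \<tau> by (intro divide_left_mono) auto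
      also have "\<dots> \<le> 12 * Y powr (1 - \<tau>)" using Npow[of "1 - \<tau>"] \<tau> by simp
      finally show ?thesis .
    qed
    have S2: "(\<Sum>n=1..N. real n powr (1 - 2 * \<tau>)) \<le> 6 * Y powr p"
    proof -
      have "(\<Sum>n=1..N. real n powr (- (2 * \<tau> - 1))) \<le> real N powr (1 - (2 * \<tau> - 1)) / (1 - (2 * \<tau> - 1))" using \<tau> by (intro sum_powr_le) auto
      also have "\<dots> \<le> real N powr p / (1/2)" unfolding p_def using \<tau> by (intro frac_le) auto
      also have "\<dots> \<le> 6 * Y powr p" using Npow[of p] \<tau> by (simp add: p_def)
      finally show ?thesis by simp
    qed
    note mv = dirichlet_polynomial_mean_product[of "{1..N}" "{1..N}" Y Y' \<alpha> "\<lambda>_. Y" \<alpha> "\<lambda>_. Y"]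
    have iP: "(\<lambda>t. P t * cnj (P t)) integrable_on {Y..Y'}"
      unfolding P_def by (rule mv(1)) (use Y in \<open>auto simp: \<alpha>_def\<close>)
    have PP: "norm (integral {Y..Y'} (\<lambda>t. P t * cnj (P t)) - of_real (\<Sum>n=1..N. \<alpha> n * \<alpha> n * (Y' - max Y Y))) \<le> 
       288 * Y powr p + 24 * (1 + ln (3 * Y)) * Y powr p"
    proof -
      have "norm (integral {Y..Y'} (\<lambda>t. P t * cnj (P t)) - of_real (\<Sum>n=1..N. \<alpha> n * \<alpha> n * (Y' - max Y Y))) \<le>
        (\<Sum>n=1..N. \<Sum>m\<in>{1..N} - {n}. 2 * (\<alpha> m * \<alpha> n) / \<bar>ln (real m / real n)\<bar>)"
        unfolding P_def by (rule mv(2)) (use Y in \<open>auto simp: \<alpha>_def\<close>)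
      also have "\<dots> \<le> (\<Sum>n=1..N. \<Sum>m\<in>{1..N} - {n}. 2 * (real m powr (- \<tau>) * real n powr (- \<tau>)) / \<bar>ln (real m / real n)\<bar>)"
        by (intro sum_mono divide_right_mono mult_left_mono mult_mono \<alpha>le) (auto simp: \<alpha>_def)
      also have "\<dots> \<le> 2 * (\<Sum>n=1..N. real n powr (- \<tau>)) * (\<Sum>m=1..N. real m powr (- \<tau>)) + 4 * (1 + ln (real N)) * (\<Sum>n=1..N. real n powr (1 - 2 * \<tau>))"
        using \<tau> by (intro offdiagonal_sum_le) auto
      also have "\<dots> \<le> 2 * (12 * Y powr (1 - \<tau>)) * (12 * Y powr (1 - \<tau>)) + 4 * (1 + ln (3 * Y)) * (6 * Y powr p)"
        using N Y by (intro add_mono mult_mono S\<tau> S2 order_refl sum_nonneg) auto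
      also have "2 * (12 * Y powr (1 - \<tau>)) * (12 * Y powr (1 - \<tau>)) = 288 * (Y powr (1 - \<tau>) * Y powr (1 - \<tau>))" by simp
      also have "Y powr (1 - \<tau>) * Y powr (1 - \<tau>) = Y powr p" unfolding powr_add[symmetric] by (simp add: p_def)
      also have "4 * (1 + ln (3 * Y)) * (6 * Y powr p) = 24 * (1 + ln (3 * Y)) * Y powr p" by simp
      finally show ?thesis .
    qed
    have Sum: "(\<Sum>n=1..N. \<alpha> n * \<alpha> n * (Y' - max Y Y)) = (Y' - Y) * (\<Sum>n=1..N. real n powr (- 2 * \<sigma>))"
      unfolding sum_distrib_left \<alpha>_def powr_add[symmetric] by (intro sum.cong refl) simp
    \<comment> \<open>The pointwise cost \<open>Y powr (1 - 2 * \<tau>)\<close>, integrated over a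
      length of at most \<open>Y\<close>, is again \<open>Y powr p\<close>.\<close>
    have pt: "\<bar>(norm (zeta (Complex \<sigma> t)))\<^sup>2 - Re (P t * cnj (P t))\<bar> \<le> K1 * Y powr (1 - 2 * \<tau>)" if t: "t \<in> {Y..Y'}" for t
    proof -
      define R where "R = zeta (Complex \<sigma> t) - P t"
      have t1: "t \<ge> 1" "t \<le> real N" "t \<ge> Y" "t \<le> 2 * Y" using t Y N by auto
      have eq: "(\<Sum>n=1..N. of_nat n powr (- Complex \<sigma> t)) = P t"
        unfolding P_def using t by (intro sum.cong refl) (subst nat_powr_critical, auto simp: \<alpha>_def)
      have "norm R \<le> (norm (Complex \<sigma> t) / N + 1/2 + N / t) * real N powr (- \<sigma>)"
        unfolding R_def eq[symmetric] using \<sigma> t1 by (intro zeta_minus_dirichlet_polynomial_le) auto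
      also have "\<dots> \<le> (\<sigma> + 5) * Y powr (- \<tau>)"
      proof (intro mult_mono)
        have "norm (Complex \<sigma> t) \<le> \<sigma> + t" using cmod_le[of "Complex \<sigma> t"] t1 \<sigma> by simp
        then have "norm (Complex \<sigma> t) / N \<le> (\<sigma> + t) / N" by (intro divide_right_mono) auto
        also have "\<dots> \<le> \<sigma> + 1"
        proof -
          have "\<sigma> * 1 \<le> \<sigma> * real N" using \<sigma> N by (intro mult_left_mono) auto
          then show ?thesis using t1 N by (simp add: field_simps)
        qed
        finally have "norm (Complex \<sigma> t) / N \<le> \<sigma> + 1" .
        moreover have "N / t \<le> 3" using N t1 by (simp add: field_simps)
        ultimately show "norm (Complex \<sigma> t) / N + 1/2 + N / t \<le> \<sigma> + 5" by linarith
        have "real N powr (- \<sigma>) \<le> real N powr (- \<tau>)" using \<tau> N by (intro powr_mono) auto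
        also have "\<dots> \<le> Y powr (- \<tau>)" using \<tau> N Y by (intro powr_mono2') auto
        finally show "real N powr (- \<sigma>) \<le> Y powr (- \<tau>)" .
      qed (use \<sigma> in auto)
      finally have R: "norm R \<le> (\<sigma> + 5) * Y powr (- \<tau>)" .
      have "norm (P t) \<le> (\<Sum>n\<in>{1..N}. real n powr (- \<tau>))"
        unfolding P_def using \<alpha>le by (intro norm_dirichlet_sum_le) (auto simp: \<alpha>_def)
      then have P: "norm (P t) \<le> 12 * Y powr (1 - \<tau>)" using S\<tau> by linarith
      have "zeta (Complex \<sigma> t) = P t + R" by (simp add: R_def)
      then have "(norm (zeta (Complex \<sigma> t)))\<^sup>2 - Re (P t * cnj (P t)) = 2 * Re (P t * cnj R) + (norm R)\<^sup>2"
        unfolding cmod_power2 by (simp add: power2_eq_square algebra_simps)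
      moreover have "\<bar>Re (P t * cnj R)\<bar> \<le> norm (P t) * norm R"
        using abs_Re_le_cmod[of "P t * cnj R"] by (simp add: norm_mult)
      moreover have "(norm R)\<^sup>2 \<ge> 0" by simp
      ultimately have "\<bar>(norm (zeta (Complex \<sigma> t)))\<^sup>2 - Re (P t * cnj (P t))\<bar> \<le> 2 * (norm (P t) * norm R) + (norm R)\<^sup>2"
        by linarith
      also have "\<dots> \<le> 2 * (12 * Y powr (1 - \<tau>) * ((\<sigma> + 5) * Y powr (- \<tau>))) + ((\<sigma> + 5) * Y powr (- \<tau>))\<^sup>2"
        using R P by (intro add_mono mult_left_mono mult_mono power_mono) auto
      also have "\<dots> = 24 * (\<sigma> + 5) * (Y powr (1 - \<tau>) * Y powr (- \<tau>)) + (\<sigma> + 5)\<^sup>2 * (Y powr (- \<tau>) * Y powr (- \<tau>))"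
        by (simp add: power2_eq_square)
      also have "\<dots> = 24 * (\<sigma> + 5) * Y powr (1 - 2 * \<tau>) + (\<sigma> + 5)\<^sup>2 * Y powr (- 2 * \<tau>)"
        unfolding powr_add[symmetric] by simp
      also have "\<dots> \<le> 24 * (\<sigma> + 5) * Y powr (1 - 2 * \<tau>) + (\<sigma> + 5)\<^sup>2 * Y powr (1 - 2 * \<tau>)"
        using Y by (intro add_left_mono mult_left_mono powr_mono) auto
      finally show ?thesis by (simp add: K1_def distrib_right)
    qed
    have iz: "(\<lambda>t. (norm (zeta (Complex \<sigma> t)))\<^sup>2) integrable_on {Y..Y'}"
      using Y by (intro integrable_continuous_real continuous_intros zeta_line_continuous) auto
    have hP: "((\<lambda>t. Re (P t * cnj (P t))) has_integral Re (integral {Y..Y'} (\<lambda>t. P t * cnj (P t)))) {Y..Y'}"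
      by (intro has_integral_Re integrable_integral iP)
    have "integral {Y..Y'} (\<lambda>t. (norm (zeta (Complex \<sigma> t)))\<^sup>2) - Re (integral {Y..Y'} (\<lambda>t. P t * cnj (P t))) =
       integral {Y..Y'} (\<lambda>t. (norm (zeta (Complex \<sigma> t)))\<^sup>2 - Re (P t * cnj (P t)))"
      using integral_unique[OF hP] iz hP by (subst integral_diff) auto
    also have "norm \<dots> \<le> integral {Y..Y'} (\<lambda>_. K1 * Y powr (1 - 2 * \<tau>))"
      using pt iz hP by (intro integral_norm_bound_integral integrable_diff) auto
    also have "\<dots> = K1 * (Y powr (1 - 2 * \<tau>) * (Y' - Y))" using Y by simp
    also have "\<dots> \<le> K1 * (Y powr (1 - 2 * \<tau>) * Y powr 1)" using Y K10 by (intro mult_left_mono) auto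
    also have "\<dots> = K1 * Y powr p" unfolding powr_add[symmetric] by (simp add: p_def)
    finally have 1: "\<bar>integral {Y..Y'} (\<lambda>t. (norm (zeta (Complex \<sigma> t)))\<^sup>2) - Re (integral {Y..Y'} (\<lambda>t. P t * cnj (P t)))\<bar> \<le> K1 * Y powr p"
      by simp
    have 2: "\<bar>Re (integral {Y..Y'} (\<lambda>t. P t * cnj (P t))) - (Y' - Y) * (\<Sum>n=1..N. real n powr (- 2 * \<sigma>))\<bar> \<le> 288 * Y powr p + 24 * (1 + ln (3 * Y)) * Y powr p"
      using abs_Re_le_cmod[of "integral {Y..Y'} (\<lambda>t. P t * cnj (P t)) - of_real ((Y' - Y) * (\<Sum>n=1..N. real n powr (- 2 * \<sigma>)))"] PP
      unfolding Sum by simp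
    have ln0: "ln (3 * Y) \<ge> 0" using Y by simp
    have "K1 * Y powr p + (288 * Y powr p + 24 * (1 + ln (3 * Y)) * Y powr p) = (K1 + 288 + 24 * (1 + ln (3 * Y))) * Y powr p"
      by (simp add: algebra_simps)
    also have "\<dots> \<le> ((K1 + 360) * (1 + ln (3 * Y))) * Y powr p"
    proof (intro mult_right_mono)
      have "(K1 + 288) * 1 \<le> (K1 + 336) * (1 + ln (3 * Y))" using K10 ln0 by (intro mult_mono) auto
      then show "K1 + 288 + 24 * (1 + ln (3 * Y)) \<le> (K1 + 360) * (1 + ln (3 * Y))" by (simp add: algebra_simps)
    qed simp
    finally show ?thesis using 1 2 unfolding N_def by linarith
  qed
  have "p < 1" using \<tau> by (simp add: p_def)
  then show ?thesis using main that by blast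
qed

section \<open>Jacob's ladders\<close>

definition zsq :: "real \<Rightarrow> real" where "zsq t = (norm (zeta (Complex (1/2) t)))\<^sup>2"

lemma zsq_nonneg: "zsq t \<ge> 0" by (simp add: zsq_def)

lemma zsq_continuous: "continuous_on S zsq"
  unfolding zsq_def by (intro continuous_intros zeta_line_continuous) auto

lemma zeta_energy_zsq: "zeta_energy T = integral {0..T} zsq"
  unfolding zeta_energy_def zsq_def ..

lemma zeta_energy_mono: "0 \<le> a \<Longrightarrow> a \<le> b \<Longrightarrow> zeta_energy a \<le> zeta_energy b"
  using zeta_energy_combine[of a b] integral_nonneg[OF zeta_square_integrable, of a b] by simp

lemma zeta_energy_continuous: "continuous_on {0..b} zeta_energy"
  unfolding zeta_energy_zsq[abs_def] by (intro indefinite_integral_continuous_1 integrable_continuous_real zsq_continuous)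

section \<open>Asymptotics of the damped integral in the ladder equation\<close>

lemma damped_energy_by_parts:
  assumes "m \<ge> 0" "Y > 0"
  shows "integral {0..m} (\<lambda>t. zsq t * exp (- (t / Y))) = zeta_energy m * exp (- (m / Y)) + integral {0..m} (\<lambda>t. zeta_energy t * exp (- (t / Y))) / Y"
proof -
  have "((\<lambda>t. zsq t * exp (- (t / Y)) - zeta_energy t * exp (- (t / Y)) / Y) has_integral
      zeta_energy m * exp (- (m / Y)) - zeta_energy 0 * exp (- (0 / Y))) {0..m}"
  proof (rule fundamental_theorem_of_calculus)
    fix t assume t: "t \<in> {0..m}"
    have d: "(zeta_energy has_real_derivative zsq t) (at t within {0..m})"
      unfolding zeta_energy_zsq[abs_def] using zsq_continuous t by (rule integral_has_real_derivative)
    have "((\<lambda>t. zeta_energy t * exp (- (t / Y))) has_real_derivative (zsq t * exp (- (t / Y)) - zeta_energy t * exp (- (t / Y)) / Y)) (at t within {0..m})"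
      using assms by (auto intro!: derivative_eq_intros d)
    then show "((\<lambda>t. zeta_energy t * exp (- (t / Y))) has_vector_derivative (zsq t * exp (- (t / Y)) - zeta_energy t * exp (- (t / Y)) / Y)) (at t within {0..m})"
      by (simp add: has_real_derivative_iff_has_vector_derivative)
  qed (use assms in auto)
  moreover have "((\<lambda>t. zsq t * exp (- (t / Y)) - zeta_energy t * exp (- (t / Y)) / Y) has_integral
      integral {0..m} (\<lambda>t. zsq t * exp (- (t / Y))) - integral {0..m} (\<lambda>t. zeta_energy t * exp (- (t / Y))) / Y) {0..m}"
    using assms by (intro has_integral_diff has_integral_divide integrable_integral integrable_continuous_real continuous_intros zsq_continuous zeta_energy_continuous) auto
  ultimately have "integral {0..m} (\<lambda>t. zsq t * exp (- (t / Y))) - integral {0..m} (\<lambda>t. zeta_energy t * exp (- (t / Y))) / Y = 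
     zeta_energy m * exp (- (m / Y)) - zeta_energy 0 * exp (- (0 / Y))"
    by (rule has_integral_unique[rotated])
  moreover have "zeta_energy 0 = 0" by (simp add: zeta_energy_def)
  ultimately show ?thesis by simp
qed

text \<open>The inequality \<open>ln x \<le> x - 1\<close> at \<open>x = 1 / sqrt u\<close>.
  Compared with the bound \<open>u - 1\<close> it leaves a square as surplus, which makes the ladder
  constant strictly positive.\<close>

lemma entropy_ge: "u \<ge> 0 \<Longrightarrow> u * ln u \<ge> u - 1 + (sqrt u - 1)\<^sup>2" for u :: real
proof (cases "u = 0")
  case False
  assume "u \<ge> 0"
  then have u: "u > 0" using False by simp
  have "ln (1 / sqrt u) \<le> 1 / sqrt u - 1" using u by (intro ln_le_minus_one) auto
  moreover have "ln (1 / sqrt u) = - (ln u / 2)" using u by (simp add: ln_div ln_sqrt)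
  ultimately have "ln u \<ge> 2 - 2 / sqrt u" by simp
  then have "u * ln u \<ge> u * (2 - 2 / sqrt u)" using u by (intro mult_left_mono) auto
  moreover have "u * (2 - 2 / sqrt u) = 2 * u - 2 * (u / sqrt u)" by (simp add: algebra_simps)
  moreover have "u / sqrt u = sqrt u" using u by (simp add: real_div_sqrt)
  moreover have "(sqrt u - 1)\<^sup>2 = u - 2 * sqrt u + 1" using u by (simp add: power2_diff)
  ultimately show ?thesis by simp
qed simp

lemma continuous_on_u_ln_u_atLeast: "continuous_on {0..} (\<lambda>u::real. u * ln u)"
proof -
  have "continuous (at u within {0..}) (\<lambda>u::real. u * ln u)" if "u \<in> {0..}" for u
  proof (cases "u = 0")
    case True
    have "((\<lambda>u::real. u * ln u) \<longlongrightarrow> 0) (at_right 0)" by real_asymp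
    moreover have "at 0 within {0..} \<le> at_right (0::real)"
      unfolding at_within_def by (intro inf_mono order_refl) auto
    ultimately have "((\<lambda>u::real. u * ln u) \<longlongrightarrow> 0) (at 0 within {0..})"
      using tendsto_mono by blast
    then show ?thesis using True by (simp add: continuous_within)
  next
    case False
    then show ?thesis using that by (intro continuous_intros) auto
  qed
  then show ?thesis by (simp add: continuous_on_eq_continuous_within)
qed

lemma continuous_on_u_ln_u: "continuous_on {0..b} (\<lambda>u::real. u * ln u)"
  by (rule continuous_on_subset[OF continuous_on_u_ln_u_atLeast]) auto

text \<open>The constant is \<open>1 - \<gamma>\<close>; only its positivity matters, which follows from \<open>u ln u \<ge> u - 1\<close>.\<close>

lemma entropy_integral:
  obtains K :: real where "K > 0" "((\<lambda>U. integral {0..U} (\<lambda>u. u * ln u * exp (- u))) \<longlongrightarrow> K) at_top"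
proof -
  let ?f = "\<lambda>u::real. u * ln u * exp (- u)"
  have fi: "?f integrable_on {0..U}" for U
    by (intro integrable_continuous_real continuous_on_mult continuous_on_u_ln_u continuous_intros)
  have "?f integrable_on {0..}"
  proof (rule measurable_bounded_by_integrable_imp_integrable)
    show "?f \<in> borel_measurable (lebesgue_on {0..})"
      by (intro continuous_imp_measurable_on_sets_lebesgue continuous_on_mult continuous_on_u_ln_u_atLeast continuous_intros) auto
    have "(\<lambda>t::real. exp (- 1 * t)) integrable_on {0..}" by (rule integrable_on_exp_minus_to_infinity) simp
    moreover have "(\<lambda>t::real. t powr (3 - 1) / exp t) integrable_on {0..}"
      by (rule has_integral_integrable[OF Gamma_integral_real]) simp
    ultimately show "(\<lambda>t::real. exp (- 1 * t) + t powr (3 - 1) / exp t) integrable_on {0..}"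
      by (rule integrable_add)
    fix u :: real assume "u \<in> {0..}"
    then have u: "u \<ge> 0" by simp
    \<comment> \<open>Bounded above by \<open>u * (u - 1)\<close> and below by \<open>u - 1\<close>;
      times \<open>exp (- u)\<close> the majorant is a sum of two Gamma integrands.\<close>
    have "\<bar>u * ln u\<bar> \<le> 1 + u\<^sup>2"
    proof (cases "u = 0")
      case False
      then have u0: "u > 0" using u by simp
      have "ln u \<le> u - 1" using u0 by (rule ln_le_minus_one)
      then have "u * ln u \<le> u * (u - 1)" using u by (rule mult_left_mono)
      moreover have "u * ln u \<ge> u - 1" using entropy_ge[OF u] zero_le_power2[of "sqrt u - 1"] by linarith
      moreover have "u * (u - 1) = u\<^sup>2 - u" by (simp add: power2_eq_square algebra_simps)
      ultimately show ?thesis using u zero_le_power2[of u] by linarith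
    qed simp
    then have "\<bar>u * ln u\<bar> * exp (- u) \<le> (1 + u\<^sup>2) * exp (- u)" by (intro mult_right_mono) auto
    also have "\<dots> = exp (- 1 * u) + u powr (3 - 1) / exp u"
      using u by (cases "u = 0") (simp_all add: powr_numeral exp_minus field_simps)
    finally show "norm (u * ln u * exp (- u)) \<le> exp (- 1 * u) + u powr (3 - 1) / exp u"
      by (simp add: abs_mult)
  qed auto
  then have lim: "((\<lambda>U. integral {0..U} ?f) \<longlongrightarrow> integral {0..} ?f) at_top"
    by (intro has_integral_atLeast_tendsto integrable_integral)
  \<comment> \<open>The part \<open>u - 1\<close> integrates to \<open>- U * exp (- U)\<close>,
    which vanishes in the limit; the surplus square contributes at least
    \<open>exp (- 3) / 10\<close> between 2 and 3, where \<open>sqrt u \<ge> 1.4\<close>.\<close>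
  have lower: "integral {0..U} ?f \<ge> 1/10 * exp (- 3) - U * exp (- U)" if U: "U \<ge> 3" for U
  proof -
    have i1: "((\<lambda>u. (u - 1) * exp (- u)) has_integral (- (U * exp (- U)) - (- (0 * exp (- 0))))) {0..U}"
      using U by (intro fundamental_theorem_of_calculus)
        (auto intro!: derivative_eq_intros simp: has_real_derivative_iff_has_vector_derivative[symmetric] algebra_simps)
    let ?g = "\<lambda>u::real. (sqrt u - 1)\<^sup>2 * exp (- u)"
    have gi: "?g integrable_on {a..b}" for a b by (intro integrable_continuous_real continuous_intros)
    have "1/10 * exp (- 3) = integral {2..3::real} (\<lambda>_. 1/10 * exp (- 3))" by simp
    also have "\<dots> \<le> integral {2..3} ?g"
    proof (intro integral_le gi)
      fix u :: real assume u: "u \<in> {2..3}"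
      have "1.4 \<le> sqrt u" using u by (intro real_le_rsqrt) (auto simp: power2_eq_square)
      then have "(4/10)\<^sup>2 \<le> (sqrt u - 1)\<^sup>2" by (intro power_mono) auto
      then have "1/10 \<le> (sqrt u - 1)\<^sup>2" by (simp add: power2_eq_square)
      then show "1/10 * exp (- 3) \<le> (sqrt u - 1)\<^sup>2 * exp (- u)" using u by (intro mult_mono) auto
    qed auto
    also have "\<dots> \<le> integral {0..U} ?g"
      using U by (intro integral_subset_le gi) auto
    finally have 2: "1/10 * exp (- 3) \<le> integral {0..U} ?g" .
    have "integral {0..U} (\<lambda>u. (u - 1) * exp (- u) + ?g u) \<le> integral {0..U} ?f"
    proof (intro integral_le fi integrable_add gi)
      show "(\<lambda>u. (u - 1) * exp (- u)) integrable_on {0..U}" using i1 by blast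
      fix u assume "u \<in> {0..U}"
      then have "(u - 1 + (sqrt u - 1)\<^sup>2) * exp (- u) \<le> (u * ln u) * exp (- u)"
        using entropy_ge[of u] by (intro mult_right_mono) auto
      then show "(u - 1) * exp (- u) + ?g u \<le> ?f u" by (simp add: algebra_simps)
    qed
    moreover have "integral {0..U} (\<lambda>u. (u - 1) * exp (- u) + ?g u) = - (U * exp (- U)) + integral {0..U} ?g"
      using integral_unique[OF has_integral_add[OF i1 integrable_integral[OF gi]]] by simp
    ultimately show ?thesis using 2 by linarith
  qed
  have "((\<lambda>U. 1/10 * exp (- 3) - U * exp (- U)) \<longlongrightarrow> 1/10 * exp (- 3 :: real)) at_top" by real_asymp
  from tendsto_le[OF _ lim this] have "1/10 * exp (- 3) \<le> integral {0..} ?f"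
    using lower by (auto intro: eventually_at_top_linorderI[of 3])
  moreover have "1/10 * exp (- 3 :: real) > 0" by simp
  ultimately show ?thesis using that lim by (meson less_le_trans)
qed

lemma has_integral_u_exp:
  fixes U :: real
  assumes "U \<ge> 0" shows "((\<lambda>u. u * exp (- u)) has_integral (1 - (1 + U) * exp (- U))) {0..U}"
proof -
  have "((\<lambda>u. u * exp (- u)) has_integral (- ((1 + U) * exp (- U)) - (- ((1 + 0) * exp (- 0))))) {0..U}"
    using assms by (intro fundamental_theorem_of_calculus)
      (auto intro!: derivative_eq_intros simp: has_real_derivative_iff_has_vector_derivative[symmetric] algebra_simps)
  then show ?thesis by simp
qed

lemma integral_rescale_real:
  fixes f :: "real \<Rightarrow> real"
  assumes "Y > 0" "f integrable_on {0..m}"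
  shows "integral {0..m} f = Y * integral {0..m / Y} (\<lambda>u. f (Y * u))"
proof -
  have "((\<lambda>u. f (Y * u)) has_integral (1 / \<bar>Y\<bar>) *\<^sub>R integral {0..m} f) ((\<lambda>x. x / Y) ` {0..m})"
    using assms by (intro has_integral_stretch_real integrable_integral) auto
  also have "(\<lambda>x. x / Y) ` {0..m} = {0..m / Y}"
    using assms by (subst image_divide_atLeastAtMost) auto
  finally show ?thesis using assms by (simp add: integral_unique)
qed

text \<open>After integration by parts the damped integral is a truncated Laplace transform of the
  energy. Substituting \<open>t = Y * u\<close> splits \<open>ln t\<close> into
  \<open>ln Y + ln u\<close>: the second part leads to the ladder constant, the first to an
  elementary integral.\<close>

lemma damped_main_term:
  fixes Y m a :: real
  assumes "Y > 0" "m \<ge> 0"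
  shows "integral {0..m} (\<lambda>t. (t * ln t + a * t) * exp (- (t / Y))) = 
    Y\<^sup>2 * (integral {0..m / Y} (\<lambda>u. u * ln u * exp (- u)) + (ln Y + a) * (1 - (1 + m / Y) * exp (- (m / Y))))"
proof -
  have "integral {0..m} (\<lambda>t. (t * ln t + a * t) * exp (- (t / Y))) = 
     Y * integral {0..m / Y} (\<lambda>u. ((Y * u) * ln (Y * u) + a * (Y * u)) * exp (- ((Y * u) / Y)))"
    by (rule integral_rescale_real[where f = "\<lambda>t. (t * ln t + a * t) * exp (- (t / Y))"])
       (use assms in \<open>auto intro!: integrable_continuous_real continuous_on_mult continuous_on_add continuous_on_u_ln_u continuous_intros\<close>)
  also have "integral {0..m / Y} (\<lambda>u. ((Y * u) * ln (Y * u) + a * (Y * u)) * exp (- ((Y * u) / Y))) =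
     integral {0..m / Y} (\<lambda>u. Y * (u * ln u * exp (- u)) + Y * (ln Y + a) * (u * exp (- u)))"
  proof (rule integral_cong)
    fix u assume "u \<in> {0..m / Y}"
    then show "((Y * u) * ln (Y * u) + a * (Y * u)) * exp (- ((Y * u) / Y)) = Y * (u * ln u * exp (- u)) + Y * (ln Y + a) * (u * exp (- u))"
      using assms by (cases "u = 0") (auto simp: ln_mult algebra_simps)
  qed
  also have "\<dots> = Y * integral {0..m / Y} (\<lambda>u. u * ln u * exp (- u)) + Y * (ln Y + a) * (1 - (1 + m / Y) * exp (- (m / Y)))"
    using assms
    by (intro integral_unique has_integral_add has_integral_mult_right has_integral_u_exp integrable_integral
         integrable_continuous_real continuous_on_mult continuous_on_u_ln_u continuous_intros) auto
  finally show ?thesis by (simp add: power2_eq_square algebra_simps)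
qed

definition energy_const :: real where "energy_const = 2 * euler_mascheroni - ln (2 * pi) - 1"

text \<open>The asymptotic error as a bound valid from 0 on, so that it can be integrated against
  the exponential. Below the threshold a constant suffices, by compactness.\<close>

lemma energy_remainder_bound:
  assumes "\<epsilon> > 0"
  obtains C where "C \<ge> 0" "\<And>t. t \<ge> 0 \<Longrightarrow> \<bar>zeta_energy t - (t * ln t + energy_const * t)\<bar> \<le> \<epsilon> * t + C"
proof -
  have "((\<lambda>T. zeta_energy T / T - ln T) \<longlongrightarrow> energy_const) at_top"
    unfolding energy_const_def by (rule zeta_energy_asymptotics)
  then have "\<forall>\<^sub>F T in at_top. dist (zeta_energy T / T - ln T) energy_const < \<epsilon>" using assms by (rule tendstoD)
  then obtain t0 where t0: "\<And>t. t \<ge> t0 \<Longrightarrow> dist (zeta_energy t / t - ln t) energy_const < \<epsilon>"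
    unfolding eventually_at_top_linorder by blast
  define t1 where "t1 = max t0 1"
  have big: "\<bar>zeta_energy t - (t * ln t + energy_const * t)\<bar> \<le> \<epsilon> * t" if "t \<ge> t1" for t
  proof -
    have t: "t \<ge> t0" "t > 0" using that by (auto simp: t1_def)
    have "zeta_energy t - (t * ln t + energy_const * t) = t * ((zeta_energy t / t - ln t) - energy_const)"
      using t by (simp add: field_simps)
    then have "\<bar>zeta_energy t - (t * ln t + energy_const * t)\<bar> = t * \<bar>(zeta_energy t / t - ln t) - energy_const\<bar>"
      using t by (simp add: abs_mult)
    also have "\<dots> \<le> t * \<epsilon>" using t0[OF t(1)] t by (intro mult_left_mono) (auto simp: dist_real_def)
    finally show ?thesis by (simp add: mult.commute)
  qed
  have "compact ((\<lambda>t. zeta_energy t - (t * ln t + energy_const * t)) ` {0..t1})"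
    by (intro compact_continuous_image continuous_on_diff continuous_on_add zeta_energy_continuous continuous_on_u_ln_u continuous_intros) auto
  then have "bounded ((\<lambda>t. zeta_energy t - (t * ln t + energy_const * t)) ` {0..t1})" by (rule compact_imp_bounded)
  then obtain B where B': "\<forall>x\<in>(\<lambda>t. zeta_energy t - (t * ln t + energy_const * t)) ` {0..t1}. norm x \<le> B"
    unfolding bounded_iff by blast
  have B: "\<bar>zeta_energy t - (t * ln t + energy_const * t)\<bar> \<le> B" if "t \<in> {0..t1}" for t
    using B' that by auto
  have "\<bar>zeta_energy t - (t * ln t + energy_const * t)\<bar> \<le> \<epsilon> * t + max B 0" if t: "t \<ge> 0" for t
  proof (cases "t \<ge> t1")
    case True
    then show ?thesis using big[OF True] by linarith
  next
    case False
    then have "\<bar>zeta_energy t - (t * ln t + energy_const * t)\<bar> \<le> B" using B[of t] t by auto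
    moreover have "\<epsilon> * t \<ge> 0" using assms t by simp
    ultimately show ?thesis by linarith
  qed
  then show ?thesis using that[of "max B 0"] by simp
qed

lemma one_plus_le_exp_half: "(1 + U)\<^sup>2 \<le> 16 * exp (U / 2)" "1 + U \<le> 2 * exp (U / 2)" if "U \<ge> 0" for U :: real
proof -
  have "1 + U \<le> 4 * exp (U / 4)" using exp_ge_add_one_self[of "U / 4"] by linarith
  then have "(1 + U)\<^sup>2 \<le> (4 * exp (U / 4))\<^sup>2" using that by (intro power_mono) auto
  also have "\<dots> = 16 * (exp (U / 4) * exp (U / 4))" by (simp add: power2_eq_square)
  also have "exp (U / 4) * exp (U / 4) = exp (U / 2)" unfolding exp_add[symmetric] by simp
  finally show "(1 + U)\<^sup>2 \<le> 16 * exp (U / 2)" .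
  show "1 + U \<le> 2 * exp (U / 2)" using exp_ge_add_one_self[of "U / 2"] that by linarith
qed

text \<open>The bound on \<open>m\<close> is admissibility at \<open>y = 2 * Y\<close>. It gives
  \<open>exp (- m / (2 * Y)) \<le> (2 * Y) powr (- 7)\<close>: one half of the exponential pays for
  the polynomial growth of the boundary terms, the other half makes the truncation at
  \<open>m\<close> negligible.\<close>

lemma damped_energy_estimate:
  assumes \<epsilon>: "C \<ge> 0" "\<epsilon> > 0" "\<And>t. t \<ge> 0 \<Longrightarrow> \<bar>zeta_energy t - (t * ln t + energy_const * t)\<bar> \<le> \<epsilon> * t + C"
    and Y: "Y \<ge> 1" and m: "m \<ge> 14 * Y * ln (2 * Y)"
  defines "E \<equiv> integral {0..m} (\<lambda>t. zsq t * exp (- (t / Y)))"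
  shows "\<bar>E / Y - ln Y - energy_const - integral {0..m / Y} (\<lambda>u. u * ln u * exp (- u))\<bar> \<le>
     \<epsilon> + C / Y + 16 * (zeta_energy 1 + 72) * Y * (2 * Y) powr (- 7) + 2 * (\<bar>ln Y\<bar> + \<bar>energy_const\<bar>) * (2 * Y) powr (- 7)"
proof -
  define U where "U = m / Y"
  have U: "U \<ge> 14 * ln (2 * Y)" using m Y by (simp add: U_def field_simps)
  have l2: "ln (2 * Y) \<ge> 0" using Y by simp
  have U0: "U \<ge> 0" using U l2 by linarith
  have m0: "m \<ge> 0" using U0 Y by (simp add: U_def zero_le_divide_iff)
  have eU: "exp (- U / 2) \<le> (2 * Y) powr (- 7)"
  proof -
    have "exp (- U / 2) \<le> exp (- 7 * ln (2 * Y))" using U by simp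
    then show ?thesis using Y by (simp add: powr_def)
  qed
  define H where "H = integral {0..U} (\<lambda>u. u * ln u * exp (- u))"
  define r where "r = (\<lambda>t. (zeta_energy t - (t * ln t + energy_const * t)) * exp (- (t / Y)))"
  have ic: "(\<lambda>t. (t * ln t + energy_const * t) * exp (- (t / Y))) integrable_on {0..m}"
    using Y by (intro integrable_continuous_real continuous_on_mult continuous_on_add continuous_on_u_ln_u continuous_intros) auto
  have iG: "(\<lambda>t. zeta_energy t * exp (- (t / Y))) integrable_on {0..m}"
    using Y by (intro integrable_continuous_real continuous_on_mult zeta_energy_continuous continuous_intros) auto
  have ir: "r integrable_on {0..m}" and Gr: "integral {0..m} (\<lambda>t. zeta_energy t * exp (- (t / Y))) = integral {0..m} (\<lambda>t. (t * ln t + energy_const * t) * exp (- (t / Y))) + integral {0..m} r"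
  proof -
    have "((\<lambda>t. zeta_energy t * exp (- (t / Y)) - (t * ln t + energy_const * t) * exp (- (t / Y))) has_integral
      integral {0..m} (\<lambda>t. zeta_energy t * exp (- (t / Y))) - integral {0..m} (\<lambda>t. (t * ln t + energy_const * t) * exp (- (t / Y)))) {0..m}"
      by (intro has_integral_diff integrable_integral ic iG)
    also have "(\<lambda>t. zeta_energy t * exp (- (t / Y)) - (t * ln t + energy_const * t) * exp (- (t / Y))) = r"
      by (simp add: r_def left_diff_distrib)
    finally show "r integrable_on {0..m}" "integral {0..m} (\<lambda>t. zeta_energy t * exp (- (t / Y))) = integral {0..m} (\<lambda>t. (t * ln t + energy_const * t) * exp (- (t / Y))) + integral {0..m} r"
      by (auto simp: has_integral_iff)
  qed
  have rb: "\<bar>integral {0..m} r\<bar> \<le> \<epsilon> * Y\<^sup>2 + C * Y"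
  proof -
    have ib: "(\<lambda>t. (\<epsilon> * t + C) * exp (- (t / Y))) integrable_on {0..m}"
      using Y by (intro integrable_continuous_real continuous_intros) auto
    have "norm (integral {0..m} r) \<le> integral {0..m} (\<lambda>t. (\<epsilon> * t + C) * exp (- (t / Y)))"
    proof (rule integral_norm_bound_integral[OF ir ib])
      fix t assume "t \<in> {0..m}"
      then show "norm (r t) \<le> (\<epsilon> * t + C) * exp (- (t / Y))"
        unfolding r_def using \<epsilon>(3)[of t] by (simp add: abs_mult)
    qed
    also have "\<dots> = Y * integral {0..m / Y} (\<lambda>u. (\<epsilon> * (Y * u) + C) * exp (- ((Y * u) / Y)))"
      using Y by (intro integral_rescale_real ib) auto
    also have "integral {0..m / Y} (\<lambda>u. (\<epsilon> * (Y * u) + C) * exp (- ((Y * u) / Y))) = integral {0..U} (\<lambda>u. \<epsilon> * Y * (u * exp (- u)) + C * exp (- u))"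
      unfolding U_def using Y by (intro integral_cong) (simp add: algebra_simps)
    also have "\<dots> = \<epsilon> * Y * (1 - (1 + U) * exp (- U)) + C * (1 - exp (- U))"
    proof -
      have "((\<lambda>u::real. exp (- u)) has_integral (- exp (- U) - (- exp (- 0)))) {0..U}"
        using U0 by (intro fundamental_theorem_of_calculus)
          (auto intro!: derivative_eq_intros simp: has_real_derivative_iff_has_vector_derivative[symmetric])
      then have "((\<lambda>u::real. exp (- u)) has_integral (1 - exp (- U))) {0..U}" by simp
      then show ?thesis using U0 by (intro integral_unique has_integral_add has_integral_mult_right has_integral_u_exp)
    qed
    also have "\<dots> \<le> \<epsilon> * Y * 1 + C * 1"
      using \<epsilon> Y U0 by (intro add_mono mult_left_mono) auto
    finally have "norm (integral {0..m} r) \<le> Y * (\<epsilon> * Y * 1 + C * 1)" using Y by simp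
    then show ?thesis by (simp add: power2_eq_square algebra_simps)
  qed
  define Q where "Q = H + (ln Y + energy_const) * (1 - (1 + U) * exp (- U))"
  have "E = zeta_energy m * exp (- U) + (Y\<^sup>2 * Q + integral {0..m} r) / Y"
    unfolding E_def Q_def using Y m0 by (simp add: damped_energy_by_parts Gr damped_main_term U_def H_def)
  moreover have "(z + (Y\<^sup>2 * Q + R) / Y) / Y = z / Y + Q + R / Y\<^sup>2" for z R
    using Y by (simp add: field_simps power2_eq_square)
  ultimately have "E / Y = zeta_energy m * exp (- U) / Y + Q + integral {0..m} r / Y\<^sup>2" by simp
  then have "E / Y - ln Y - energy_const - H = zeta_energy m * exp (- U) / Y - (ln Y + energy_const) * ((1 + U) * exp (- U)) + integral {0..m} r / Y\<^sup>2"
    by (simp add: Q_def right_diff_distrib)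
  moreover have "\<bar>integral {0..m} r / Y\<^sup>2\<bar> \<le> \<epsilon> + C / Y"
  proof -
    have "\<bar>integral {0..m} r\<bar> / Y\<^sup>2 \<le> (\<epsilon> * Y\<^sup>2 + C * Y) / Y\<^sup>2" using rb by (intro divide_right_mono) auto
    also have "\<dots> = \<epsilon> + C / Y" using Y by (simp add: field_simps power2_eq_square)
    finally show ?thesis by simp
  qed
  moreover have "\<bar>(ln Y + energy_const) * ((1 + U) * exp (- U))\<bar> \<le> 2 * (\<bar>ln Y\<bar> + \<bar>energy_const\<bar>) * (2 * Y) powr (- 7)"
  proof -
    have "(1 + U) * exp (- U) \<le> (2 * exp (U / 2)) * exp (- U)" using one_plus_le_exp_half(2)[OF U0] by (intro mult_right_mono) auto
    also have "\<dots> = 2 * exp (- U / 2)" by (simp flip: exp_add)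
    finally have "(1 + U) * exp (- U) \<le> 2 * (2 * Y) powr (- 7)" using eU by linarith
    moreover have "0 \<le> (1 + U) * exp (- U)" using U0 by simp
    ultimately have "\<bar>ln Y + energy_const\<bar> * ((1 + U) * exp (- U)) \<le> (\<bar>ln Y\<bar> + \<bar>energy_const\<bar>) * (2 * (2 * Y) powr (- 7))"
      by (intro mult_mono[OF abs_triangle_ineq]) (assumption | simp)+
    then show ?thesis
      unfolding abs_mult[of "ln Y + energy_const" "(1 + U) * exp (- U)"] abs_of_nonneg[OF \<open>0 \<le> (1 + U) * exp (- U)\<close>]
      by (simp only: mult_ac)
  qed
  moreover have "\<bar>zeta_energy m * exp (- U) / Y\<bar> \<le> 16 * (zeta_energy 1 + 72) * Y * (2 * Y) powr (- 7)"
  proof -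
    have z1: "zeta_energy 1 \<ge> 0" by (rule zeta_energy_nonneg)
    have "zeta_energy m \<le> zeta_energy (max m 1)" using m0 by (intro zeta_energy_mono) auto
    also have "\<dots> \<le> zeta_energy 1 + 36 * (max m 1 + 1) * max m 1" by (intro zeta_energy_le) auto
    also have "\<dots> \<le> (zeta_energy 1 + 72) * (1 + m)\<^sup>2"
    proof -
      have "1 * 1 \<le> (1 + m)\<^sup>2" using m0 by (simp add: one_le_power)
      then have "zeta_energy 1 * 1 \<le> zeta_energy 1 * (1 + m)\<^sup>2" using z1 by (intro mult_left_mono) auto
      moreover have "(max m 1 + 1) * max m 1 \<le> (1 + m)\<^sup>2 * 2" 
        using m0 by (auto simp: max_def power2_eq_square algebra_simps)
      ultimately show ?thesis by (simp add: distrib_right mult.assoc)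
    qed
    also have "\<dots> \<le> (zeta_energy 1 + 72) * (Y * (1 + U))\<^sup>2"
    proof -
      have "1 + m \<le> Y * (1 + U)" using Y by (simp add: U_def distrib_left)
      then show ?thesis using z1 m0 by (intro mult_left_mono power_mono) auto
    qed
    also have "\<dots> = (zeta_energy 1 + 72) * (Y\<^sup>2 * (1 + U)\<^sup>2)" by (simp add: power_mult_distrib)
    also have "\<dots> \<le> (zeta_energy 1 + 72) * (Y\<^sup>2 * (16 * exp (U / 2)))"
      using z1 one_plus_le_exp_half(1)[OF U0] by (intro mult_left_mono) auto
    finally have "zeta_energy m * exp (- U) \<le> (zeta_energy 1 + 72) * (Y\<^sup>2 * (16 * exp (U / 2))) * exp (- U)"
      by (intro mult_right_mono) auto
    also have "\<dots> = 16 * (zeta_energy 1 + 72) * Y\<^sup>2 * (exp (U / 2) * exp (- U))" by simp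
    also have "exp (U / 2) * exp (- U) = exp (- U / 2)" by (simp flip: exp_add)
    also have "16 * (zeta_energy 1 + 72) * Y\<^sup>2 * exp (- U / 2) \<le> 16 * (zeta_energy 1 + 72) * Y\<^sup>2 * (2 * Y) powr (- 7)"
      using z1 by (intro mult_left_mono eU) auto
    finally have "zeta_energy m * exp (- U) / Y \<le> 16 * (zeta_energy 1 + 72) * Y\<^sup>2 * (2 * Y) powr (- 7) / Y"
      using Y by (intro divide_right_mono) auto
    also have "\<dots> = 16 * (zeta_energy 1 + 72) * Y * (2 * Y) powr (- 7)" using Y by (simp add: power2_eq_square)
    finally show ?thesis using zeta_energy_nonneg[of m] Y by simp
  qed
  ultimately show ?thesis unfolding H_def[symmetric] U_def[symmetric] by linarith
qed

lemma damped_energy_asymptotics: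
  fixes m :: "real \<Rightarrow> real"
  assumes m: "\<forall>\<^sub>F Y in at_top. m Y \<ge> 14 * Y * ln (2 * Y)"
    and K: "((\<lambda>U. integral {0..U} (\<lambda>u. u * ln u * exp (- u))) \<longlongrightarrow> K) at_top"
  shows "((\<lambda>Y. integral {0..m Y} (\<lambda>t. zsq t * exp (- (t / Y))) / Y - ln Y) \<longlongrightarrow> energy_const + K) at_top"
proof -
  define E where "E = (\<lambda>Y. integral {0..m Y} (\<lambda>t. zsq t * exp (- (t / Y))))"
  define H where "H = (\<lambda>Y. integral {0..m Y / Y} (\<lambda>u. u * ln u * exp (- u)))"
  have mY: "filterlim (\<lambda>Y. m Y / Y) at_top at_top"
  proof (rule filterlim_at_top_mono)
    show "filterlim (\<lambda>Y::real. 14 * ln (2 * Y)) at_top at_top" by real_asymp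
    show "\<forall>\<^sub>F Y in at_top. 14 * ln (2 * Y) \<le> m Y / Y"
      using m eventually_gt_at_top[of 0] by eventually_elim (simp add: field_simps)
  qed
  have H: "(H \<longlongrightarrow> K) at_top" unfolding H_def using filterlim_compose[OF K mY] .
  have "((\<lambda>Y. E Y / Y - ln Y - energy_const - H Y) \<longlongrightarrow> 0) at_top"
  proof (rule tendstoI)
    fix \<delta> :: real assume \<delta>: "\<delta> > 0"
    \<comment> \<open>\<open>C\<close> depends on the permitted slope of the error, so the slope is
      fixed before \<open>Y\<close> grows and \<open>C / Y\<close> vanishes afterwards.\<close>
    obtain C where C: "C \<ge> 0" "\<And>t. t \<ge> 0 \<Longrightarrow> \<bar>zeta_energy t - (t * ln t + energy_const * t)\<bar> \<le> \<delta> / 2 * t + C"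
      using energy_remainder_bound[of "\<delta> / 2"] \<delta> by auto
    define B where "B = (\<lambda>Y. C / Y + 16 * (zeta_energy 1 + 72) * Y * (2 * Y) powr (- 7) + 2 * (\<bar>ln Y\<bar> + \<bar>energy_const\<bar>) * (2 * Y) powr (- 7))"
    have "(B \<longlongrightarrow> 0) at_top" unfolding B_def by real_asymp
    then have "\<forall>\<^sub>F Y in at_top. B Y < \<delta> / 2" using \<delta> by (intro order_tendstoD) auto
    then show "\<forall>\<^sub>F Y in at_top. dist (E Y / Y - ln Y - energy_const - H Y) 0 < \<delta>"
      using m eventually_ge_at_top[of 1]
    proof eventually_elim
      case (elim Y)
      have "\<bar>E Y / Y - ln Y - energy_const - H Y\<bar> \<le> \<delta> / 2 + C / Y + 16 * (zeta_energy 1 + 72) * Y * (2 * Y) powr (- 7) + 2 * (\<bar>ln Y\<bar> + \<bar>energy_const\<bar>) * (2 * Y) powr (- 7)"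
        unfolding E_def H_def using C \<delta> elim by (intro damped_energy_estimate) auto
      then show ?case using elim(1) unfolding B_def dist_real_def by linarith
    qed
  qed
  from tendsto_add[OF this H] have "((\<lambda>Y. E Y / Y - ln Y - energy_const) \<longlongrightarrow> K) at_top" by simp
  from tendsto_add[OF tendsto_const[of energy_const] this] show ?thesis unfolding E_def by (simp add: algebra_simps)
qed

text \<open>A bootstrap. Monotonicity of the energy places \<open>Y'\<close> between
  \<open>Y\<close> and \<open>2 * Y\<close>. With \<open>v = Y' / Y\<close> the two-term expansion
  at \<open>Y'\<close> becomes an identity for \<open>(v - 1) * ln Y\<close>: its right side is
  bounded, so \<open>v\<close> tends to 1, and with this limit the same right side tends to
  \<open>K\<close>.\<close>

lemma ladder_step_asymptotics:
  fixes Y' :: "real \<Rightarrow> real"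
  assumes K: "K > 0" and pos: "\<forall>\<^sub>F Y in at_top. Y' Y \<ge> 0"
    and lim: "((\<lambda>Y. zeta_energy (Y' Y) / Y - ln Y) \<longlongrightarrow> energy_const + K) at_top"
  shows "\<forall>\<^sub>F Y in at_top. Y < Y' Y \<and> Y' Y < 2 * Y"
    and "((\<lambda>Y. (zeta_energy (Y' Y) - zeta_energy Y) / Y) \<longlongrightarrow> K) at_top"
    and "((\<lambda>Y. (Y' Y - Y) * ln Y / Y) \<longlongrightarrow> K) at_top"
proof -
  have G: "((\<lambda>T. zeta_energy T / T - ln T) \<longlongrightarrow> energy_const) at_top"
    unfolding energy_const_def by (rule zeta_energy_asymptotics)
  from tendsto_diff[OF lim G]
  show diff: "((\<lambda>Y. (zeta_energy (Y' Y) - zeta_energy Y) / Y) \<longlongrightarrow> K) at_top"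
    by (simp add: diff_divide_distrib)
  have ev1: "\<forall>\<^sub>F Y in at_top. (zeta_energy (Y' Y) - zeta_energy Y) / Y > 0"
    using order_tendstoD(1)[OF diff K] .
  \<comment> \<open>The energy at \<open>2 * Y\<close>, divided by \<open>Y\<close>, exceeds
    \<open>ln Y\<close> by about another \<open>ln Y\<close> and so outgrows the bounded quantity at
    \<open>Y'\<close>.\<close>
  have ev2: "\<forall>\<^sub>F Y in at_top. zeta_energy (Y' Y) / Y - ln Y < zeta_energy (2 * Y) / Y - ln Y"
  proof -
    have f2: "filterlim (\<lambda>Y::real. 2 * Y) at_top at_top" by real_asymp
    have "((\<lambda>Y. zeta_energy (2 * Y) / (2 * Y) - ln (2 * Y)) \<longlongrightarrow> energy_const) at_top"
      using filterlim_compose[OF G f2] .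
    then have "\<forall>\<^sub>F Y in at_top. zeta_energy (2 * Y) / (2 * Y) - ln (2 * Y) > energy_const - 1" by (intro order_tendstoD) auto
    moreover have "\<forall>\<^sub>F Y in at_top. zeta_energy (Y' Y) / Y - ln Y < energy_const + K + 1" using lim by (intro order_tendstoD) auto
    moreover have "\<forall>\<^sub>F Y::real in at_top. energy_const + K + 1 < 2 * energy_const - 2 + 2 * ln (2 * Y) - ln Y" by real_asymp
    ultimately show ?thesis using eventually_gt_at_top[of 0]
    proof eventually_elim
      case (elim Y)
      have "zeta_energy (2 * Y) / Y = 2 * (zeta_energy (2 * Y) / (2 * Y))" using elim by simp
      then show ?case using elim by linarith
    qed
  qed
  show bounds: "\<forall>\<^sub>F Y in at_top. Y < Y' Y \<and> Y' Y < 2 * Y"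
    using ev1 ev2 pos eventually_gt_at_top[of 0]
  proof eventually_elim
    case (elim Y)
    have "zeta_energy Y < zeta_energy (Y' Y)" using elim by (simp add: zero_less_divide_iff)
    then have 1: "Y < Y' Y" using zeta_energy_mono[of "Y' Y" Y] elim by (metis linorder_not_less)
    have "zeta_energy (Y' Y) < zeta_energy (2 * Y)" using elim by (simp add: divide_less_cancel)
    then have 2: "Y' Y < 2 * Y" using zeta_energy_mono[of "2 * Y" "Y' Y"] elim by (metis linorder_not_less mult_nonneg_nonneg less_imp_le zero_le_numeral)
    show ?case using 1 2 ..
  qed
  define v where "v = (\<lambda>Y. Y' Y / Y)"
  define g where "g = (\<lambda>Y. zeta_energy (Y' Y) / Y' Y - ln (Y' Y) - energy_const)"
  have Y'top: "filterlim Y' at_top at_top"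
    by (rule filterlim_at_top_mono[OF filterlim_ident]) (use bounds in \<open>auto elim: eventually_mono\<close>)
  have g0: "(g \<longlongrightarrow> 0) at_top"
    using tendsto_diff[OF filterlim_compose[OF G Y'top] tendsto_const[of energy_const]] by (simp add: g_def)
  have vb: "\<forall>\<^sub>F Y in at_top. 1 < v Y \<and> v Y < 2"
    using bounds eventually_gt_at_top[of 0] by eventually_elim (simp add: v_def field_simps)
  have id: "\<forall>\<^sub>F Y in at_top. (v Y - 1) * ln Y = (zeta_energy (Y' Y) / Y - ln Y) - v Y * ln (v Y) - v Y * energy_const - v Y * g Y"
    using bounds eventually_gt_at_top[of 0]
  proof eventually_elim
    case (elim Y)
    have Y: "Y > 0" "Y' Y > 0" using elim by auto
    have "v Y * (zeta_energy (Y' Y) / Y' Y) = zeta_energy (Y' Y) / Y" using Y by (simp add: v_def)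
    moreover have "ln (Y' Y) = ln Y + ln (v Y)" using Y by (simp add: v_def ln_div)
    ultimately show ?case by (simp add: g_def algebra_simps)
  qed
  have bounded: "\<forall>\<^sub>F Y in at_top. \<bar>(v Y - 1) * ln Y\<bar> \<le> \<bar>energy_const + K\<bar> + 1 + 2 + 2 * \<bar>energy_const\<bar> + 2"
  proof -
    have "\<forall>\<^sub>F Y in at_top. \<bar>zeta_energy (Y' Y) / Y - ln Y\<bar> < \<bar>energy_const + K\<bar> + 1"
      using tendsto_rabs[OF lim] by (intro order_tendstoD) auto
    moreover have "\<forall>\<^sub>F Y in at_top. \<bar>g Y\<bar> < 1" using tendsto_rabs[OF g0] by (intro order_tendstoD) auto
    ultimately show ?thesis using id vb
    proof eventually_elim
      case (elim Y)
      have "ln (v Y) \<le> v Y - 1" using elim by (intro ln_le_minus_one) auto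
      then have l: "ln (v Y) \<le> 1" "0 \<le> ln (v Y)" using elim by auto
      then have "v Y * ln (v Y) \<le> 2 * 1" using elim by (intro mult_mono) auto
      moreover have "0 \<le> v Y * ln (v Y)" using l elim by simp
      moreover have "\<bar>v Y * energy_const\<bar> \<le> 2 * \<bar>energy_const\<bar>" using elim by (simp add: abs_mult mult_right_mono)
      moreover have "\<bar>v Y * g Y\<bar> \<le> 2 * 1" unfolding abs_mult using elim by (intro mult_mono) auto
      ultimately show ?case using elim by linarith
    qed
  qed
  have v1: "((\<lambda>Y. v Y - 1) \<longlongrightarrow> 0) at_top"
  proof (rule Lim_null_comparison)
    define B where "B = \<bar>energy_const + K\<bar> + 1 + 2 + 2 * \<bar>energy_const\<bar> + 2"
    show "((\<lambda>Y. B / ln Y) \<longlongrightarrow> 0) at_top" by real_asymp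
    show "\<forall>\<^sub>F Y in at_top. norm (v Y - 1) \<le> B / ln Y"
      using bounded eventually_gt_at_top[of 1] unfolding B_def[symmetric]
    proof eventually_elim
      case (elim Y)
      then have "ln Y > 0" by simp
      then show ?case using elim(1) unfolding abs_mult by (simp add: pos_le_divide_eq)
    qed
  qed
  have v: "(v \<longlongrightarrow> 1) at_top" using tendsto_add[OF v1 tendsto_const[of 1]] by simp
  have "((\<lambda>Y. (zeta_energy (Y' Y) / Y - ln Y) - v Y * ln (v Y) - v Y * energy_const - v Y * g Y) \<longlongrightarrow>
      (energy_const + K) - 1 * ln 1 - 1 * energy_const - 1 * 0) at_top"
    by (intro tendsto_intros lim v g0) auto
  then have "((\<lambda>Y. (v Y - 1) * ln Y) \<longlongrightarrow> (energy_const + K) - 1 * ln 1 - 1 * energy_const - 1 * 0) at_top"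
    by (rule Lim_transform_eventually) (use id in \<open>auto elim: eventually_mono\<close>)
  then have "((\<lambda>Y. (v Y - 1) * ln Y) \<longlongrightarrow> K) at_top" by simp
  then show "((\<lambda>Y. (Y' Y - Y) * ln Y / Y) \<longlongrightarrow> K) at_top"
    by (rule Lim_transform_eventually) (auto intro!: eventually_mono[OF eventually_gt_at_top[of 0]] simp: v_def field_simps)
qed

section \<open>Existence and size of the reverse iterate\<close>

definition damped :: "(real \<Rightarrow> real) \<Rightarrow> real \<Rightarrow> real" where
  "damped \<mu> y = integral {0..\<mu> y} (\<lambda>t. zsq t * exp (- (2 * t / y)))"

lemma ladder_equation_iff: "ladder_equation \<mu> y T \<longleftrightarrow> damped \<mu> y = zeta_energy T"
  unfolding ladder_equation_def damped_def zeta_energy_zsq hardy_Z_squared zsq_def ..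

lemma damped_integrable: "y \<noteq> 0 \<Longrightarrow> (\<lambda>t. zsq t * exp (- (2 * t / y))) integrable_on {a..b}"
  by (intro integrable_continuous_real continuous_intros zsq_continuous) auto

text \<open>Enlarging \<open>y\<close> lengthens the interval and weakens the damping. Equality
  would force \<open>zsq\<close> to vanish on the interval up to \<open>\<mu> y1\<close> except at
  0, and then the smaller integral would be 0. Its assumed positivity thus stands in for knowledge
  about the zeros of zeta.\<close>

lemma damped_strict_mono:
  assumes \<mu>: "admissible \<mu> y0" and y: "y0 \<le> y1" "y1 < y2" and pos: "damped \<mu> y1 > 0"
  shows "damped \<mu> y1 < damped \<mu> y2"
proof -
  have y0: "y0 > 1" and \<mu>12: "\<mu> y1 \<le> \<mu> y2"
    using \<mu> y by (auto simp: admissible_def mono_on_def)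
  have y12: "y1 > 0" "y2 > 0" using y0 y by auto
  have \<mu>1: "\<mu> y1 > 0"
  proof (rule ccontr)
    assume "\<not> \<mu> y1 > 0"
    then have "{0..\<mu> y1} \<subseteq> {0}" by auto
    then have "damped \<mu> y1 = 0" unfolding damped_def
      by (intro integral_unique has_integral_negligible[where S = "{0}"]) auto
    then show False using pos by simp
  qed
  define d where "d = (\<lambda>t. zsq t * exp (- (2 * t / y2)) - zsq t * exp (- (2 * t / y1)))"
  have dnn: "d t \<ge> 0" if "t \<ge> 0" for t
  proof -
    have "2 * t / y2 \<le> 2 * t / y1" using y y12 that by (intro divide_left_mono) auto
    then show ?thesis unfolding d_def right_diff_distrib[symmetric] by (intro mult_nonneg_nonneg zsq_nonneg) auto
  qed
  have dc: "continuous_on {0..\<mu> y1} d"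
    unfolding d_def using y12 by (intro continuous_intros zsq_continuous) auto
  have di: "integral {0..\<mu> y1} d = integral {0..\<mu> y1} (\<lambda>t. zsq t * exp (- (2 * t / y2))) - damped \<mu> y1"
    unfolding d_def damped_def using y12 by (intro integral_diff damped_integrable) auto
  have "integral {0..\<mu> y1} d \<noteq> 0"
  proof
    assume "integral {0..\<mu> y1} d = 0"
    then have d0: "\<forall>t\<in>{0..\<mu> y1}. d t = 0"
      using integral_eq_0_iff[OF dc \<mu>1] dnn by auto
    have "zsq t = 0" if t: "t \<in> {0..\<mu> y1} - {0}" for t
    proof -
      have "2 * t / y2 < 2 * t / y1" using y y12 t by (intro divide_strict_left_mono) auto
      then have "exp (- (2 * t / y2)) - exp (- (2 * t / y1)) > 0" by simp
      moreover have "d t = 0" using d0 t by auto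
      then have "zsq t * (exp (- (2 * t / y2)) - exp (- (2 * t / y1))) = 0" unfolding d_def right_diff_distrib .
      ultimately show ?thesis by (metis less_irrefl mult_eq_0_iff)
    qed
    then have "damped \<mu> y1 = 0" unfolding damped_def
      by (intro integral_unique has_integral_negligible[where S = "{0}"]) auto
    then show False using pos by simp
  qed
  moreover have "integral {0..\<mu> y1} d \<ge> 0" using dnn dc by (intro integral_nonneg integrable_continuous_real) auto
  moreover have "integral {0..\<mu> y1} (\<lambda>t. zsq t * exp (- (2 * t / y2))) \<le> damped \<mu> y2"
    unfolding damped_def using \<mu>12 y12
    by (intro integral_subset_le damped_integrable) (auto intro: mult_nonneg_nonneg zsq_nonneg)
  ultimately show ?thesis using di by linarith
qed

lemma zeta_energy_at_top: "filterlim zeta_energy at_top at_top"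
proof -
  have "((\<lambda>T. zeta_energy T / T - ln T) \<longlongrightarrow> energy_const) at_top"
    unfolding energy_const_def by (rule zeta_energy_asymptotics)
  then have "\<forall>\<^sub>F T in at_top. zeta_energy T / T - ln T > energy_const - 1" by (intro order_tendstoD) auto
  then have "\<forall>\<^sub>F T in at_top. T * (ln T + energy_const - 1) \<le> zeta_energy T"
    using eventually_gt_at_top[of 0]
  proof eventually_elim
    case (elim T)
    then have "T * (ln T + energy_const - 1) \<le> T * (zeta_energy T / T)" by (intro mult_left_mono) auto
    then show ?case using elim by simp
  qed
  moreover have "filterlim (\<lambda>T::real. T * (ln T + energy_const - 1)) at_top at_top" by real_asymp
  ultimately show ?thesis using filterlim_at_top_mono by blast
qed

text \<open>Large \<open>Y\<close> must be shown to be attained before \<open>inv_into\<close> says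
  anything. Continuity of the energy provides \<open>T\<close> with energy
  \<open>damped \<mu> (2 * Y)\<close>, and strict monotonicity of \<open>damped\<close> forces
  \<open>\<phi> T = 2 * Y\<close>. The argument is \<open>2 * Y\<close> because the ladder is half
  of \<open>\<phi>\<close>; the damping becomes \<open>exp (- (t / Y))\<close>. The ladder equation
  at the reverse iterate then hands the asymptotics over to the energy.\<close>

lemma reverse_iterate_asymptotics:
  assumes "jacobs_ladder \<phi>\<^sub>1 T0" and K: "((\<lambda>U. integral {0..U} (\<lambda>u. u * ln u * exp (- u))) \<longlongrightarrow> K) at_top"
  shows "\<forall>\<^sub>F Y in at_top. reverse_iterate \<phi>\<^sub>1 T0 Y \<ge> 0"
    and "((\<lambda>Y. zeta_energy (reverse_iterate \<phi>\<^sub>1 T0 Y) / Y - ln Y) \<longlongrightarrow> energy_const + K) at_top"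
proof -
  obtain \<mu> y0 \<phi> where T0: "T0 > 0" and \<mu>: "admissible \<mu> y0"
    and \<phi>: "\<And>T. T \<ge> T0 \<Longrightarrow> y0 \<le> \<phi> T \<and> ladder_equation \<mu> (\<phi> T) T \<and> \<phi>\<^sub>1 T = \<phi> T / 2"
    using assms(1) unfolding jacobs_ladder_def by blast
  have y0ev: "\<forall>\<^sub>F Y in at_top. y0 \<le> 2 * Y" by real_asymp
  then have "\<forall>\<^sub>F Y in at_top. \<mu> (2 * Y) \<ge> 14 * Y * ln (2 * Y)"
  proof eventually_elim
    case (elim Y)
    then have "\<mu> (2 * Y) \<ge> 7 * (2 * Y) * ln (2 * Y)" using \<mu> unfolding admissible_def by blast
    then show ?case by simp
  qed
  from damped_energy_asymptotics[OF this K]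
  have lim: "((\<lambda>Y. damped \<mu> (2 * Y) / Y - ln Y) \<longlongrightarrow> energy_const + K) at_top"
    by (simp add: damped_def)
  then have "\<forall>\<^sub>F Y in at_top. damped \<mu> (2 * Y) / Y - ln Y > energy_const + K - 1" by (intro order_tendstoD) auto
  then have "\<forall>\<^sub>F Y in at_top. Y * (ln Y + (energy_const + K - 1)) \<le> damped \<mu> (2 * Y)"
    using eventually_gt_at_top[of 0]
  proof eventually_elim
    case (elim Y)
    then have "Y * (ln Y + (energy_const + K - 1)) \<le> Y * (damped \<mu> (2 * Y) / Y)" by (intro mult_left_mono) auto
    then show ?case using elim by simp
  qed
  moreover have "filterlim (\<lambda>Y::real. Y * (ln Y + (energy_const + K - 1))) at_top at_top" by real_asymp
  ultimately have "filterlim (\<lambda>Y. damped \<mu> (2 * Y)) at_top at_top"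
    by (rule filterlim_at_top_mono[rotated])
  \<comment> \<open>The 1 supplies the positivity for strict monotonicity, the energy at
    \<open>T0\<close> the lower end for the intermediate value theorem.\<close>
  then have big: "\<forall>\<^sub>F Y in at_top. damped \<mu> (2 * Y) \<ge> max 1 (zeta_energy T0)"
    unfolding filterlim_at_top by blast
  have key: "\<forall>\<^sub>F Y in at_top. reverse_iterate \<phi>\<^sub>1 T0 Y \<ge> 0 \<and> damped \<mu> (2 * Y) = zeta_energy (reverse_iterate \<phi>\<^sub>1 T0 Y)"
    using big y0ev
  proof eventually_elim
    case (elim Y)
    have "\<forall>\<^sub>F b in at_top. damped \<mu> (2 * Y) \<le> zeta_energy b"
      using zeta_energy_at_top unfolding filterlim_at_top by blast
    then have "\<forall>\<^sub>F b in at_top. damped \<mu> (2 * Y) \<le> zeta_energy b \<and> T0 \<le> b"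
      using eventually_ge_at_top[of T0] by eventually_elim auto
    then obtain b where b: "damped \<mu> (2 * Y) \<le> zeta_energy b" "T0 \<le> b"
      using eventually_happens'[OF trivial_limit_at_top_linorder] by blast
    have "continuous_on {T0..b} zeta_energy"
      using zeta_energy_continuous[of b] T0 by (rule_tac continuous_on_subset) auto
    then obtain T where T: "T \<ge> T0" "zeta_energy T = damped \<mu> (2 * Y)"
      using IVT'[of zeta_energy T0 "damped \<mu> (2 * Y)" b] b elim by auto
    have "\<phi> T = 2 * Y"
    proof (rule ccontr)
      assume ne: "\<phi> T \<noteq> 2 * Y"
      have eq: "damped \<mu> (\<phi> T) = damped \<mu> (2 * Y)" and ge: "y0 \<le> \<phi> T"
        using \<phi>[OF T(1)] T(2) by (simp_all add: ladder_equation_iff)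
      consider "\<phi> T < 2 * Y" | "2 * Y < \<phi> T" using ne by linarith
      then show False
        using damped_strict_mono[OF \<mu>, of "\<phi> T" "2 * Y"] damped_strict_mono[OF \<mu>, of "2 * Y" "\<phi> T"] eq ge elim
        by cases auto
    qed
    then have img: "Y \<in> \<phi>\<^sub>1 ` {T0..}" using \<phi>[OF T(1)] T(1) by force
    have r: "reverse_iterate \<phi>\<^sub>1 T0 Y \<in> {T0..}" "\<phi>\<^sub>1 (reverse_iterate \<phi>\<^sub>1 T0 Y) = Y"
      unfolding reverse_iterate_def by (rule inv_into_into[OF img], rule f_inv_into_f[OF img])
    then have "\<phi> (reverse_iterate \<phi>\<^sub>1 T0 Y) = 2 * Y" and "ladder_equation \<mu> (\<phi> (reverse_iterate \<phi>\<^sub>1 T0 Y)) (reverse_iterate \<phi>\<^sub>1 T0 Y)"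
      using \<phi>[of "reverse_iterate \<phi>\<^sub>1 T0 Y"] by auto
    then show ?case using r T0 by (simp add: ladder_equation_iff)
  qed
  then show "\<forall>\<^sub>F Y in at_top. reverse_iterate \<phi>\<^sub>1 T0 Y \<ge> 0" by eventually_elim auto
  show "((\<lambda>Y. zeta_energy (reverse_iterate \<phi>\<^sub>1 T0 Y) / Y - ln Y) \<longlongrightarrow> energy_const + K) at_top"
    using lim by (rule Lim_transform_eventually) (use key in \<open>auto elim: eventually_mono\<close>)
qed

section \<open>The limit of the functional\<close>

lemma zeta_real_sums:
  assumes "\<sigma> > 1/2"
  shows "(\<lambda>n. real (Suc n) powr (- 2 * \<sigma>)) sums Re (zeta (of_real (2 * \<sigma>)))" and "Re (zeta (of_real (2 * \<sigma>))) > 0"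
proof -
  have s: "complex_of_real (2 * \<sigma>) \<noteq> 1" "Re (complex_of_real (2 * \<sigma>)) > 1" using assms by (auto simp: complex_eq_iff)
  have "(\<lambda>n. 1 / of_nat (Suc n) powr complex_of_real (2 * \<sigma>)) sums zeta (of_real (2 * \<sigma>))"
    using zeta0_sums[OF s(2)] zeta_eq_zeta0[OF s(1)] s(2) by simp
  then have "(\<lambda>n. Re (1 / of_nat (Suc n) powr complex_of_real (2 * \<sigma>))) sums Re (zeta (of_real (2 * \<sigma>)))"
    by (rule sums_Re)
  moreover have "Re (1 / of_nat (Suc n) powr complex_of_real (2 * \<sigma>)) = real (Suc n) powr (- 2 * \<sigma>)" for n
  proof -
    have "(of_nat (Suc n) :: complex) powr of_real (2 * \<sigma>) = of_real (real (Suc n) powr (2 * \<sigma>))"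
      using powr_of_real[of "real (Suc n)" "2 * \<sigma>"] by simp
    then show ?thesis by (simp add: powr_minus divide_inverse flip: of_real_inverse)
  qed
  ultimately show S: "(\<lambda>n. real (Suc n) powr (- 2 * \<sigma>)) sums Re (zeta (of_real (2 * \<sigma>)))" by simp
  have "(\<Sum>n\<in>{..<1}. real (Suc n) powr (- 2 * \<sigma>)) \<le> (\<Sum>n. real (Suc n) powr (- 2 * \<sigma>))"
    by (intro sum_le_suminf sums_summable[OF S]) auto
  then show "Re (zeta (of_real (2 * \<sigma>))) > 0" using sums_unique[OF S] by simp
qed

text \<open>Divided by \<open>Y ln Y\<close>, by \<open>Y / ln Y\<close> and by \<open>Y\<close>
  respectively, the three integrals tend to 1, to \<open>K\<close> times
  \<open>zeta (2 * \<sigma>)\<close> and to \<open>K\<close>. The divisors combine to the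
  \<open>1 / Y\<close> of the statement.\<close>

lemma ladder_functional_tendsto:
  assumes lad: "jacobs_ladder \<phi>\<^sub>1 T0" and \<sigma>: "\<sigma> > 1/2"
  defines "Y' \<equiv> reverse_iterate \<phi>\<^sub>1 T0"
  shows "((\<lambda>Y. integral {1..Y} zsq / Y * integral {Y..Y' Y} (\<lambda>t. (norm (zeta (Complex \<sigma> t)))\<^sup>2) * inverse (integral {Y..Y' Y} zsq))
     \<longlongrightarrow> Re (zeta (of_real (2 * \<sigma>)))) at_top"
proof -
  define z2 where "z2 = Re (zeta (of_real (2 * \<sigma>)))"
  obtain K :: real where K: "K > 0" "((\<lambda>U. integral {0..U} (\<lambda>u. u * ln u * exp (- u))) \<longlongrightarrow> K) at_top"
    by (rule entropy_integral)
  note ri = reverse_iterate_asymptotics[OF lad K(2), folded Y'_def]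
  note ls = ladder_step_asymptotics[OF K(1) ri]
  define I where "I = (\<lambda>Y. integral {Y..Y' Y} (\<lambda>t. (norm (zeta (Complex \<sigma> t)))\<^sup>2))"
  define S where "S = (\<lambda>Y::real. \<Sum>n=1..nat \<lceil>2 * Y\<rceil>. real n powr (- 2 * \<sigma>))"
  have S: "(S \<longlongrightarrow> z2) at_top"
  proof -
    have "(\<lambda>N. \<Sum>n<N. real (Suc n) powr (- 2 * \<sigma>)) \<longlonglongrightarrow> z2"
      using zeta_real_sums(1)[OF \<sigma>] by (simp add: sums_def z2_def)
    moreover have "(\<Sum>n<N. real (Suc n) powr (- 2 * \<sigma>)) = (\<Sum>n=1..N. real n powr (- 2 * \<sigma>))" for N
      by (rule sum.reindex_bij_witness[of _ "\<lambda>n. n - 1" Suc]) auto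
    ultimately have 1: "(\<lambda>N. \<Sum>n=1..N. real n powr (- 2 * \<sigma>)) \<longlonglongrightarrow> z2" by simp
    have "filterlim (\<lambda>Y::real. real (nat \<lceil>2 * Y\<rceil>)) at_top at_top"
    proof (rule filterlim_at_top_mono)
      show "filterlim (\<lambda>Y::real. 2 * Y) at_top at_top" by real_asymp
      show "\<forall>\<^sub>F Y::real in at_top. 2 * Y \<le> real (nat \<lceil>2 * Y\<rceil>)" by (intro always_eventually allI) linarith
    qed
    then have "filterlim (\<lambda>Y::real. nat \<lceil>2 * Y\<rceil>) sequentially at_top"
      by (simp add: filterlim_sequentially_iff_filterlim_real)
    from filterlim_compose[OF 1 this] show ?thesis by (simp add: S_def)
  qed
  have Iasym: "((\<lambda>Y. I Y * ln Y / Y) \<longlongrightarrow> K * z2) at_top"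
  proof -
    obtain C p where p: "p < 1" and C: "\<And>Y Y'. Y \<ge> 1 \<Longrightarrow> Y \<le> Y' \<Longrightarrow> Y' \<le> 2 * Y \<Longrightarrow>
      \<bar>integral {Y..Y'} (\<lambda>t. (norm (zeta (Complex \<sigma> t)))\<^sup>2) - (Y' - Y) * (\<Sum>n=1..nat \<lceil>2 * Y\<rceil>. real n powr (- 2 * \<sigma>))\<bar>
      \<le> C * (1 + ln (3 * Y)) * Y powr p"
      by (rule mean_square_right_of_critical[OF \<sigma>], rule that)
    \<comment> \<open>The interval has length about \<open>K Y / ln Y\<close>, so an error of order
      \<open>Y powr p\<close> with \<open>p < 1\<close> is smaller even with logarithms.\<close>
    have "((\<lambda>Y. (I Y - (Y' Y - Y) * S Y) * ln Y / Y) \<longlongrightarrow> 0) at_top"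
    proof (rule Lim_null_comparison)
      show "((\<lambda>Y. C * (1 + ln (3 * Y)) * Y powr p * ln Y / Y) \<longlongrightarrow> 0) at_top" using p by real_asymp
      show "\<forall>\<^sub>F Y in at_top. norm ((I Y - (Y' Y - Y) * S Y) * ln Y / Y) \<le> C * (1 + ln (3 * Y)) * Y powr p * ln Y / Y"
        using ls(1) eventually_ge_at_top[of 1]
      proof eventually_elim
        case (elim Y)
        have "\<bar>I Y - (Y' Y - Y) * S Y\<bar> \<le> C * (1 + ln (3 * Y)) * Y powr p"
          unfolding I_def S_def using elim by (intro C) auto
        then have "\<bar>I Y - (Y' Y - Y) * S Y\<bar> * (ln Y / Y) \<le> C * (1 + ln (3 * Y)) * Y powr p * (ln Y / Y)"
          using elim by (intro mult_right_mono) auto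
        then show ?case using elim by (simp add: abs_mult)
      qed
    qed
    from tendsto_add[OF this tendsto_mult[OF ls(3) S]]
    show ?thesis
    proof (rule Lim_transform_eventually[where f = "\<lambda>Y. (I Y - (Y' Y - Y) * S Y) * ln Y / Y + (Y' Y - Y) * ln Y / Y * S Y", simplified add_0, THEN tendsto_eq_rhs])
    qed (auto intro!: eventually_mono[OF eventually_gt_at_top[of 0]] simp: field_simps)
  qed
  have E1: "((\<lambda>Y. integral {1..Y} zsq / (Y * ln Y)) \<longlongrightarrow> 1) at_top"
  proof -
    have G: "((\<lambda>T. zeta_energy T / T - ln T) \<longlongrightarrow> energy_const) at_top"
      unfolding energy_const_def by (rule zeta_energy_asymptotics)
    have "((\<lambda>Y::real. 1 / ln Y) \<longlongrightarrow> 0) at_top" "((\<lambda>Y::real. zeta_energy 1 / (Y * ln Y)) \<longlongrightarrow> 0) at_top" by real_asymp+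
    then have "((\<lambda>Y. (zeta_energy Y / Y - ln Y) * (1 / ln Y) + 1 - zeta_energy 1 / (Y * ln Y)) \<longlongrightarrow> energy_const * 0 + 1 - 0) at_top"
      by (intro tendsto_add tendsto_diff tendsto_mult G tendsto_const)
    then have "((\<lambda>Y. (zeta_energy Y / Y - ln Y) * (1 / ln Y) + 1 - zeta_energy 1 / (Y * ln Y)) \<longlongrightarrow> 1) at_top" by simp
    then show ?thesis
    proof (rule Lim_transform_eventually)
      show "\<forall>\<^sub>F Y in at_top. (zeta_energy Y / Y - ln Y) * (1 / ln Y) + 1 - zeta_energy 1 / (Y * ln Y) = integral {1..Y} zsq / (Y * ln Y)"
        using eventually_gt_at_top[of 1]
      proof eventually_elim
        case (elim Y)
        then have "ln Y > 0" by simp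
        have "integral {1..Y} zsq = zeta_energy Y - zeta_energy 1"
          using zeta_energy_combine[of 1 Y] elim by (simp add: zsq_def[abs_def])
        then show ?case using elim \<open>ln Y > 0\<close> by (simp add: field_simps)
      qed
    qed
  qed
  have "((\<lambda>Y. integral {1..Y} zsq / (Y * ln Y) * (I Y * ln Y / Y) * inverse ((zeta_energy (Y' Y) - zeta_energy Y) / Y)) \<longlongrightarrow> 1 * (K * z2) * inverse K) at_top"
    using K(1) by (intro tendsto_mult tendsto_inverse E1 Iasym ls(2)) auto
  moreover have "1 * (K * z2) * inverse K = z2" using K(1) by simp
  ultimately have "((\<lambda>Y. integral {1..Y} zsq / (Y * ln Y) * (I Y * ln Y / Y) * inverse ((zeta_energy (Y' Y) - zeta_energy Y) / Y)) \<longlongrightarrow> z2) at_top" by (simp only:)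
  then have "((\<lambda>Y. integral {1..Y} zsq / Y * I Y * inverse (integral {Y..Y' Y} zsq)) \<longlongrightarrow> z2) at_top"
  proof (rule Lim_transform_eventually)
    show "\<forall>\<^sub>F Y in at_top. integral {1..Y} zsq / (Y * ln Y) * (I Y * ln Y / Y) * inverse ((zeta_energy (Y' Y) - zeta_energy Y) / Y) =
      integral {1..Y} zsq / Y * I Y * inverse (integral {Y..Y' Y} zsq)"
      using ls(1) eventually_gt_at_top[of 1]
    proof eventually_elim
      case (elim Y)
      then have "ln Y > 0" by simp
      have "zeta_energy (Y' Y) - zeta_energy Y = integral {Y..Y' Y} zsq"
        using zeta_energy_combine[of Y "Y' Y"] elim by (simp add: zsq_def[abs_def])
      then show ?case using elim \<open>ln Y > 0\<close> by (simp add: field_simps)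
    qed
  qed
  then show ?thesis unfolding I_def z2_def .
qed

text \<open>In the variable \<open>Y = q * \<tau> / z2\<close> the factor \<open>1 / \<tau>\<close>
  is \<open>q / z2\<close> divided by \<open>Y\<close>, and the value \<open>z2\<close> of zeta
  cancels against the limit along the ladder. Positivity of \<open>q\<close> is what sends
  \<open>Y\<close> to infinity with \<open>\<tau>\<close>.\<close>

lemma fermat_functional_tendsto:
  assumes lad: "jacobs_ladder \<phi>\<^sub>1 T0" and \<sigma>: "\<sigma> > 1/2" and q: "fermat_rational x y z n > 0"
  shows "(fermat_functional \<phi>\<^sub>1 T0 \<sigma> x y z n \<longlongrightarrow> fermat_rational x y z n) at_top"
proof -
  define q where "q = fermat_rational x y z n"
  define z2 where "z2 = Re (zeta (of_real (2 * \<sigma>)))"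
  have z2: "z2 > 0" unfolding z2_def using zeta_real_sums(2)[OF \<sigma>] .
  have q0: "q > 0" using q by (simp add: q_def)
  define V where "V = (\<lambda>Y. integral {1..Y} zsq / Y * integral {Y..reverse_iterate \<phi>\<^sub>1 T0 Y} (\<lambda>t. (norm (zeta (Complex \<sigma> t)))\<^sup>2) * inverse (integral {Y..reverse_iterate \<phi>\<^sub>1 T0 Y} zsq))"
  have V: "(V \<longlongrightarrow> z2) at_top" unfolding V_def z2_def by (rule ladder_functional_tendsto[OF lad \<sigma>])
  have "filterlim (\<lambda>\<tau>. q * \<tau> / z2) at_top at_top" using q0 z2 by real_asymp
  from filterlim_compose[OF V this] have "((\<lambda>\<tau>. q / z2 * V (q * \<tau> / z2)) \<longlongrightarrow> q / z2 * z2) at_top"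
    by (intro tendsto_mult tendsto_const)
  then have "((\<lambda>\<tau>. q / z2 * V (q * \<tau> / z2)) \<longlongrightarrow> q) at_top" using z2 by simp
  then show ?thesis unfolding q_def[symmetric]
  proof (rule Lim_transform_eventually)
    show "\<forall>\<^sub>F \<tau> in at_top. q / z2 * V (q * \<tau> / z2) = fermat_functional \<phi>\<^sub>1 T0 \<sigma> x y z n \<tau>"
      using eventually_gt_at_top[of 0]
    proof eventually_elim
      case (elim \<tau>)
      have "q / z2 * (a / (q * \<tau> / z2) * b * c) = 1 / \<tau> * a * b * c" for a b c
        using elim q0 z2 by (simp add: field_simps)
      then show ?case
        unfolding V_def fermat_functional_def Let_def q_def[symmetric] z2_def[symmetric] zsq_def[abs_def] by simp
    qed
  qed
qed

lemma fermat_rational_eq_1_iff: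
  assumes "z > 0"
  shows "fermat_rational x y z n = 1 \<longleftrightarrow> x ^ n + y ^ n = z ^ n"
proof -
  have "fermat_rational x y z n = 1 \<longleftrightarrow> real (x ^ n + y ^ n) = real (z ^ n)"
    using assms by (auto simp: fermat_rational_def field_simps)
  then show ?thesis by (simp only: of_nat_eq_iff)
qed

text \<open>The limit is the Fermat rational itself, so it equals 1 exactly at a solution, quadruple
  by quadruple. Convergence is a conjunct of its own because \<open>Lim\<close> is a definite
  description and denotes an unspecified value where no limit exists.\<close>

theorem theorem2:
  fixes \<phi>\<^sub>1 :: "real \<Rightarrow> real" and T0 \<epsilon> \<sigma> :: real
  assumes "jacobs_ladder \<phi>\<^sub>1 T0" and "\<epsilon> > 0" and "\<sigma> \<ge> 1/2 + \<epsilon>"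
  shows "(\<forall>(x::nat) (y::nat) (z::nat) (n::nat). x > 0 \<and> y > 0 \<and> z > 0 \<and> n \<ge> 3 \<longrightarrow>
            (\<exists>l. (fermat_functional \<phi>\<^sub>1 T0 \<sigma> x y z n \<longlongrightarrow> l) at_top)) \<and>
         ((\<forall>(x::nat) (y::nat) (z::nat) (n::nat). x > 0 \<and> y > 0 \<and> z > 0 \<and> n \<ge> 3 \<longrightarrow>
            fermat_limit \<phi>\<^sub>1 T0 \<sigma> x y z n \<noteq> 1)
          \<longleftrightarrow> \<not> (\<exists>(x::nat) (y::nat) (z::nat) (n::nat).
                   x > 0 \<and> y > 0 \<and> z > 0 \<and> n \<ge> 3 \<and> x ^ n + y ^ n = z ^ n))"
proof -
  have \<sigma>: "\<sigma> > 1/2" using assms by linarith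
  have lim: "(fermat_functional \<phi>\<^sub>1 T0 \<sigma> x y z n \<longlongrightarrow> fermat_rational x y z n) at_top"
    if "x > 0" "y > 0" "z > 0" for x y z n :: nat
    using that by (intro fermat_functional_tendsto assms(1) \<sigma>) (simp add: fermat_rational_def add_pos_pos)
  have eq: "fermat_limit \<phi>\<^sub>1 T0 \<sigma> x y z n = 1 \<longleftrightarrow> x ^ n + y ^ n = z ^ n"
    if "x > 0" "y > 0" "z > 0" for x y z n :: nat
    unfolding fermat_limit_def tendsto_Lim[OF trivial_limit_at_top_linorder lim[OF that]]
    using that(3) by (rule fermat_rational_eq_1_iff)
  show ?thesis
  proof (intro conjI allI impI)
    show "\<exists>l. (fermat_functional \<phi>\<^sub>1 T0 \<sigma> x y z n \<longlongrightarrow> l) at_top"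
      if "x > 0 \<and> y > 0 \<and> z > 0 \<and> n \<ge> 3" for x y z n
      using lim[of x y z n] that by (intro exI) auto
  qed (metis eq)
qed

end
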